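(* For every integer $d\geq 2$ one has $$\frac{d^{3/2}}{\sqrt{2\pi e}}\ \leq\ \mathrm{vein}(\mathbf{B}_2^d)\ \leq\ 2\,d^{3/2},$$ where $\mathbf{B}_2^d$ denotes the Euclidean unit ball in $\mathbb{R}^d$. Moreover, if $d=2$ or $d=3$, then $\mathrm{vein}(\mathbf{B}_2^d)=2\,d^{3/2}$.
   Context: A convex body in $\mathbb{R}^d$ is a compact convex set with non-empty interior; it is $0$-symmetric if it is symmetric about the origin $0$. For a $0$-symmetric convex body $\mathbf{K}\subset\mathbb{R}^d$, $d\ge 2$, let $\|x\|_{\mathbf{K}}=\inf\{\lambda>0 : x\in\lambda\mathbf{K}\}$ be the norm with unit ball $\mathbf{K}$. The vertex index of $\mathbf{K}$ is $$\mathrm{vein}(\mathbf{K})=\inf\Big\{\sum_i\|p_i\|_{\mathbf{K}} : \mathbf{K}\subset\mathrm{conv}\{p_i\}\Big\},$$ where the infimum is over all finite families of points $p_1,\dots,p_n\in\mathbb{R}^d$ whose convex hull contains $\mathbf{K}$. *)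

theory Defs
  imports "HOL-Analysis.Analysis"
begin

definition symmetric_convex_body :: "'a::euclidean_space set \<Rightarrow> bool" where
  "symmetric_convex_body K \<longleftrightarrow>
     compact K \<and> convex K \<and> interior K \<noteq> {} \<and> uminus ` K = K"

(* The norm with unit ball K, meant for K satisfying symmetric_convex_body.
   The set is then non-empty for every x, so the real-valued Inf is a genuine infimum. *)
definition body_norm :: "'a::euclidean_space set \<Rightarrow> 'a \<Rightarrow> real" where
  "body_norm K x = Inf {l. l > 0 \<and> x \<in> (\<lambda>y. l *\<^sub>R y) ` K}"

(* Finite families, possibly with repetitions, are functions restricted to {..<n} with n arbitrary.
   For a symmetric convex body K the set is non-empty (K is bounded, hence contained in a polytope)
   and bounded below by 0, so here too Inf is a genuine infimum. *)
definition vein :: "'a::euclidean_space set \<Rightarrow> real" where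
  "vein K = Inf {(\<Sum>i<n. body_norm K (p i)) | (n::nat) (p::nat \<Rightarrow> 'a).
                   K \<subseteq> convex hull (p ` {..<n})}"

lemma symmetric_convex_body_cball: "symmetric_convex_body (cball (0::'a::euclidean_space) 1)"
proof -
  have "uminus ` cball (0::'a) 1 = cball 0 1"
  proof
    show "uminus ` cball (0::'a) 1 \<subseteq> cball 0 1"
      by auto
    show "cball (0::'a) 1 \<subseteq> uminus ` cball 0 1"
    proof
      fix x :: 'a assume "x \<in> cball 0 1"
      then have "- x \<in> cball 0 1" by simp
      then show "x \<in> uminus ` cball 0 1" by (metis image_eqI minus_minus)
    qed
  qed
  then show ?thesis
    by (simp add: symmetric_convex_body_def)
qed

end

theory Submission
  imports Defs
begin

text \<open>Lower bound in general: by Caratheodory's argument the ball lies in the union of the simplices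
  spanned by the origin and \<open>d\<close> of the points, so Hadamard's inequality bounds its volume by
  \<open>e\<^sub>d / d!\<close>, where \<open>e\<^sub>d \<le> S ^ d / d!\<close> is the elementary symmetric polynomial of the norms
  and \<open>S\<close> their sum. The inscribed cube has volume \<open>(2 / sqrt d) ^ d\<close>. Upper bound: the
  cross-polytope.

  Dimension two: a point at distance \<open>r\<close> takes care of an arc of length \<open>2 arccos (1 / r)\<close>, the arcs
  cover the circle, and the secant is convex.

  Dimension three: let \<open>P\<close> be the convex hull, with \<open>n\<close> vertices. The normal cones of the vertices
  cover space, and the one at a vertex \<open>v\<close> of degree \<open>k\<close> lies in the cone over the cap of directions
  whose inner product with \<open>v\<close> is at least one. Among \<open>k\<close>-gons in a cap the regular inscribed one
  is the largest, so the solid angles give \<open>\<Sum> k arctan (tan (pi/k) / norm v) \<le> pi (n - 2)\<close>. For at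
  least eight vertices the areas of the caps already suffice. For fewer vertices the summand is
  bounded below by a function linear in \<open>k\<close> and \<open>norm v\<close>, and the degrees are controlled by counting
  pairs of vertices that do not span an edge: by Radon's theorem there is such a pair among any five
  vertices, and if there are six vertices there are three such pairs, as for the octahedron, which
  is the extremal case.\<close>

text \<open>Spherical area is expressed through volume: the share of the unit ball inside a cone is
  its solid angle divided by \<open>4 * pi\<close>, so \<open>2 * pi\<close> times the measure is
  half of the area. The planar case uses the same measure, through wedges that contain the vertical
  axis. At a single vertex neither the degree nor the norm is known; only totals can be controlled.
  Hence the lower bounds linear in both: summed over the vertices, the degrees become an edge count
  and the norms the quantity sought. The octahedron has to give equality throughout, which fixes the
  slope and the contact point for six vertices; all other constants only need some margin. The
  comparison with a regular polygon cuts a cell into triangles around the axis through its vertex,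
  so it presupposes that this axis is interior to the cell. Cells that miss their axis are bounded
  separately, independently of the degree.\<close>

text \<open>The library computes volumes of linear images only over well-ordered index types.\<close>

typedef 'a ordered_copy = "UNIV :: 'a set" ..

text \<open>Any injection into the naturals serves: the order pulled back along it is a well-order,
  whatever the choice.\<close>

definition copy_index :: "'a::finite ordered_copy \<Rightarrow> nat" where
  "copy_index = (SOME f. inj f)"

instance ordered_copy :: (finite) finite
proof
  show "finite (UNIV :: 'a ordered_copy set)"
    unfolding type_definition.univ[OF type_definition_ordered_copy] by (intro finite_imageI) simp
qed

lemma inj_copy_index: "inj copy_index"
proof -
  have "\<exists>f::'a ordered_copy \<Rightarrow> nat. inj f"
    using finite_imp_inj_to_nat_seg[OF finite[of UNIV]] by blast
  then show ?thesis unfolding copy_index_def by (rule someI_ex)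
qed

instantiation ordered_copy :: (finite) wellorder
begin

definition less_eq_ordered_copy :: "'a ordered_copy \<Rightarrow> 'a ordered_copy \<Rightarrow> bool" where
  "less_eq_ordered_copy x y \<longleftrightarrow> copy_index x \<le> copy_index y"

definition less_ordered_copy :: "'a ordered_copy \<Rightarrow> 'a ordered_copy \<Rightarrow> bool" where
  "less_ordered_copy x y \<longleftrightarrow> copy_index x < copy_index y"

instance
proof
  fix x y :: "'a ordered_copy"
  assume "x \<le> y" "y \<le> x"
  then show "x = y"
    using inj_copy_index by (auto simp: less_eq_ordered_copy_def inj_def)
next
  fix P :: "'a ordered_copy \<Rightarrow> bool" and a :: "'a ordered_copy"
  assume step: "\<And>x. (\<And>y. y < x \<Longrightarrow> P y) \<Longrightarrow> P x"
  show "P a"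
    by (induction a rule: measure_induct[of copy_index]) (rule step, simp add: less_ordered_copy_def)
qed (auto simp: less_eq_ordered_copy_def less_ordered_copy_def)

end

lemma card_ordered_copy: "CARD('a::finite ordered_copy) = CARD('a)"
  using type_definition.card[OF type_definition_ordered_copy, where 'a = 'a] .

text \<open>A linear isometry preserves the unit ball and all norms, so coverings move freely
  between spaces of equal dimension: to an ordered index type for the volume bound, and to
  \<open>real^2\<close> or \<open>real^3\<close> for the sharp cases, where only the cardinality of
  the index type is given.\<close>

lemma hull_isometric_copy:
  fixes V :: "'a::euclidean_space set"
  assumes fin: "finite V" and ball: "cball 0 1 \<subseteq> convex hull V" and dim: "DIM('a) = DIM('b::euclidean_space)"
  obtains W :: "'b::euclidean_space set" where "finite W" "cball 0 1 \<subseteq> convex hull W" "sum norm W = sum norm V"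
proof -
  obtain f :: "'a \<Rightarrow> 'b::euclidean_space" and g where f: "linear f" "linear g" "f ` UNIV = UNIV" "g ` UNIV = UNIV"
    "\<And>x. x \<in> UNIV \<Longrightarrow> norm (f x) = norm x" "\<And>x. x \<in> UNIV \<Longrightarrow> norm (g x) = norm x"
    "\<And>x. x \<in> UNIV \<Longrightarrow> g (f x) = x" "\<And>x. x \<in> UNIV \<Longrightarrow> f (g x) = x"
    by (rule isometries_subspaces[of "UNIV :: 'a set" "UNIV :: 'b set"]) (use dim in auto)
  have inj: "inj f" using f(7) by (metis UNIV_I injI)
  show ?thesis
  proof (rule that[of "f ` V"])
    have "x \<in> f ` (convex hull V)" if "x \<in> cball 0 1" for x
    proof -
      have "g x \<in> convex hull V" using ball that f(6)[of x] by (auto simp: subset_iff)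
      then show ?thesis using f(8)[of x] by (metis UNIV_I imageI)
    qed
    then show "cball 0 1 \<subseteq> convex hull (f ` V)"
      using convex_hull_linear_image[OF f(1), of V] by blast
    show "sum norm (f ` V) = sum norm V"
      using inj_on_subset[OF inj subset_UNIV] f(5) by (simp add: sum.reindex)
  qed (use fin in simp)
qed

subsection \<open>Hadamard's inequality and volumes of simplices\<close>

text \<open>Gram-Schmidt without normalization: each new row loses its projection onto the span of
  the rows treated before. This is a row operation, so the determinant stays, and by Pythagoras the
  row does not get longer.\<close>

lemma orthogonalize_rows:
  fixes A :: "real^'n^'n"
  assumes "finite T"
  shows "\<exists>B. det B = det A \<and> (\<forall>i. norm (row i B) \<le> norm (row i A)) \<and>
    (\<forall>i\<in>T. \<forall>j\<in>T. i \<noteq> j \<longrightarrow> row i B \<bullet> row j B = 0)"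
  using assms
proof (induction T rule: finite_induct)
  case empty
  then show ?case by auto
next
  case (insert t T)
  then obtain B where B: "det B = det A" "\<forall>i. norm (row i B) \<le> norm (row i A)"
    "\<forall>i\<in>T. \<forall>j\<in>T. i \<noteq> j \<longrightarrow> row i B \<bullet> row j B = 0" by blast
  define R where "R = (\<lambda>i. row i B) ` T"
  obtain y z where yz: "y \<in> span R" "\<And>w. w \<in> span R \<Longrightarrow> orthogonal z w" "row t B = y + z"
    by (rule orthogonal_subspace_decomp_exists[of R "row t B"]) blast
  define C where "C = (\<chi> k. if k = t then row t B + (- y) else row k B)"
  have "R \<subseteq> {row j B |j. j \<noteq> t}" using insert.hyps(2) by (auto simp: R_def)
  then have "y \<in> span {row j B |j. j \<noteq> t}" using yz(1) span_mono by blast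
  then have "- y \<in> vec.span {row j B |j. j \<noteq> t}" by (simp add: span_vec_eq span_neg)
  then have dC: "det C = det B" unfolding C_def by (rule det_row_span)
  have rC: "row k C = (if k = t then z else row k B)" for k
    using yz(3) by (simp add: row_def C_def vec_eq_iff)
  have "norm z \<le> norm (row t B)"
  proof -
    have "orthogonal y z" using yz(2)[OF yz(1)] by (simp add: orthogonal_commute)
    then have "(norm (row t B))\<^sup>2 = (norm y)\<^sup>2 + (norm z)\<^sup>2"
      unfolding yz(3) by (rule norm_add_Pythagorean)
    then have "(norm z)\<^sup>2 \<le> (norm (row t B))\<^sup>2" by simp
    then show ?thesis by (rule power2_le_imp_le) simp
  qed
  then have "norm (row i C) \<le> norm (row i A)" for i
    using order_trans[of "norm z" "norm (row t B)" "norm (row t A)"] B(2) by (simp add: rC)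
  moreover have "z \<bullet> row i B = 0" if "i \<in> T" for i
    using yz(2)[of "row i B"] that by (auto simp: R_def span_base orthogonal_def)
  then have "\<forall>i\<in>insert t T. \<forall>j\<in>insert t T. i \<noteq> j \<longrightarrow> row i C \<bullet> row j C = 0"
    using B(3) by (auto simp: rC inner_commute)
  ultimately show ?case using B(1) dC by (intro exI[of _ C]) auto
qed

text \<open>For orthogonal rows \<open>B ** transpose B\<close> is diagonal with the squared norms
  as entries, so equality holds; orthogonalization reduces to this case.\<close>

lemma Hadamard_inequality:
  fixes A :: "real^'n^'n"
  shows "\<bar>det A\<bar> \<le> (\<Prod>i\<in>UNIV. norm (row i A))"
proof -
  obtain B where B: "det B = det A" "\<And>i. norm (row i B) \<le> norm (row i A)"
    "\<And>i j. i \<noteq> j \<Longrightarrow> row i B \<bullet> row j B = 0"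
    using orthogonalize_rows[of UNIV A] by auto
  have e: "(B ** transpose B) $ i $ j = row i B \<bullet> row j B" for i j
    by (simp add: matrix_matrix_mult_def transpose_def row_def inner_vec_def)
  have "(det B)\<^sup>2 = det (B ** transpose B)" by (simp add: det_mul power2_eq_square)
  also have "\<dots> = (\<Prod>i\<in>UNIV. (B ** transpose B) $ i $ i)"
    by (rule det_diagonal) (simp add: e B(3))
  also have "\<dots> = (\<Prod>i\<in>UNIV. norm (row i B))\<^sup>2"
    by (simp add: e power2_norm_eq_inner prod_power_distrib)
  finally have "\<bar>det B\<bar> = (\<Prod>i\<in>UNIV. norm (row i B))"
    by (metis abs_of_nonneg norm_ge_zero power2_abs power2_eq_iff_nonneg abs_ge_zero prod_nonneg)
  also have "\<dots> \<le> (\<Prod>i\<in>UNIV. norm (row i A))" by (intro prod_mono) (auto simp: B(2))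
  finally show ?thesis by (simp add: B(1))
qed

text \<open>For finite \<open>I\<close> this is the convex hull of \<open>I\<close> and the origin;
  the slack \<open>1 - sum c I\<close> is the weight of the origin.\<close>

definition corner_simplex :: "'a::real_vector set \<Rightarrow> 'a set" where
  "corner_simplex I = {\<Sum>v\<in>I. c v *\<^sub>R v | c. (\<forall>v\<in>I. 0 \<le> c v) \<and> sum c I \<le> 1}"

text \<open>The matrix whose columns are the points of \<open>I\<close> maps the standard simplex,
  of volume \<open>1 / d!\<close>, onto this set, and Hadamard bounds the determinant. For dependent
  points the determinant is zero.\<close>

lemma measure_corner_simplex:
  fixes I :: "(real^'n::{finite,wellorder}) set"
  assumes "card I = CARD('n)"
  shows "corner_simplex I \<in> lmeasurable"
    and "measure lebesgue (corner_simplex I) \<le> (\<Prod>v\<in>I. norm v) / fact CARD('n)"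
proof -
  have "finite I" using assms by (intro card_ge_0_finite) simp
  then obtain h :: "'n \<Rightarrow> (real,'n) vec" where h: "bij_betw h UNIV I"
    using finite_same_card_bij[of "UNIV :: 'n set" I] assms by auto
  define A :: "((real,'n) vec,'n) vec" where "A = (\<chi> i. h i)"
  define S where "S = (convex hull (insert 0 Basis) :: ((real,'n) vec) set)"
  have S_eq: "S = {x. (\<forall>i. 0 \<le> x$i) \<and> (\<Sum>i\<in>UNIV. x$i) \<le> 1}"
  proof -
    have b: "(\<Sum>i\<in>Basis. x \<bullet> i) = (\<Sum>i\<in>UNIV. x$i)" for x :: "(real,'n) vec"
      by (simp add: Basis_vec_def sum.UNION_disjoint inner_axis axis_eq_axis)
    show ?thesis unfolding S_def std_simplex b by (auto simp: Basis_vec_def inner_axis)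
  qed
  define T where "T x = transpose A *v x" for x
  have T: "T x = (\<Sum>i\<in>UNIV. x$i *\<^sub>R h i)" for x
    by (simp add: T_def matrix_mult_sum column_transpose A_def scalar_mult_eq_scaleR row_def)
  have im: "corner_simplex I = T ` S"
  proof (intro equalityI subsetI)
    fix y assume "y \<in> corner_simplex I"
    then obtain c where c: "y = (\<Sum>v\<in>I. c v *\<^sub>R v)" "\<forall>v\<in>I. 0 \<le> c v" "sum c I \<le> 1"
      by (auto simp: corner_simplex_def)
    have "y = T (\<chi> i. c (h i))" unfolding T c(1) by (simp add: sum.reindex_bij_betw[OF h, symmetric])
    moreover have "(\<chi> i. c (h i)) \<in> S"
      using c(2,3) bij_betwE[OF h] by (simp add: S_eq sum.reindex_bij_betw[OF h])
    ultimately show "y \<in> T ` S" by blast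
  next
    fix y assume "y \<in> T ` S"
    then obtain x where x: "y = T x" "\<forall>i. 0 \<le> x$i" "(\<Sum>i\<in>UNIV. x$i) \<le> 1" by (auto simp: S_eq)
    define c where "c v = x $ (inv_into UNIV h v)" for v
    have ch: "c (h i) = x$i" for i using h by (simp add: c_def bij_betw_def)
    have "y = (\<Sum>v\<in>I. c v *\<^sub>R v)"
      unfolding x(1) T by (simp add: sum.reindex_bij_betw[OF h, symmetric] ch)
    moreover have "sum c I \<le> 1" using x(3) by (simp add: sum.reindex_bij_betw[OF h, symmetric] ch)
    moreover have "\<forall>v\<in>I. 0 \<le> c v" using x(2) by (simp add: c_def)
    ultimately show "y \<in> corner_simplex I" by (auto simp: corner_simplex_def)
  qed
  have cS: "compact S" unfolding S_def by (intro finite_imp_compact_convex_hull) simp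
  have lin: "linear T" unfolding T_def by (rule matrix_vector_mul_linear)
  show "corner_simplex I \<in> lmeasurable"
    unfolding im using cS lin
    by (intro lmeasurable_compact compact_continuous_image linear_continuous_on) (simp_all add: linear_linear)
  have "measure lebesgue (T ` S) = \<bar>det (matrix T)\<bar> * measure lebesgue S"
    using cS lin by (intro measure_linear_image lmeasurable_compact)
  also have "matrix T = transpose A" unfolding T_def by (rule matrix_of_matrix_vector_mul)
  also have "measure lebesgue S = 1 / fact CARD('n)"
    using content_std_simplex[where 'a = "(real,'n) vec"] cS unfolding S_def
    by (simp add: measure_completion borel_compact)
  also have "\<bar>det (transpose A)\<bar> = \<bar>det A\<bar>" by simp
  also have "\<bar>det A\<bar> * (1 / fact CARD('n)) \<le> (\<Prod>i\<in>UNIV. norm (row i A)) * (1 / fact CARD('n))"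
    by (intro mult_right_mono Hadamard_inequality) simp
  also have "(\<Prod>i\<in>UNIV. norm (row i A)) = (\<Prod>v\<in>I. norm v)"
    by (simp add: A_def row_def prod.reindex_bij_betw[OF h, of norm])
  finally show "measure lebesgue (corner_simplex I) \<le> (\<Prod>v\<in>I. norm v) / fact CARD('n)"
    by (simp add: im)
qed

text \<open>A representation with minimal support is linearly independent: subtracting a multiple of a
  linear dependency with nonnegative coefficient sum would remove a point without increasing the
  sum of the coefficients.\<close>

lemma corner_simplex_independent:
  assumes fin: "finite V" and x: "x \<in> corner_simplex V"
  obtains I where "I \<subseteq> V" "independent I" "x \<in> corner_simplex I"
proof -
  have "\<exists>I\<subseteq>V. independent I \<and> x \<in> corner_simplex I" using fin x
  proof (induction V rule: finite_psubset_induct)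
    case (psubset V)
    show ?case
    proof (cases "independent V")
      case True
      then show ?thesis using psubset.prems by blast
    next
      case False
      then obtain u0 v0 where u0: "(\<Sum>v\<in>V. u0 v *\<^sub>R v) = 0" "v0 \<in> V" "u0 v0 \<noteq> 0"
        using dependent_finite[OF psubset.hyps(1)] by auto
      \<comment> \<open>Of the two signs of the dependency the one with nonnegative coefficient sum
        is taken: then subtracting a nonnegative multiple cannot raise the total weight, and some
        coefficient must be positive.\<close>
      define u where "u v = (if 0 \<le> sum u0 V then u0 v else - u0 v)" for v
      have u: "(\<Sum>v\<in>V. u v *\<^sub>R v) = 0" "u v0 \<noteq> 0" "0 \<le> sum u V"
        using u0 by (cases "0 \<le> sum u0 V"; simp add: u_def sum_negf)+
      define P where "P = {v \<in> V. 0 < u v}"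
      have "P \<noteq> {}"
      proof
        assume "P = {}"
        then have "\<And>v. v \<in> V \<Longrightarrow> u v \<le> 0" by (auto simp: P_def not_less)
        then have "sum u V < 0"
        proof -
          have "u v0 < 0" using \<open>\<And>v. v \<in> V \<Longrightarrow> u v \<le> 0\<close>[OF u0(2)] u(2) by simp
          moreover have "sum u (V - {v0}) \<le> 0"
            using \<open>\<And>v. v \<in> V \<Longrightarrow> u v \<le> 0\<close> by (intro sum_nonpos) auto
          ultimately show ?thesis using sum.remove[OF psubset.hyps(1) u0(2), of u] by linarith
        qed
        then show False using u(3) by simp
      qed
      obtain c where c: "x = (\<Sum>v\<in>V. c v *\<^sub>R v)" "\<forall>v\<in>V. 0 \<le> c v" "sum c V \<le> 1"
        using psubset.prems by (auto simp: corner_simplex_def)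
      have fP: "finite P" using psubset.hyps(1) by (simp add: P_def)
      \<comment> \<open>The largest multiple that keeps all coefficients nonnegative; it annihilates
        the one at the minimizing \<open>w\<close>.\<close>
      define t where "t = Min ((\<lambda>v. c v / u v) ` P)"
      have "t \<in> (\<lambda>v. c v / u v) ` P" unfolding t_def using fP \<open>P \<noteq> {}\<close> by (intro Min_in) auto
      then obtain w where w: "w \<in> P" "t = c w / u w" by auto
      have tle: "t \<le> c v / u v" if "v \<in> P" for v unfolding t_def using fP that by simp
      have t0: "0 \<le> t" using w c(2) by (auto simp: P_def)
      define c' where "c' v = c v - t * u v" for v
      have c'0: "0 \<le> c' v" if "v \<in> V" for v
      proof (cases "0 < u v")
        case True
        then show ?thesis using tle[of v] that by (simp add: P_def c'_def pos_le_divide_eq)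
      next
        case False
        then have "t * u v \<le> 0" using t0 by (simp add: mult_nonneg_nonpos)
        moreover have "0 \<le> c v" using c(2) that by blast
        ultimately show ?thesis unfolding c'_def by linarith
      qed
      have c'w: "c' w = 0" using w by (simp add: c'_def P_def)
      have wV: "w \<in> V" using w by (simp add: P_def)
      have "(\<Sum>v\<in>V. c' v *\<^sub>R v) = (\<Sum>v\<in>V. c v *\<^sub>R v) - t *\<^sub>R (\<Sum>v\<in>V. u v *\<^sub>R v)"
        by (simp add: c'_def scaleR_left_diff_distrib sum_subtractf scaleR_sum_right)
      then have "x = (\<Sum>v\<in>V. c' v *\<^sub>R v)" using c(1) u(1) by simp
      then have x': "x = (\<Sum>v\<in>V - {w}. c' v *\<^sub>R v)"
        using sum.remove[OF psubset.hyps(1) wV, of "\<lambda>v. c' v *\<^sub>R v"] c'w by simp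
      have "sum c' V = sum c V - t * sum u V"
        by (simp add: c'_def sum_subtractf sum_distrib_left)
      then have "sum c' V \<le> 1" using c(3) t0 u(3) mult_nonneg_nonneg[of t "sum u V"] by linarith
      then have "sum c' (V - {w}) \<le> 1"
        using sum.remove[OF psubset.hyps(1) wV, of c'] c'w by simp
      then have "x \<in> corner_simplex (V - {w})"
        unfolding corner_simplex_def using x' c'0 by blast
      moreover have "V - {w} \<subset> V" using wV by blast
      ultimately obtain I where "I \<subseteq> V - {w}" "independent I" "x \<in> corner_simplex I"
        using psubset.IH by blast
      then show ?thesis by blast
    qed
  qed
  then show ?thesis using that by blast
qed

lemma corner_simplex_mono:
  assumes "I \<subseteq> J" "finite J"
  shows "corner_simplex I \<subseteq> corner_simplex J"
proof
  fix x assume "x \<in> corner_simplex I"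
  then obtain c where c: "x = (\<Sum>v\<in>I. c v *\<^sub>R v)" "\<forall>v\<in>I. 0 \<le> c v" "sum c I \<le> 1"
    by (auto simp: corner_simplex_def)
  define c' where "c' v = (if v \<in> I then c v else 0)" for v
  have "(\<Sum>v\<in>J. c' v *\<^sub>R v) = (\<Sum>v\<in>I. c v *\<^sub>R v)" "sum c' J = sum c I"
    using assms by (auto simp: c'_def intro!: sum.mono_neutral_cong_right)
  then show "x \<in> corner_simplex J"
    unfolding corner_simplex_def using c by (intro CollectI exI[of _ c']) (auto simp: c'_def)
qed

section \<open>Elementary symmetric polynomials and the volume bound\<close>

lemma power_Suc_add_ge:
  fixes s a :: real
  assumes "0 \<le> s" "0 \<le> a"
  shows "s ^ Suc k + real (Suc k) * a * s ^ k \<le> (s + a) ^ Suc k"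
proof (induction k)
  case (Suc k)
  have "s ^ Suc (Suc k) + real (Suc (Suc k)) * a * s ^ Suc k
      \<le> (s + a) * (s ^ Suc k + real (Suc k) * a * s ^ k)"
    using assms by (simp add: algebra_simps)
  also have "\<dots> \<le> (s + a) * (s + a) ^ Suc k" using Suc assms by (intro mult_left_mono) auto
  finally show ?case by simp
qed simp

text \<open>Splitting off an element \<open>x\<close> turns \<open>e_(j+1)\<close> into
  \<open>e_(j+1) + a x * e_j\<close>. Multiplied by the factorial, the two parts are bounded by the
  first two terms in the binomial expansion of \<open>(sum a V + a x) ^ Suc j\<close>.\<close>

lemma elementary_symmetric_le_power:
  fixes a :: "'a \<Rightarrow> real"
  assumes "finite V" "\<And>v. v \<in> V \<Longrightarrow> 0 \<le> a v"
  shows "fact k * (\<Sum>I | I \<subseteq> V \<and> card I = k. \<Prod>v\<in>I. a v) \<le> (sum a V) ^ k"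
  using assms
proof (induction V arbitrary: k rule: finite_induct)
  case empty
  have e: "{I. I \<subseteq> {} \<and> card I = k} = (if k = 0 then {{}} else {})" by auto
  show ?case unfolding e by (cases "k = 0") simp_all
next
  case (insert x V)
  show ?case
  proof (cases k)
    case 0
    have "{I. I \<subseteq> insert x V \<and> card I = 0} = {{}}"
      using insert.hyps(1) by (auto simp: finite_subset card_eq_0_iff)
    then show ?thesis using 0 by simp
  next
    case (Suc j)
    let ?e = "\<lambda>k. \<Sum>I | I \<subseteq> V \<and> card I = k. \<Prod>v\<in>I. a v"
    let ?A = "{I. I \<subseteq> V \<and> card I = Suc j}" and ?B = "{I. I \<subseteq> V \<and> card I = j}"
    have fin: "finite ?A" "finite ?B" using insert.hyps(1) by simp_all
    have split: "{I. I \<subseteq> insert x V \<and> card I = Suc j} = ?A \<union> insert x ` ?B"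
    proof (intro equalityI subsetI)
      fix I assume I: "I \<in> {I. I \<subseteq> insert x V \<and> card I = Suc j}"
      show "I \<in> ?A \<union> insert x ` ?B"
      proof (cases "x \<in> I")
        case True
        have "finite I" using I insert.hyps(1) by (auto intro: finite_subset)
        then have "I - {x} \<in> ?B" using I True by auto
        moreover have "I = insert x (I - {x})" using True by auto
        ultimately show ?thesis by blast
      next
        case False
        then show ?thesis using I by auto
      qed
    next
      fix I assume "I \<in> ?A \<union> insert x ` ?B"
      then show "I \<in> {I. I \<subseteq> insert x V \<and> card I = Suc j}"
        using insert.hyps by (auto simp: card_insert_if finite_subset)
    qed
    have inj: "inj_on (insert x) ?B"
      using insert.hyps(2) by (auto simp: inj_on_def insert_eq_iff subset_iff)
    have "(\<Sum>I\<in>insert x ` ?B. \<Prod>v\<in>I. a v) = (\<Sum>I\<in>?B. a x * (\<Prod>v\<in>I. a v))"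
      unfolding sum.reindex[OF inj] o_def
    proof (rule sum.cong[OF refl])
      fix I assume I: "I \<in> ?B"
      then have "finite I" "x \<notin> I" using insert.hyps by (auto intro: finite_subset)
      then show "prod a (insert x I) = a x * prod a I" by simp
    qed
    then have e: "(\<Sum>I | I \<subseteq> insert x V \<and> card I = Suc j. \<Prod>v\<in>I. a v) = ?e (Suc j) + a x * ?e j"
      unfolding split using fin insert.hyps(2)
      by (subst sum.union_disjoint) (auto simp: sum_distrib_left)
    have ax: "0 \<le> a x" and s0: "0 \<le> sum a V" using insert.prems by (auto intro: sum_nonneg)
    have IH: "fact k * ?e k \<le> sum a V ^ k" for k using insert.IH insert.prems by simp
    have "fact (Suc j) * (?e (Suc j) + a x * ?e j) = fact (Suc j) * ?e (Suc j) + real (Suc j) * a x * (fact j * ?e j)"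
      by (simp add: algebra_simps)
    also have "\<dots> \<le> sum a V ^ Suc j + real (Suc j) * a x * sum a V ^ j"
      using ax by (intro add_mono IH mult_left_mono) auto
    also have "\<dots> \<le> (sum a V + a x) ^ Suc j" by (rule power_Suc_add_ge[OF s0 ax])
    finally show ?thesis unfolding Suc e using insert.hyps by (simp add: add.commute)
  qed
qed

lemma measure_hull_le:
  fixes V :: "(real^'n::{finite,wellorder}) set"
  assumes fin: "finite V" and ball: "cball 0 1 \<subseteq> convex hull V"
  shows "measure lebesgue (cball (0::real^'n::{finite,wellorder}) 1) \<le> (sum norm V) ^ CARD('n) / (fact CARD('n))\<^sup>2"
proof -
  let ?d = "CARD('n)"
  have cV: "?d \<le> card V"
  proof (rule ccontr)
    assume "\<not> ?d \<le> card V"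
    then have "interior (convex hull V) = {}" using fin by (intro empty_interior_convex_hull) auto
    moreover have "ball 0 1 \<subseteq> interior (convex hull V)" using ball by (intro interior_maximal) auto
    ultimately show False by auto
  qed
  define \<I> where "\<I> = {I. I \<subseteq> V \<and> card I = ?d}"
  have fI: "finite \<I>" using fin by (simp add: \<I>_def)
  have cover: "cball 0 1 \<subseteq> (\<Union>I\<in>\<I>. corner_simplex I)"
  proof
    fix x :: "(real,'n) vec" assume "x \<in> cball 0 1"
    then have "x \<in> corner_simplex V"
      using ball fin unfolding corner_simplex_def convex_hull_finite[OF fin] by force
    then obtain I where I: "I \<subseteq> V" "independent I" "x \<in> corner_simplex I"
      by (rule corner_simplex_independent[OF fin])
    have "card I \<le> ?d" using independent_card_le[OF I(2)] by simp
    \<comment> \<open>The volume bound needs exactly \<open>d\<close> points, so the independent set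
      is filled up; the simplex only grows.\<close>
    then obtain J where J: "I \<subseteq> J" "J \<subseteq> V" "card J = ?d"
      using exists_subset_between[of I ?d V] cV I(1) fin by auto
    then have "x \<in> corner_simplex J" using corner_simplex_mono[OF J(1)] I(3) fin finite_subset by blast
    then show "x \<in> (\<Union>I\<in>\<I>. corner_simplex I)" using J by (auto simp: \<I>_def)
  qed
  have lm: "corner_simplex I \<in> lmeasurable" if "I \<in> \<I>" for I
    using measure_corner_simplex(1)[of I] that by (simp add: \<I>_def)
  have "measure lebesgue (cball (0::(real,'n) vec) 1) \<le> measure lebesgue (\<Union>I\<in>\<I>. corner_simplex I)"
    using cover fI lm by (intro measure_mono_fmeasurable fmeasurable.finite_UN) auto
  also have "\<dots> \<le> (\<Sum>I\<in>\<I>. measure lebesgue (corner_simplex I))"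
    using fI lm by (intro measure_UNION_le) (auto intro: fmeasurableD)
  also have "\<dots> \<le> (\<Sum>I\<in>\<I>. (\<Prod>v\<in>I. norm v) / fact ?d)"
    by (intro sum_mono measure_corner_simplex(2)) (simp add: \<I>_def)
  also have "\<dots> = (fact ?d * (\<Sum>I | I \<subseteq> V \<and> card I = ?d. \<Prod>v\<in>I. norm v)) / (fact ?d)\<^sup>2"
    by (simp add: \<I>_def power2_eq_square sum_divide_distrib[symmetric])
  also have "\<dots> \<le> (sum norm V) ^ ?d / (fact ?d)\<^sup>2"
    by (intro divide_right_mono elementary_symmetric_le_power fin) auto
  finally show ?thesis .
qed

text \<open>\<open>n ^ n / n!\<close> is a single term of the exponential series at
  \<open>n\<close>.\<close>

lemma power_over_exp_le_fact: "(real n / exp 1) ^ n \<le> fact n"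
proof -
  have "real n ^ n / fact n = (\<Sum>i\<in>{n}. real n ^ i / fact i)" by simp
  also have "\<dots> \<le> (\<Sum>i. real n ^ i / fact i)"
    using summable_exp[of "real n"] by (intro sum_le_suminf) (auto simp: field_simps)
  also have "\<dots> = exp (real n)" by (simp add: exp_def field_simps)
  also have "\<dots> = exp 1 ^ n" by (simp flip: exp_of_nat_mult)
  finally show ?thesis by (simp add: power_divide field_simps)
qed

text \<open>Instead of the exact volume of the ball, that of the inscribed cube suffices.\<close>

lemma sum_norm_ge_general:
  fixes V :: "(real^'n::{finite,wellorder}) set"
  assumes fin: "finite V" and ball: "cball 0 1 \<subseteq> convex hull V"
  shows "real CARD('n) powr (3/2) / sqrt (2 * pi * exp 1) \<le> sum norm V"
proof -
  define d where "d = CARD('n)"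
  have d0: "0 < real d" by (simp add: d_def)
  \<comment> \<open>Half the edge length that puts the corners of the cube on the unit
    sphere.\<close>
  define s where "s = 1 / sqrt (real d)"
  have s: "0 < s" "real d * s\<^sup>2 = 1" using d0 by (simp_all add: s_def power_divide)
  define Q where "Q = (cbox (\<chi> i. - s) (\<chi> i. s) :: ((real,'n) vec) set)"
  have "measure lebesgue Q = (2 * s) ^ d"
  proof -
    have "Q \<noteq> {}" using s(1) by (auto simp: Q_def interval_ne_empty_cart)
    then have "measure lborel Q = (\<Prod>i\<in>(UNIV::'n set). 2 * s)"
      unfolding Q_def by (subst content_cbox_cart) auto
    then show ?thesis by (simp add: Q_def d_def)
  qed
  moreover have "Q \<subseteq> cball 0 1"
  proof
    fix x assume "x \<in> Q"
    then have "\<bar>x$i\<bar> \<le> s" for i by (auto simp: Q_def mem_box_cart abs_le_iff minus_le_iff)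
    then have "(x$i)\<^sup>2 \<le> s\<^sup>2" for i using s(1) by (simp add: abs_le_square_iff[symmetric])
    then have "(\<Sum>i\<in>UNIV. (x$i)\<^sup>2) \<le> (\<Sum>i\<in>(UNIV::'n set). s\<^sup>2)" by (intro sum_mono) auto
    then have "(norm x)\<^sup>2 \<le> 1" using s(2) by (simp add: norm_vec_def L2_set_def d_def sum_nonneg)
    then have "norm x \<le> 1" by (simp add: power_le_one_iff abs_square_le_1[of "norm x"])
    then show "x \<in> cball 0 1" by simp
  qed
  then have "measure lebesgue Q \<le> measure lebesgue (cball (0::(real,'n) vec) 1)"
    by (intro measure_mono_fmeasurable) (auto simp: Q_def)
  moreover note measure_hull_le[OF fin ball]
  ultimately have "(2 * s) ^ d \<le> (sum norm V) ^ d / (fact d)\<^sup>2" by (simp add: d_def)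
  then have "(2 * s) ^ d * (fact d)\<^sup>2 \<le> (sum norm V) ^ d" by (simp add: pos_le_divide_eq)
  moreover have "((real d / exp 1) ^ d)\<^sup>2 \<le> (fact d)\<^sup>2"
    using power_over_exp_le_fact[of d] by (intro power_mono) auto
  then have "(2 * s) ^ d * ((real d / exp 1) ^ d)\<^sup>2 \<le> (2 * s) ^ d * (fact d)\<^sup>2"
    using s(1) by (intro mult_left_mono) auto
  ultimately have "(2 * s) ^ d * ((real d / exp 1) ^ d)\<^sup>2 \<le> (sum norm V) ^ d" by linarith
  moreover have "(2 * s) ^ d * ((real d / exp 1) ^ d)\<^sup>2 = (2 * s * (real d / exp 1)\<^sup>2) ^ d"
    by (simp add: power_mult_distrib mult.commute flip: power_mult)
  ultimately have "(2 * s * (real d / exp 1)\<^sup>2) ^ d \<le> (sum norm V) ^ d" by simp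
  then have "2 * s * (real d / exp 1)\<^sup>2 \<le> sum norm V"
    using d0 by (subst (asm) power_mono_iff) (use s(1) in \<open>auto simp: sum_nonneg\<close>)
  moreover have "2 * s * (real d / exp 1)\<^sup>2 = 2 * real d powr (3/2) / (exp 1)\<^sup>2"
  proof -
    have "s * (real d)\<^sup>2 = real d powr (-1/2) * real d powr 2"
      using d0 by (simp add: s_def powr_minus powr_half_sqrt inverse_eq_divide)
    also have "\<dots> = real d powr (-1/2 + 2)" by (rule powr_add[symmetric])
    also have "\<dots> = real d powr (3/2)" by simp
    finally show ?thesis by (simp add: power_divide)
  qed
  \<comment> \<open>The cube yields the constant \<open>2 / e^2\<close>. It is at least the one
    claimed because, after squaring, this amounts to \<open>e ^ 3 \<le> 8 * pi\<close>.\<close>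
  moreover have "real d powr (3/2) / sqrt (2 * pi * exp 1) \<le> 2 * real d powr (3/2) / (exp 1)\<^sup>2"
  proof -
    have e: "exp 1 \<le> (2.72::real)" using e_less_272 by simp
    have "exp 1 ^ 3 \<le> (2.72::real) ^ 3" using e by (intro power_mono) auto
    also have "\<dots> \<le> 8 * pi" using pi_gt3 by (simp add: power3_eq_cube)
    finally have "exp 1 * exp 1 ^ 3 \<le> exp 1 * (8 * pi)" by (intro mult_left_mono) auto
    then have "((exp 1)\<^sup>2)\<^sup>2 \<le> 2\<^sup>2 * (2 * pi * exp (1::real))"
      by (simp add: power2_eq_square power3_eq_cube)
    then have "sqrt (((exp 1)\<^sup>2)\<^sup>2) \<le> sqrt (2\<^sup>2 * (2 * pi * exp (1::real)))" by (rule real_sqrt_le_mono)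
    then have "(exp (1::real))\<^sup>2 \<le> 2 * sqrt (2 * pi * exp 1)" unfolding real_sqrt_mult[of "2\<^sup>2"] real_sqrt_abs by simp
    then have "1 / sqrt (2 * pi * exp (1::real)) \<le> 2 / (exp 1)\<^sup>2" by (simp add: field_simps)
    then have "real d powr (3/2) * (1 / sqrt (2 * pi * exp 1)) \<le> real d powr (3/2) * (2 / (exp 1)\<^sup>2)"
      by (intro mult_left_mono) auto
    then show ?thesis by (simp add: mult.commute)
  qed
  ultimately show ?thesis by (simp add: d_def)
qed

subsection \<open>Measure of cones in space\<close>

text \<open>Normalized solid angle: for a cone, the share of the ball's volume equals the share of
  the sphere's area. Planes are null sets, so boundaries of cones can be ignored.\<close>

definition sph :: "(real^3) measure" where
  "sph = uniform_measure lborel (cball 0 1)"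

lemma sets_sph [simp, measurable_cong]: "sets sph = sets borel"
  by (simp add: sph_def)

lemma space_sph [simp]: "space sph = UNIV"
  by (simp add: sph_def)

lemma content_ball3_pos: "0 < measure lborel (cball (0::real^3) 1)"
  using content_cball_pos[of 1 "0::real^3"] by simp

lemma measure_sph:
  assumes "S \<in> sets borel"
  shows "measure sph S = measure lborel (cball 0 1 \<inter> S) / measure lborel (cball (0::real^3) 1)"
proof -
  have "emeasure lborel (cball (0::real^3) 1) \<noteq> 0"
    using content_ball3_pos by (auto simp: measure_def)
  moreover have "emeasure lborel (cball (0::real^3) 1) \<noteq> \<infinity>"
    using emeasure_lborel_cball_finite[of "0::real^3" 1] by simp
  ultimately show ?thesis
    unfolding sph_def using assms by (intro measure_uniform_measure) simp_all
qed

lemma measure_sph_UNIV: "measure sph UNIV = 1"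
  using content_ball3_pos by (simp add: measure_sph)

interpretation sph: finite_measure sph
proof
  have "emeasure sph (space sph) = emeasure lborel (cball (0::real^3) 1) / emeasure lborel (cball (0::real^3) 1)"
    by (simp add: sph_def)
  then show "emeasure sph (space sph) \<noteq> \<infinity>"
    using content_ball3_pos
    by (metis measure_sph_UNIV space_sph measure_eq_emeasure_eq_ennreal[of 1 sph UNIV]
        ennreal_1 ennreal_one_neq_top infinity_ennreal_def measure_def enn2real_top zero_neq_one)
qed

lemma measure_sph_orthogonal:
  fixes f :: "real^3 \<Rightarrow> real^3"
  assumes f: "orthogonal_transformation f" and S: "S \<in> sets borel"
  shows "measure sph {x. f x \<in> S} = measure sph S"
proof -
  have lin: "linear f" using f by (rule orthogonal_transformation_linear)
  have [measurable]: "f \<in> borel_measurable borel"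
    by (intro borel_measurable_continuous_onI linear_continuous_on) (simp add: lin linear_linear)
  have T: "{x. f x \<in> S} \<in> sets borel"
    using measurable_sets_borel[of f borel S] S by (simp add: vimage_def)
  have im: "f ` (cball 0 1 \<inter> {x. f x \<in> S}) = cball 0 1 \<inter> S"
  proof (intro equalityI subsetI)
    fix y assume y: "y \<in> cball 0 1 \<inter> S"
    obtain x where x: "y = f x" using orthogonal_transformation_surj[OF f] by (metis surjD)
    have "norm (f x) = norm x" by (rule orthogonal_transformation_norm[OF f])
    with x y show "y \<in> f ` (cball 0 1 \<inter> {x. f x \<in> S})" by (intro image_eqI[of _ _ x]) auto
  qed (auto simp: orthogonal_transformation_norm[OF f])
  have L: "cball 0 1 \<inter> {x. f x \<in> S} \<in> sets borel" using T by simp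
  have "cball 0 1 \<inter> {x. f x \<in> S} \<in> lmeasurable"
    using L by (intro bounded_set_imp_lmeasurable) (auto simp: bounded_Int)
  from measure_orthogonal_image[OF f this]
  have "measure lborel (cball 0 1 \<inter> S) = measure lborel (cball 0 1 \<inter> {x. f x \<in> S})"
    unfolding im using L S by (simp add: measure_completion)
  then show ?thesis using S T by (simp add: measure_sph)
qed

lemma borel_halfspaces [measurable]:
  "{x::real^3. 0 \<le> x \<bullet> a} \<in> sets borel" "{x::real^3. x \<bullet> a < 0} \<in> sets borel"
  "{x::real^3. 0 < x \<bullet> a} \<in> sets borel" "{x::real^3. x \<bullet> a = 0} \<in> sets borel"
  by simp_all

lemma measure_sph_hyperplane:
  assumes "a \<noteq> 0"
  shows "measure sph {x. x \<bullet> a = 0} = 0"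
proof -
  have "negligible {x. a \<bullet> x = 0}" using assms by (intro negligible_hyperplane) auto
  then have "negligible (cball 0 1 \<inter> {x. x \<bullet> a = 0})"
    by (rule negligible_subset) (auto simp: inner_commute)
  then have "measure lebesgue (cball 0 1 \<inter> {x. x \<bullet> a = 0}) = 0"
    by (rule negligible_imp_measure0)
  then have "measure lborel (cball 0 1 \<inter> {x. x \<bullet> a = 0}) = 0"
    by (simp add: measure_completion)
  then show ?thesis by (simp add: measure_sph)
qed

lemma measure_sph_null_subset:
  assumes "S \<in> sets borel" "S \<subseteq> {x. x \<bullet> a = 0}" "a \<noteq> 0"
  shows "measure sph S = 0"
proof (rule antisym)
  have "measure sph S \<le> measure sph {x. x \<bullet> a = 0}"
    using assms by (intro sph.finite_measure_mono) simp_all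
  then show "measure sph S \<le> 0" using measure_sph_hyperplane[OF assms(3)] by simp
qed simp

text \<open>This exchanges weak and strict inequalities at one boundary plane.\<close>

lemma measure_sph_eq_mod_null:
  assumes "S \<in> sets borel" "T \<in> sets borel" "a \<noteq> 0"
    "\<And>x. x \<bullet> a \<noteq> 0 \<Longrightarrow> x \<in> S \<longleftrightarrow> x \<in> T"
  shows "measure sph S = measure sph T"
proof -
  have *: "measure sph A \<le> measure sph B" if A: "A \<in> sets borel" and B: "B \<in> sets borel"
    and AB: "\<And>x. x \<bullet> a \<noteq> 0 \<Longrightarrow> x \<in> A \<Longrightarrow> x \<in> B" for A B
  proof -
    have "measure sph A \<le> measure sph (B \<union> {x. x \<bullet> a = 0})"
      using A B AB by (intro sph.finite_measure_mono) auto
    also have "\<dots> \<le> measure sph B + measure sph {x. x \<bullet> a = 0}"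
      using B by (intro measure_Un_le) auto
    finally show ?thesis by (simp add: measure_sph_hyperplane assms(3))
  qed
  show ?thesis using *[of S T] *[of T S] assms by force
qed

lemma measure_sph_halfspace:
  assumes "a \<noteq> 0"
  shows "measure sph {x. 0 \<le> x \<bullet> a} = 1/2"
proof -
  have o: "orthogonal_transformation (\<lambda>x::real^3. - x)"
    by (simp add: orthogonal_transformation_neg)
  have "measure sph {x. x \<bullet> a < 0} = measure sph {x. - x \<in> {x. 0 < x \<bullet> a}}" by simp
  also have "\<dots> = measure sph {x. 0 < x \<bullet> a}" by (rule measure_sph_orthogonal[OF o]) simp
  also have "\<dots> = measure sph {x. 0 \<le> x \<bullet> a}"
    by (rule measure_sph_eq_mod_null[of _ _ a]) (use assms in auto)
  finally have 1: "measure sph {x. x \<bullet> a < 0} = measure sph {x. 0 \<le> x \<bullet> a}" .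
  have "measure sph ({x. x \<bullet> a < 0} \<union> {x. 0 \<le> x \<bullet> a}) = measure sph {x. x \<bullet> a < 0} + measure sph {x. 0 \<le> x \<bullet> a}"
    by (intro sph.finite_measure_Union) auto
  moreover have "{x. x \<bullet> a < 0} \<union> {x. 0 \<le> x \<bullet> a} = UNIV" by auto
  ultimately show ?thesis using 1 measure_sph_UNIV by simp
qed

section \<open>Lunes, wedges and trihedral cones\<close>

definition hdir :: "real \<Rightarrow> real^3" where "hdir t = vector [cos t, sin t, 0]"

lemma hdir_nth [simp]: "hdir t $ 1 = cos t" "hdir t $ 2 = sin t" "hdir t $ 3 = 0"
  by (simp_all add: hdir_def)

lemma inner3: "(x::real^3) \<bullet> y = x$1 * y$1 + x$2 * y$2 + x$3 * y$3"
  by (simp add: inner_vec_def sum_3)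

lemma norm3_sq: "(norm (x::real^3))\<^sup>2 = (x$1)\<^sup>2 + (x$2)\<^sup>2 + (x$3)\<^sup>2"
  unfolding power2_norm_eq_inner inner3 by (simp add: power2_eq_square)

lemma hdir_nonzero [simp]: "hdir t \<noteq> 0"
proof
  assume "hdir t = 0"
  then have "cos t = 0" "sin t = 0" by (metis hdir_nth zero_index)+
  then show False using sin_cos_squared_add[of t] by simp
qed

lemma orthogonal_transformation_coords:
  fixes a b c :: "real^3"
  assumes "norm a = 1" "norm b = 1" "a \<bullet> b = 0" "c = cross3 a b"
  shows "orthogonal_transformation (\<lambda>x. vector [x \<bullet> a, x \<bullet> b, x \<bullet> c] :: real^3)"
proof -
  let ?f = "\<lambda>x. vector [x \<bullet> a, x \<bullet> b, x \<bullet> c] :: real^3"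
  have lin: "linear ?f"
    by (rule linearI) (simp_all add: vec_eq_iff forall_3 inner_add_left)
  have "norm (?f x) = norm x" for x
  proof -
    have aa: "a \<bullet> a = 1" "b \<bullet> b = 1" using assms by (simp_all add: norm_eq_1)
    \<comment> \<open>The right side is the Gram determinant of \<open>x\<close>, \<open>a\<close>,
      \<open>b\<close>, which is the square of their triple product; for orthonormal
      \<open>a\<close>, \<open>b\<close> it becomes Pythagoras.\<close>
    have "(x \<bullet> c)\<^sup>2 = (x \<bullet> x) * (a \<bullet> a) * (b \<bullet> b) + 2 * (x \<bullet> a) * (a \<bullet> b) * (x \<bullet> b)
        - (x \<bullet> a)\<^sup>2 * (b \<bullet> b) - (x \<bullet> b)\<^sup>2 * (a \<bullet> a) - (x \<bullet> x) * (a \<bullet> b)\<^sup>2"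
      unfolding assms(4) inner3 cross3_def vector_3 by algebra
    then have "(x \<bullet> c)\<^sup>2 + (x \<bullet> a)\<^sup>2 + (x \<bullet> b)\<^sup>2 = x \<bullet> x" using aa assms(3) by simp
    moreover have "(norm (?f x))\<^sup>2 = (x \<bullet> a)\<^sup>2 + (x \<bullet> b)\<^sup>2 + (x \<bullet> c)\<^sup>2" by (simp add: norm3_sq)
    ultimately have "(norm (?f x))\<^sup>2 = (norm x)\<^sup>2" by (simp add: power2_norm_eq_inner)
    then show ?thesis by simp
  qed
  then show ?thesis using lin by (simp add: orthogonal_transformation)
qed

text \<open>For \<open>0 \<le> t\<close> and \<open>t < pi\<close> a wedge of dihedral angle
  \<open>t\<close> along the vertical axis. It is half-open so that adjacent lunes are disjoint and
  fit together exactly.\<close>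

definition lune :: "real \<Rightarrow> real \<Rightarrow> (real^3) set" where
  "lune s t = {x. 0 \<le> x \<bullet> hdir s \<and> x \<bullet> hdir (s + t) < 0}"

lemma lune_borel [measurable]: "lune s t \<in> sets borel"
  unfolding lune_def by measurable

lemma measure_lune_rotate: "measure sph (lune s t) = measure sph (lune 0 t)"
proof -
  define f where "f = (\<lambda>x. vector [x \<bullet> hdir s, x \<bullet> hdir (s + pi/2), x \<bullet> cross3 (hdir s) (hdir (s + pi/2))] :: real^3)"
  have "orthogonal_transformation f"
    unfolding f_def
    by (rule orthogonal_transformation_coords)
       (auto simp: norm_eq_1 inner3 sin_add cos_add simp flip: power2_eq_square)
  moreover have "lune s t = {x. f x \<in> lune 0 t}"
  proof -
    have 1: "f x \<bullet> hdir 0 = x \<bullet> hdir s" for x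
      unfolding inner3[of "f x"] by (simp add: f_def)
    have 2: "f x \<bullet> hdir (0 + t) = x \<bullet> hdir (s + t)" for x
      unfolding inner3[of "f x"] by (simp add: f_def inner3 sin_add cos_add algebra_simps)
    show ?thesis by (auto simp only: lune_def 1 2 mem_Collect_eq)
  qed
  ultimately show ?thesis by (simp add: measure_sph_orthogonal)
qed

text \<open>Up to the factor \<open>sin (s + t)\<close>, the middle direction \<open>hdir s\<close>
  is a combination of \<open>hdir 0\<close> and \<open>hdir (s + t)\<close> with weights
  \<open>sin t\<close> and \<open>sin s\<close>; this decides the signs when a lune is cut in
  two.\<close>

lemma sin_add_combination:
  fixes p q s t :: real
  shows "sin (s + t) * (p * cos s + q * sin s) = sin t * p + sin s * (p * cos (s + t) + q * sin (s + t))"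
proof -
  have "sin (s+t) * cos s = sin t + cos (s+t) * sin s"
    using sin_diff[of "s + t" s] by simp
  then have "p * (sin (s+t) * cos s) = p * (sin t + cos (s+t) * sin s)" by simp
  then show ?thesis by (simp add: distrib_left mult.commute mult.left_commute)
qed

lemma measure_lune_add:
  assumes "0 \<le> s" "0 \<le> t" "s + t < pi"
  shows "measure sph (lune 0 (s + t)) = measure sph (lune 0 s) + measure sph (lune 0 t)"
proof (cases "s = 0 \<or> t = 0")
  case True
  moreover have "lune 0 0 = {}" by (auto simp: lune_def)
  ultimately show ?thesis by auto
next
  case False
  with assms have pos: "0 < sin s" "0 < sin t" "0 < sin (s + t)" by (auto intro!: sin_gt_zero)
  have id: "sin (s + t) * (x \<bullet> hdir s) = sin t * (x \<bullet> hdir 0) + sin s * (x \<bullet> hdir (s + t))" for x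
    using sin_add_combination[of s t "x$1" "x$2"] by (simp only: inner3 hdir_nth) simp
  have eq: "lune 0 (s + t) = lune 0 s \<union> lune s t"
  proof (intro equalityI subsetI)
    fix x assume "x \<in> lune 0 (s + t)" then show "x \<in> lune 0 s \<union> lune s t" by (auto simp: lune_def)
  next
    fix x assume "x \<in> lune 0 s \<union> lune s t"
    then consider "0 \<le> x \<bullet> hdir 0" "x \<bullet> hdir s < 0" | "0 \<le> x \<bullet> hdir s" "x \<bullet> hdir (s + t) < 0"
      by (auto simp: lune_def)
    then show "x \<in> lune 0 (s + t)"
    proof cases
      case 1
      have "sin (s + t) * (x \<bullet> hdir s) < 0" using 1 pos by (simp add: mult_pos_neg)
      moreover have "0 \<le> sin t * (x \<bullet> hdir 0)" using 1 pos by simp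
      ultimately have "sin s * (x \<bullet> hdir (s + t)) < 0" using id[of x] by linarith
      then show ?thesis using 1 pos by (simp add: lune_def mult_less_0_iff)
    next
      case 2
      have "0 \<le> sin (s + t) * (x \<bullet> hdir s)" using 2 pos by simp
      moreover have "sin s * (x \<bullet> hdir (s + t)) < 0" using 2 pos by (simp add: mult_pos_neg)
      ultimately have "0 < sin t * (x \<bullet> hdir 0)" using id[of x] by linarith
      then show ?thesis using 2 pos by (simp add: lune_def zero_less_mult_iff)
    qed
  qed
  have "measure sph (lune 0 (s + t)) = measure sph (lune 0 s) + measure sph (lune s t)"
    unfolding eq by (rule sph.finite_measure_Union) (auto simp: lune_def)
  then show ?thesis by (simp only: measure_lune_rotate[of s])
qed

text \<open>Four right-angled lunes fill space up to a plane, and rotation makes their measures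
  equal.\<close>

lemma measure_lune_quarter: "measure sph (lune 0 (pi/2)) = 1/4"
proof -
  define Q where "Q i = lune (real i * (pi/2)) (pi/2)" for i :: nat
  have t: "cos (3*pi/2) = 0" "sin (3*pi/2) = -1"
    using cos_add[of pi "pi/2"] sin_add[of pi "pi/2"] by (simp_all add: field_simps)
  have Q: "Q 0 = {x. 0 \<le> x$1 \<and> x$2 < 0}" "Q 1 = {x. 0 \<le> x$2 \<and> 0 < x$1}"
    "Q 2 = {x. x$1 \<le> 0 \<and> 0 < x$2}" "Q 3 = {x. x$2 \<le> 0 \<and> x$1 < 0}"
    unfolding Q_def lune_def inner3 hdir_nth sin_add cos_add using t by auto
  have B: "Q i \<in> sets borel" for i unfolding Q_def by simp
  have M: "measure sph (Q i) = measure sph (lune 0 (pi/2))" for i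
    unfolding Q_def by (rule measure_lune_rotate)
  have "1 = measure sph (\<Union>i\<in>{0,1,2,3}. Q i)"
    unfolding measure_sph_UNIV[symmetric]
  proof (rule measure_sph_eq_mod_null[of _ _ "hdir 0"])
    fix x assume "x \<bullet> hdir 0 \<noteq> 0"
    then have "x$1 \<noteq> 0" by (simp add: inner3)
    then show "x \<in> UNIV \<longleftrightarrow> x \<in> (\<Union>i\<in>{0,1,2,3}. Q i)"
      by (simp add: Q Q(2)[unfolded One_nat_def]) linarith
  qed (use B in auto)
  also have "\<dots> = (\<Sum>i\<in>{0,1,2,3}. measure sph (Q i))"
  proof (rule sph.finite_measure_finite_Union)
    show "disjoint_family_on Q {0, 1, 2, 3}"
      unfolding disjoint_family_on_def by (auto simp: Q Q(2)[unfolded One_nat_def])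
  qed (use B in auto)
  also have "\<dots> = 4 * measure sph (lune 0 (pi/2))" by (simp add: M)
  finally show ?thesis by simp
qed

lemma measure_lune_mult:
  assumes "0 \<le> t" "real n * t < pi"
  shows "measure sph (lune 0 (real n * t)) = real n * measure sph (lune 0 t)"
  using assms
proof (induction n)
  case 0
  have "lune 0 0 = {}" by (auto simp: lune_def)
  then show ?case by simp
next
  case (Suc n)
  have "measure sph (lune 0 (real n * t + t)) = measure sph (lune 0 (real n * t)) + measure sph (lune 0 t)"
    using Suc.prems by (intro measure_lune_add) (auto simp: algebra_simps)
  moreover have "real n * t < pi" using Suc.prems by (simp add: algebra_simps)
  ultimately show ?case using Suc by (simp add: algebra_simps)
qed

text \<open>Additive and monotone in \<open>t\<close>, hence linear: \<open>t\<close> is enclosed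
  between neighbouring multiples of a small angle whose measure follows from the quarter
  lune.\<close>

lemma measure_lune:
  assumes "0 \<le> t" "t < pi"
  shows "measure sph (lune 0 t) = t / (2 * pi)"
proof -
  let ?f = "\<lambda>t. measure sph (lune 0 t)"
  have bound: "\<bar>?f t - t / (2*pi)\<bar> \<le> 1 / (4 * real n)" if n: "n > 0" "t + (pi/2) / n < pi" for n
  proof -
    define d where "d = (pi/2) / n"
    have d0: "d > 0" using n by (simp add: d_def)
    have "?f (real n * d) = real n * ?f d"
      using n d0 by (intro measure_lune_mult) (auto simp: d_def)
    then have fd: "?f d = 1 / (4 * real n)" using n measure_lune_quarter by (simp add: d_def field_simps)
    define m where "m = nat \<lfloor>t / d\<rfloor>"
    have m: "real m * d \<le> t" "t < (real m + 1) * d"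
    proof -
      have "real m \<le> t / d" "t / d < real m + 1"
        unfolding m_def using assms d0 by (auto simp: of_nat_nat floor_less_iff)
      then show "real m * d \<le> t" "t < (real m + 1) * d" using d0 by (auto simp: field_simps)
    qed
    have "t + d < pi" using n by (simp add: d_def)
    then have up: "real (Suc m) * d < pi" using m(1) by (simp add: distrib_right)
    have mono: "?f u \<le> ?f v" if "0 \<le> u" "u \<le> v" "v < pi" for u v
      using measure_lune_add[of u "v - u"] that by simp
    have lo: "real m * ?f d \<le> ?f t"
      using mono[of "real m * d" t] m measure_lune_mult[of d m] d0 assms by simp
    have hi: "?f t \<le> (real m + 1) * ?f d"
      using mono[of t "real (Suc m) * d"] m measure_lune_mult[of d "Suc m"] d0 assms up by (simp add: add.commute)
    have q: "d / (2*pi) = ?f d" unfolding fd using n by (simp add: d_def)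
    have "real m * ?f d \<le> t / (2*pi)" "t / (2*pi) \<le> (real m + 1) * ?f d"
      unfolding q[symmetric] using m by (auto simp: field_simps)
    with lo hi fd show ?thesis by (simp add: add_divide_distrib distrib_right abs_le_iff)
  qed
  have "\<bar>?f t - t / (2*pi)\<bar> \<le> e" if e: "e > 0" for e
  proof -
    \<comment> \<open>The second condition leaves room for one more step of the small angle below
      \<open>pi\<close>, the range in which additivity is available.\<close>
    obtain n :: nat where n: "real n > 1 / e" "real n > (pi/2) / (pi - t)"
      using reals_Archimedean2[of "max (1/e) ((pi/2)/(pi - t))"] by auto
    have n0: "n > 0" using n e by (metis divide_pos_pos gr0I less_asym of_nat_0 zero_less_one)
    have "t + (pi/2) / n < pi" using n n0 assms by (simp add: field_simps)
    from bound[OF n0 this] have "\<bar>?f t - t / (2*pi)\<bar> \<le> 1 / (4 * real n)" .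
    also have "\<dots> \<le> e" using n n0 e by (simp add: field_simps)
    finally show ?thesis .
  qed
  then have "\<And>e. 0 < e \<Longrightarrow> \<bar>?f t - t / (2*pi)\<bar> \<le> 0 + e" unfolding add_0 .
  then have "\<bar>?f t - t / (2*pi)\<bar> \<le> 0" by (rule field_le_epsilon)
  then show ?thesis by simp
qed

text \<open>A half-space minus the lune on which the other inequality fails; the lune has the angle
  between \<open>a\<close> and \<open>b\<close>. Parallel vectors are treated apart because they do
  not span a frame.\<close>

lemma measure_sph_wedge:
  assumes a: "norm a = 1" and b: "norm b = 1"
  shows "measure sph {x. 0 \<le> x \<bullet> a \<and> 0 \<le> x \<bullet> b} = 1/2 - arccos (a \<bullet> b) / (2*pi)"
proof -
  define t where "t = arccos (a \<bullet> b)"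
  have ab: "\<bar>a \<bullet> b\<bar> \<le> 1" using Cauchy_Schwarz_ineq2[of a b] a b by simp
  have ct: "cos t = a \<bullet> b" using ab by (simp add: t_def cos_arccos_abs)
  have t: "0 \<le> t" "t \<le> pi" using ab by (auto simp: t_def arccos_lbound arccos_ubound abs_le_iff)
  have aa: "a \<bullet> a = 1" "b \<bullet> b = 1" using a b by (simp_all add: norm_eq_1)
  have an: "a \<noteq> 0" using a by auto
  consider "t = 0" | "t = pi" | "0 < t" "t < pi" using t by fastforce
  then show ?thesis
  proof cases
    case 1
    then have "a \<bullet> b = 1" using ct by simp
    then have "a = b" using a b norm_cauchy_schwarz_eq[of a b] by simp
    then show ?thesis using measure_sph_halfspace[OF an] aa by simp
  next
    case 2
    then have "a \<bullet> b = -1" using ct by simp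
    then have "a \<bullet> (- b) = norm a * norm (- b)" using a b by simp
    then have "a = - b" using a b norm_cauchy_schwarz_eq[of a "- b"] by simp
    then have "measure sph {x. 0 \<le> x \<bullet> a \<and> 0 \<le> x \<bullet> b} = 0"
      by (intro measure_sph_null_subset[OF _ _ an]) auto
    then show ?thesis using 2 t_def by simp
  next
    case 3
    have s: "sin t > 0" using 3 by (simp add: sin_gt_zero)
    define c where "c = (1 / sin t) *\<^sub>R (b - cos t *\<^sub>R a)"
    have bc: "b = cos t *\<^sub>R a + sin t *\<^sub>R c" using s by (simp add: c_def)
    have ac: "a \<bullet> c = 0" by (simp add: c_def inner_diff_right aa ct)
    have "(b - cos t *\<^sub>R a) \<bullet> (b - cos t *\<^sub>R a) = (sin t)\<^sup>2"
      using sin_cos_squared_add[of t]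
      by (simp add: inner_diff_left inner_diff_right aa ct inner_commute[of b a] power2_eq_square algebra_simps)
    then have "norm c = 1"
      using s unfolding norm_eq_1 c_def inner_scaleR_left inner_scaleR_right
      by (simp add: power2_eq_square)
    from orthogonal_transformation_coords[OF a this ac refl]
    have f: "orthogonal_transformation (\<lambda>x. vector [x \<bullet> a, x \<bullet> c, x \<bullet> cross3 a c] :: real^3)" (is "orthogonal_transformation ?f") .
    have 1: "?f x \<bullet> hdir 0 = x \<bullet> a" for x unfolding inner3[of "?f x"] by simp
    have 2: "?f x \<bullet> hdir (0 + t) = x \<bullet> b" for x
      unfolding inner3[of "?f x"] by (simp add: bc inner_add_right)
    have "{x. 0 \<le> x \<bullet> a \<and> x \<bullet> b < 0} = {x. ?f x \<in> lune 0 t}"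
      by (auto simp only: lune_def 1 2 mem_Collect_eq)
    then have L: "measure sph {x. 0 \<le> x \<bullet> a \<and> x \<bullet> b < 0} = t / (2*pi)"
      using measure_sph_orthogonal[OF f lune_borel] measure_lune[of t] 3 by simp
    have "measure sph ({x. 0 \<le> x \<bullet> a \<and> 0 \<le> x \<bullet> b} \<union> {x. 0 \<le> x \<bullet> a \<and> x \<bullet> b < 0}) =
      measure sph {x. 0 \<le> x \<bullet> a \<and> 0 \<le> x \<bullet> b} + measure sph {x. 0 \<le> x \<bullet> a \<and> x \<bullet> b < 0}"
      by (intro sph.finite_measure_Union) auto
    moreover have "{x. 0 \<le> x \<bullet> a \<and> 0 \<le> x \<bullet> b} \<union> {x. 0 \<le> x \<bullet> a \<and> x \<bullet> b < 0} = {x. 0 \<le> x \<bullet> a}" by auto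
    ultimately show ?thesis using L measure_sph_halfspace[OF an] t_def by simp
  qed
qed

text \<open>Girard's formula: by central symmetry, a trihedral cone and the complement of the union of
  its three half-spaces have the same measure, and inclusion-exclusion turns this into an equation
  for that measure.\<close>

lemma measure_sph_trihedral:
  assumes a: "norm a = 1" and b: "norm b = 1" and c: "norm c = 1"
  shows "measure sph {x. 0 \<le> x \<bullet> a \<and> 0 \<le> x \<bullet> b \<and> 0 \<le> x \<bullet> c}
    = 1/2 - (arccos (a \<bullet> b) + arccos (a \<bullet> c) + arccos (b \<bullet> c)) / (4*pi)"
proof -
  let ?H = "\<lambda>a. {x. 0 \<le> x \<bullet> a}"
  let ?m = "measure sph"
  have nz: "a \<noteq> 0" "b \<noteq> 0" "c \<noteq> 0" using assms norm_zero zero_neq_one by metis+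
  have un: "?m (A \<union> B) = ?m A + ?m B - ?m (A \<inter> B)" if "A \<in> sets borel" "B \<in> sets borel" for A B
    using that by (intro measure_Un3) (auto simp: sph.fmeasurable_eq_sets)
  have 1: "?m (?H a \<union> ?H b \<union> ?H c) = ?m (?H a) + ?m (?H b) + ?m (?H c)
     - ?m (?H a \<inter> ?H b) - ?m (?H a \<inter> ?H c) - ?m (?H b \<inter> ?H c) + ?m (?H a \<inter> ?H b \<inter> ?H c)"
  proof -
    have "?m ((?H a \<union> ?H b) \<inter> ?H c) = ?m ((?H a \<inter> ?H c) \<union> (?H b \<inter> ?H c))"
      by (simp add: Int_Un_distrib2)
    also have "\<dots> = ?m (?H a \<inter> ?H c) + ?m (?H b \<inter> ?H c) - ?m ((?H a \<inter> ?H c) \<inter> (?H b \<inter> ?H c))"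
      by (rule un) auto
    also have "(?H a \<inter> ?H c) \<inter> (?H b \<inter> ?H c) = ?H a \<inter> ?H b \<inter> ?H c" by auto
    finally show ?thesis by (simp add: un)
  qed
  have "?m (UNIV - (?H a \<union> ?H b \<union> ?H c)) = ?m {x. - x \<in> {x. 0 < x \<bullet> a \<and> 0 < x \<bullet> b \<and> 0 < x \<bullet> c}}"
    by (rule arg_cong[where f = ?m]) (auto simp: not_le)
  also have "\<dots> = ?m {x. 0 < x \<bullet> a \<and> 0 < x \<bullet> b \<and> 0 < x \<bullet> c}"
    by (rule measure_sph_orthogonal) (simp add: orthogonal_transformation_neg, measurable)
  also have "\<dots> = ?m {x. 0 \<le> x \<bullet> a \<and> 0 < x \<bullet> b \<and> 0 < x \<bullet> c}"
    by (rule measure_sph_eq_mod_null[OF _ _ nz(1)]) auto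
  also have "\<dots> = ?m {x. 0 \<le> x \<bullet> a \<and> 0 \<le> x \<bullet> b \<and> 0 < x \<bullet> c}"
    by (rule measure_sph_eq_mod_null[OF _ _ nz(2)]) auto
  also have "\<dots> = ?m {x. 0 \<le> x \<bullet> a \<and> 0 \<le> x \<bullet> b \<and> 0 \<le> x \<bullet> c}"
    by (rule measure_sph_eq_mod_null[OF _ _ nz(3)]) auto
  also have "{x. 0 \<le> x \<bullet> a \<and> 0 \<le> x \<bullet> b \<and> 0 \<le> x \<bullet> c} = ?H a \<inter> ?H b \<inter> ?H c" by auto
  finally have 2: "?m (UNIV - (?H a \<union> ?H b \<union> ?H c)) = ?m (?H a \<inter> ?H b \<inter> ?H c)" .
  have 3: "?m (UNIV - (?H a \<union> ?H b \<union> ?H c)) = 1 - ?m (?H a \<union> ?H b \<union> ?H c)"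
    using sph.finite_measure_compl[of "?H a \<union> ?H b \<union> ?H c"] measure_sph_UNIV by simp
  have w: "?m (?H u \<inter> ?H v) = 1/2 - arccos (u \<bullet> v) / (2*pi)" if "norm u = 1" "norm v = 1" for u v
    using measure_sph_wedge[OF that] by (simp add: Collect_conj_eq)
  have e: "{x. 0 \<le> x \<bullet> a \<and> 0 \<le> x \<bullet> b \<and> 0 \<le> x \<bullet> c} = ?H a \<inter> ?H b \<inter> ?H c" by auto
  show ?thesis unfolding e
    using 1 2 3 w[OF a b] w[OF a c] w[OF b c] measure_sph_halfspace[OF nz(1)]
      measure_sph_halfspace[OF nz(2)] measure_sph_halfspace[OF nz(3)]
    by (simp add: add_divide_distrib)
qed

subsection \<open>Circular sectors of a cell\<close>

lemma norm_hdir [simp]: "norm (hdir t) = 1"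
  using norm3_sq[of "hdir t"] norm_ge_zero[of "hdir t"] by (simp add: power2_eq_1_iff)

text \<open>Girard for the isosceles triangle with apex at the pole, apex angle \<open>2 * p\<close>
  and legs whose tangent is \<open>R\<close>. The last normal belongs to the plane through the
  origin and the points at height one above \<open>R\<close> times \<open>hdir s\<close> and
  \<open>hdir t\<close>. Each base angle is \<open>pi/2\<close> minus the arctan term.\<close>

lemma measure_sph_triangle:
  assumes psi: "p = (t - s) / 2" "0 \<le> p" "p < pi/2" and R: "0 < R"
  shows "measure sph {x. 0 \<le> x \<bullet> hdir (s + pi/2) \<and> 0 \<le> x \<bullet> hdir (t - pi/2)
      \<and> 0 \<le> x \<bullet> vector [- cos ((s + t)/2), - sin ((s + t)/2), R * cos p]}
    = (p - arctan (tan p / sqrt (1 + R\<^sup>2))) / (2 * pi)"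
proof -
  define r where "r = sqrt (1 + R\<^sup>2)"
  define n where "n = (vector [- cos ((s + t)/2), - sin ((s + t)/2), R * cos p] :: real^3)"
  have cp: "0 < cos p" using psi by (intro cos_gt_zero_pi) auto
  have sp: "0 \<le> sin p" using psi by (intro sin_ge_zero) auto
  have r: "0 < r" "r\<^sup>2 = 1 + R\<^sup>2" by (auto simp: r_def add_pos_nonneg)
  have nn: "(norm n)\<^sup>2 = 1 + (R * cos p)\<^sup>2" by (simp add: norm3_sq n_def)
  then have "(norm n)\<^sup>2 \<noteq> 0" using zero_le_power2[of "R * cos p"] by linarith
  then have npos: "0 < norm n" by simp
  define m where "m = (1 / norm n) *\<^sub>R n"
  have m1: "norm m = 1" using npos by (simp add: m_def)
  note h1 = norm_hdir
  define u where "u = tan p / r"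
  have u0: "0 \<le> u" using cp sp r by (simp add: u_def tan_def)
  \<comment> \<open>Napier's rule for the right-angled half of the triangle: the right side is
    \<open>sin (arctan u)\<close>, which identifies the base angle.\<close>
  have key: "sin p / norm n = u / sqrt (1 + u\<^sup>2)"
  proof -
    have "(r * cos p)\<^sup>2 * (1 + u\<^sup>2) = (norm n)\<^sup>2"
    proof -
      have "r * cos p * u = sin p" using cp r by (simp add: u_def tan_def)
      then have "(r * cos p)\<^sup>2 * u\<^sup>2 = (sin p)\<^sup>2" by (simp flip: power_mult_distrib)
      then have "(r * cos p)\<^sup>2 * (1 + u\<^sup>2) = r\<^sup>2 * (cos p)\<^sup>2 + (sin p)\<^sup>2"
        by (simp add: distrib_left power_mult_distrib)
      also have "\<dots> = (norm n)\<^sup>2"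
        using sin_cos_squared_add[of p] by (simp add: r nn power_mult_distrib distrib_right)
      finally show ?thesis .
    qed
    then have "sqrt ((r * cos p)\<^sup>2 * (1 + u\<^sup>2)) = norm n" by simp
    then have "norm n = r * cos p * sqrt (1 + u\<^sup>2)" using cp r by (simp add: real_sqrt_mult)
    then show ?thesis using cp r by (simp add: u_def tan_def)
  qed
  have half: "s + pi/2 - (s+t)/2 = pi/2 - p" "(s+t)/2 - (t - pi/2) = pi/2 - p"
    "s + pi/2 - (t - pi/2) = pi - 2 * p" using psi(1) by (simp_all add: field_simps)
  have i12: "hdir (s + pi/2) \<bullet> hdir (t - pi/2) = cos (pi - 2 * p)"
    unfolding half(3)[symmetric] cos_diff[of "s + pi/2" "t - pi/2"] by (simp add: inner3)
  have "hdir (s + pi/2) \<bullet> n = - cos (pi/2 - p)"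
    unfolding half(1)[symmetric] cos_diff[of "s + pi/2" "(s+t)/2"] by (simp add: inner3 n_def)
  then have i13: "hdir (s + pi/2) \<bullet> m = - (sin p / norm n)"
    by (simp add: m_def cos_diff)
  have "hdir (t - pi/2) \<bullet> n = - cos (pi/2 - p)"
    unfolding half(2)[symmetric] cos_diff[of "(s+t)/2" "t - pi/2"] by (simp add: inner3 n_def)
  then have i23: "hdir (t - pi/2) \<bullet> m = - (sin p / norm n)"
    by (simp add: m_def cos_diff)
  have a12: "arccos (hdir (s + pi/2) \<bullet> hdir (t - pi/2)) = pi - 2 * p"
    unfolding i12 using psi by (intro arccos_cos) auto
  have a3: "arccos (- (sin p / norm n)) = pi/2 + arctan u"
  proof -
    have "- (sin p / norm n) = cos (pi/2 + arctan u)"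
      unfolding key by (simp add: cos_add sin_arctan)
    then show ?thesis using arctan_bounded[of u] by (simp add: arccos_cos)
  qed
  have "{x. 0 \<le> x \<bullet> hdir (s + pi/2) \<and> 0 \<le> x \<bullet> hdir (t - pi/2) \<and> 0 \<le> x \<bullet> n}
      = {x. 0 \<le> x \<bullet> hdir (s + pi/2) \<and> 0 \<le> x \<bullet> hdir (t - pi/2) \<and> 0 \<le> x \<bullet> m}"
    using npos by (simp add: m_def zero_le_divide_iff)
  then have "measure sph {x. 0 \<le> x \<bullet> hdir (s + pi/2) \<and> 0 \<le> x \<bullet> hdir (t - pi/2) \<and> 0 \<le> x \<bullet> n}
      = 1/2 - ((pi - 2 * p) + (pi/2 + arctan u) + (pi/2 + arctan u)) / (4 * pi)"
    using measure_sph_trihedral[OF h1 h1 m1, of "s + pi/2" "t - pi/2"] i13 i23 a12 a3 by simp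
  also have "\<dots> = (p - arctan u) / (2 * pi)" by (simp add: field_simps)
  finally show ?thesis by (simp add: n_def u_def r_def)
qed

lemma planar_direction:
  assumes "0 < x \<bullet> hdir c"
  obtains d t where "0 < d" "\<bar>t - c\<bar> < pi/2" "x$1 = d * cos t" "x$2 = d * sin t"
proof -
  define u where "u = x \<bullet> hdir c"
  define v where "v = x \<bullet> hdir (c + pi/2)"
  define w where "w = arctan (v / u)"
  define d where "d = sqrt (u\<^sup>2 + v\<^sup>2)"
  have u: "u > 0" using assms by (simp add: u_def)
  have d: "d > 0" using u by (simp add: d_def add_pos_nonneg)
  have "sqrt (1 + (v/u)\<^sup>2) = d / u"
  proof -
    have "1 + (v/u)\<^sup>2 = (u\<^sup>2 + v\<^sup>2) / u\<^sup>2" using u by (simp add: field_simps power2_eq_square)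
    then show ?thesis using u by (simp add: d_def real_sqrt_divide)
  qed
  then have cw: "d * cos w = u" "d * sin w = v"
    using u d by (simp_all add: w_def cos_arctan sin_arctan)
  have uv: "u = x$1 * cos c + x$2 * sin c" "v = x$2 * cos c - x$1 * sin c"
    by (simp_all add: u_def v_def inner3 cos_add sin_add)
  have "u * cos c - v * sin c = x$1 * ((cos c)\<^sup>2 + (sin c)\<^sup>2)" "u * sin c + v * cos c = x$2 * ((cos c)\<^sup>2 + (sin c)\<^sup>2)"
    unfolding uv by (simp_all only: algebra_simps power2_eq_square)
  then have "u * cos c - v * sin c = x$1" "u * sin c + v * cos c = x$2" by simp_all
  then have "x$1 = d * cos (c + w)" "x$2 = d * sin (c + w)"
    unfolding cos_add sin_add right_diff_distrib distrib_left cw[symmetric]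
    by (simp_all add: ac_simps)
  moreover have "\<bar>w\<bar> < pi/2" unfolding w_def abs_less_iff using arctan_bounded[of "v/u"] by linarith
  ultimately show ?thesis using that[of d "c + w"] d by simp
qed

text \<open>Cramer's rule for the horizontal part of \<open>x\<close> in the basis
  \<open>hdir s\<close>, \<open>hdir t\<close>.\<close>

lemma planar_decomposition:
  fixes x :: "real^3"
  assumes "s < t" "t - s < pi"
  defines "a \<equiv> (x \<bullet> hdir (t - pi/2)) / sin (t - s)" and "b \<equiv> (x \<bullet> hdir (s + pi/2)) / sin (t - s)"
  shows "x$1 = a * cos s + b * cos t" "x$2 = a * sin s + b * sin t"
proof -
  have s: "sin (t - s) > 0" using assms by (intro sin_gt_zero) auto
  have d: "sin (t - s) = sin t * cos s - cos t * sin s" by (simp add: sin_diff)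
  have ab: "x \<bullet> hdir (t - pi/2) = x$1 * sin t - x$2 * cos t"
    "x \<bullet> hdir (s + pi/2) = x$2 * cos s - x$1 * sin s"
    by (simp_all add: inner3 cos_diff sin_diff cos_add sin_add)
  have "x$1 * sin (t - s) = (x \<bullet> hdir (t - pi/2)) * cos s + (x \<bullet> hdir (s + pi/2)) * cos t"
    "x$2 * sin (t - s) = (x \<bullet> hdir (t - pi/2)) * sin s + (x \<bullet> hdir (s + pi/2)) * sin t"
    unfolding ab d by (simp_all add: algebra_simps)
  then show "x$1 = a * cos s + b * cos t" "x$2 = a * sin s + b * sin t"
    using s by (simp_all add: a_def b_def field_simps)
qed

lemma half_differences:
  fixes s t :: real
  shows "s - (s + t)/2 = - ((t - s)/2)" "t - (s + t)/2 = (t - s)/2" "pi - (t - s) = s + pi/2 - (t - pi/2)"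
  by (simp_all add: field_simps)

text \<open>On the plane \<open>x$3 = 1\<close> the conditions
  \<open>x \<bullet> q \<le> x$3\<close> cut out a polygon around the origin inside the disc of
  radius \<open>R\<close>, and \<open>S\<close> is the sector under the edge of \<open>q\<close>.
  The triangle in this sector lies in the isosceles triangle with the same directions and both legs
  of length \<open>R\<close>.\<close>

lemma sector_measure:
  fixes B :: "(real^3) set" and R :: real
  assumes fin: "finite B" and qB: "q \<in> B" and planar: "\<And>q. q \<in> B \<Longrightarrow> q$3 = 0" and R: "0 < R"
    and cov: "\<And>y. y$3 = 0 \<Longrightarrow> \<exists>q\<in>B. norm y \<le> R * (y \<bullet> q)"
  defines "S \<equiv> {x. \<forall>q'\<in>B. x \<bullet> q' \<le> x \<bullet> q}"
  obtains (result) p where "0 \<le> p" "p < pi/2" "measure sph S = p / pi"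
    "measure sph (S \<inter> {x. x \<bullet> q \<le> x$3}) \<le> (p - arctan (tan p / sqrt (1 + R\<^sup>2))) / (2*pi)"
proof -
  have Sdiff: "S = (\<Inter>q'\<in>B. {x. 0 \<le> x \<bullet> (q - q')})" by (auto simp: S_def inner_diff_right)
  have Sb: "S \<in> sets borel" unfolding Sdiff
    using fin qB by (intro sets.finite_INT) auto
  have D: "{x. x \<bullet> q \<le> x$3} \<in> sets borel"
  proof -
    have "{x. x \<bullet> q \<le> x$3} = {x. 0 \<le> x \<bullet> (axis 3 1 - q)}"
      by (auto simp: inner_diff_right inner_axis)
    then show ?thesis by simp
  qed
  have dir: "1 \<le> R * (hdir t \<bullet> q)" if "hdir t \<in> S" for t
  proof -
    obtain q' where "q' \<in> B" "norm (hdir t) \<le> R * (hdir t \<bullet> q')" using cov[of "hdir t"] by auto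
    moreover have "R * (hdir t \<bullet> q') \<le> R * (hdir t \<bullet> q)"
      using that \<open>q' \<in> B\<close> R by (simp add: S_def)
    ultimately show ?thesis by simp
  qed
  \<comment> \<open>Sectors without interior contribute the trivial value
    \<open>p = 0\<close>.\<close>
  have null: thesis if "S \<subseteq> {x. x \<bullet> a = 0}" "a \<noteq> 0" for a
  proof -
    have 1: "measure sph S = 0" by (rule measure_sph_null_subset[OF Sb that])
    have 2: "measure sph (S \<inter> {x. x \<bullet> q \<le> x$3}) = 0"
      using that Sb D by (intro measure_sph_null_subset[of _ a]) auto
    show thesis by (rule result[of 0]) (use 1 2 in auto)
  qed

  have q3: "q$3 = 0" using planar qB by simp
  obtain e c where q: "0 \<le> e" "q$1 = e * cos c" "q$2 = e * sin c"
  proof (cases "q = 0")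
    case True
    then show ?thesis using that[of 0 0] by simp
  next
    case False
    define n where "n = norm q"
    have n: "n > 0" using False by (simp add: n_def)
    have "(q$1 / n)\<^sup>2 + (q$2 / n)\<^sup>2 = ((q$1)\<^sup>2 + (q$2)\<^sup>2) / n\<^sup>2"
      by (simp add: power_divide add_divide_distrib)
    also have "(q$1)\<^sup>2 + (q$2)\<^sup>2 = n\<^sup>2" using norm3_sq[of q] q3 by (simp add: n_def)
    finally have "(q$1 / n)\<^sup>2 + (q$2 / n)\<^sup>2 = 1" using n by simp
    then obtain t where "q$1 / n = cos t" "q$2 / n = sin t" by (metis sincos_total_2pi)
    then show ?thesis using that[of n t] n by (simp add: field_simps)
  qed
  have hq: "hdir t \<bullet> q = e * cos (t - c)" for t
    by (simp add: inner3 q q3 cos_diff algebra_simps)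
  \<comment> \<open>Here \<open>c\<close> is the direction of \<open>q\<close>. By
    \<open>dir\<close>, directions of the sector have positive inner product with \<open>q\<close>,
    so angles within \<open>pi/2\<close> of \<open>c\<close> describe the sector without wrapping
    around.\<close>
  define T where "T = {t. \<bar>t - c\<bar> \<le> pi/2 \<and> hdir t \<in> S}"
  have scale: "hdir t \<in> S" if "x \<in> S" "0 < d" "x$1 = d * cos t" "x$2 = d * sin t" for x d t
  proof -
    have "d * (hdir t \<bullet> (q - q')) = x \<bullet> (q - q')" if "q' \<in> B" for q'
      using planar[OF that] q3 by (simp add: inner3 \<open>x$1 = _\<close> \<open>x$2 = _\<close> algebra_simps)
    moreover have "0 \<le> x \<bullet> (q - q')" if "q' \<in> B" for q' using \<open>x \<in> S\<close> that by (simp add: Sdiff)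
    ultimately show ?thesis using \<open>0 < d\<close> by (auto simp: Sdiff) (metis zero_le_mult_iff not_less)
  qed
  have polar: "\<exists>d t. 0 < d \<and> t \<in> T \<and> x$1 = d * cos t \<and> x$2 = d * sin t" if x: "x \<in> S" "x$1 \<noteq> 0 \<or> x$2 \<noteq> 0" for x
  proof -
    define y where "y = (vector [x$1, x$2, 0] :: real^3)"
    have "y \<noteq> 0" using x(2) by (auto simp: y_def vec_eq_iff forall_3)
    have yB: "y \<bullet> q' = x \<bullet> q'" if "q' \<in> B" for q' using planar[OF that] by (simp add: inner3 y_def)
    obtain q' where "q' \<in> B" "norm y \<le> R * (y \<bullet> q')" using cov[of y] by (auto simp: y_def)
    moreover have "R * (y \<bullet> q') \<le> R * (y \<bullet> q)"
      using x(1) \<open>q' \<in> B\<close> R yB[OF \<open>q' \<in> B\<close>] yB[OF qB] by (simp add: S_def)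
    ultimately have "0 < R * (y \<bullet> q)" using \<open>y \<noteq> 0\<close> by (metis less_le_trans zero_less_norm_iff)
    then have "0 < y \<bullet> q" using R by (simp add: zero_less_mult_iff)
    moreover have "y \<bullet> q = e * (x \<bullet> hdir c)" by (simp add: inner3 y_def q q3 algebra_simps)
    ultimately have "0 < x \<bullet> hdir c" using q(1) by (simp add: zero_less_mult_iff)
    then obtain d t where "0 < d" "\<bar>t - c\<bar> < pi/2" "x$1 = d * cos t" "x$2 = d * sin t"
      by (rule planar_direction)
    moreover then have "hdir t \<in> S" using scale x(1) by blast
    ultimately show ?thesis by (intro exI[of _ d] exI[of _ t]) (simp add: T_def)
  qed
  show thesis
  proof (cases "T = {}")
    case True
    then have "x$1 = 0" if "x \<in> S" for x using polar[OF that] by auto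
    then have "S \<subseteq> {x. x \<bullet> hdir 0 = 0}" by (auto simp: inner3)
    then show thesis using null hdir_nonzero by blast
  next
    case False
    have clT: "closed T"
    proof -
      have "T = {t. \<bar>t - c\<bar> \<le> pi/2} \<inter> (\<Inter>q'\<in>B. {t. 0 \<le> hdir t \<bullet> (q - q')})"
        by (auto simp: T_def Sdiff)
      moreover have "closed {t. \<bar>t - c\<bar> \<le> pi/2}"
        by (intro closed_Collect_le continuous_intros)
      moreover have "closed {t. 0 \<le> hdir t \<bullet> w}" for w
        unfolding inner3 hdir_nth by (intro closed_Collect_le continuous_intros)
      ultimately show ?thesis by (metis closed_INT closed_Int)
    qed
    have bd: "bdd_below T" "bdd_above T"
    proof -
      have "c - pi/2 \<le> v \<and> v \<le> c + pi/2" if "v \<in> T" for v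
        using that unfolding T_def mem_Collect_eq by linarith
      then show "bdd_below T" "bdd_above T" by (meson bdd_belowI bdd_aboveI)+
    qed
    \<comment> \<open>The two bounding rays of the sector; \<open>T\<close> is closed and bounded,
      so both extreme angles belong to it.\<close>
    define s where "s = Inf T"
    define t where "t = Sup T"
    have sT: "s \<in> T" "t \<in> T"
      unfolding s_def t_def using closed_contains_Inf[OF False bd(1) clT] closed_contains_Sup[OF False bd(2) clT] by auto
    have st: "s \<le> v" "v \<le> t" if "v \<in> T" for v
      unfolding s_def t_def using that bd by (auto intro: cInf_lower cSup_upper)
    have strict: "\<bar>v - c\<bar> < pi/2" if "v \<in> T" for v
    proof -
      have "cos (v - c) \<noteq> 0" using dir[of v] that hq[of v] by (auto simp: T_def)
      then have "\<bar>v - c\<bar> \<noteq> pi/2" by (metis cos_abs_real cos_pi_half)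
      then show ?thesis using that by (simp add: T_def)
    qed
    have lt: "s \<le> t" "t - s < pi"
      using st[OF sT(1)] strict[OF sT(1)] strict[OF sT(2)] unfolding abs_less_iff by linarith+
    have sub: "0 \<le> x \<bullet> hdir (s + pi/2) \<and> 0 \<le> x \<bullet> hdir (t - pi/2)" if x: "x \<in> S" for x
    proof (cases "x$1 = 0 \<and> x$2 = 0")
      case True
      then show ?thesis by (simp add: inner3)
    next
      case False
      then obtain d v where v: "0 < d" "v \<in> T" "x$1 = d * cos v" "x$2 = d * sin v"
        using polar[OF x] by auto
      have "x \<bullet> hdir (s + pi/2) = d * sin (v - s)" "x \<bullet> hdir (t - pi/2) = d * sin (t - v)"
        by (simp_all add: inner3 v cos_diff sin_diff cos_add sin_add algebra_simps)
      moreover have "0 \<le> sin (v - s)" "0 \<le> sin (t - v)"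
        using st[OF v(2)] lt by (auto intro!: sin_ge_zero)
      ultimately show ?thesis using v(1) by simp
    qed
    show thesis
    proof (cases "s = t")
      case True
      have "x \<bullet> hdir (t - pi/2) = - (x \<bullet> hdir (s + pi/2))" for x
        by (simp add: inner3 True cos_add sin_add cos_diff sin_diff)
      then have "S \<subseteq> {x. x \<bullet> hdir (s + pi/2) = 0}" using sub by fastforce
      then show thesis using null hdir_nonzero by blast
    next
      case False
      with lt have lt': "s < t" by simp
      define p where "p = (t - s) / 2"
      have p: "0 < p" "p < pi/2" using lt lt' by (auto simp: p_def)
      have sp: "sin (t - s) > 0" using lt lt' by (intro sin_gt_zero) auto
      define a where "a x = (x \<bullet> hdir (t - pi/2)) / sin (t - s)" for x
      define b where "b x = (x \<bullet> hdir (s + pi/2)) / sin (t - s)" for x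
      have dec: "x$1 = a x * cos s + b x * cos t" "x$2 = a x * sin s + b x * sin t" for x
        unfolding a_def b_def by (rule planar_decomposition[OF lt' lt(2)])+
      have decw: "x \<bullet> w = a x * (hdir s \<bullet> w) + b x * (hdir t \<bullet> w)" if "w$3 = 0" for x w
        unfolding inner3 hdir_nth that dec[of x] by (simp add: algebra_simps)
      have S_eq: "S = {x. 0 \<le> x \<bullet> hdir (s + pi/2) \<and> 0 \<le> x \<bullet> hdir (t - pi/2)}"
      proof (intro equalityI subsetI)
        fix x assume "x \<in> S" then show "x \<in> {x. 0 \<le> x \<bullet> hdir (s + pi/2) \<and> 0 \<le> x \<bullet> hdir (t - pi/2)}"
          using sub by blast
      next
        fix x assume "x \<in> {x. 0 \<le> x \<bullet> hdir (s + pi/2) \<and> 0 \<le> x \<bullet> hdir (t - pi/2)}"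
        then have ab: "0 \<le> a x" "0 \<le> b x" using sp by (auto simp: a_def b_def)
        have "0 \<le> x \<bullet> (q - q')" if "q' \<in> B" for q'
        proof -
          have "(q - q')$3 = 0" using planar[OF that] q3 by simp
          moreover have "0 \<le> hdir s \<bullet> (q - q')" "0 \<le> hdir t \<bullet> (q - q')"
            using sT that by (auto simp: T_def Sdiff)
          ultimately show ?thesis using ab by (simp add: decw[of "q - q'" x])
        qed
        then show "x \<in> S" by (simp add: Sdiff)
      qed
      have "hdir (s + pi/2) \<bullet> hdir (t - pi/2) = cos (pi - 2 * p)"
      proof -
        have "2 * p = t - s" by (simp add: p_def)
        then have e: "pi - 2 * p = s + pi/2 - (t - pi/2)" by (simp only: half_differences)
        show ?thesis unfolding e cos_diff[of "s + pi/2" "t - pi/2"] by (simp add: inner3)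
      qed
      then have "arccos (hdir (s + pi/2) \<bullet> hdir (t - pi/2)) = pi - 2 * p"
        using p by (simp only:) (intro arccos_cos, auto)
      then have m1: "measure sph S = p / pi"
        unfolding S_eq using measure_sph_wedge[OF norm_hdir norm_hdir, of "s + pi/2" "t - pi/2"]
        by (simp add: field_simps)
      define n where "n = (vector [- cos ((s + t)/2), - sin ((s + t)/2), R * cos p] :: real^3)"
      have cp: "0 < cos p" using p by (intro cos_gt_zero) auto
      \<comment> \<open>In the coordinates \<open>a x\<close>, \<open>b x\<close> the claim is the
        chord inequality \<open>a x + b x \<le> R * x$3\<close> of the larger triangle. It holds
        because \<open>dir\<close> places both ends of the edge within distance
        \<open>R\<close>.\<close>
      have n3: "0 \<le> x \<bullet> n" if x: "x \<in> S" "x \<bullet> q \<le> x$3" for x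
      proof -
        have ab: "0 \<le> a x" "0 \<le> b x" using x(1) sp by (auto simp: a_def b_def S_eq)
        have 1: "1 \<le> R * (hdir s \<bullet> q)" "1 \<le> R * (hdir t \<bullet> q)" using dir sT by (auto simp: T_def)
        have "a x + b x \<le> a x * (R * (hdir s \<bullet> q)) + b x * (R * (hdir t \<bullet> q))"
          using mult_left_mono[OF 1(1) ab(1)] mult_left_mono[OF 1(2) ab(2)] by simp
        also have "\<dots> = R * (x \<bullet> q)" by (simp add: decw[OF q3, of x] algebra_simps)
        also have "\<dots> \<le> R * x$3" using x(2) R by simp
        finally have "a x + b x \<le> R * x$3" .
        moreover have "x \<bullet> n = (R * x$3 - (a x + b x)) * cos p"
        proof -
          have c: "cos (s - (s+t)/2) = cos p" "cos (t - (s+t)/2) = cos p"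
          proof -
            have "s - (s+t)/2 = - p" "t - (s+t)/2 = p" unfolding p_def by (rule half_differences)+
            then show "cos (s - (s+t)/2) = cos p" "cos (t - (s+t)/2) = cos p" by simp_all
          qed
          have "x \<bullet> n = R * cos p * x$3 - (a x * cos (s - (s+t)/2) + b x * cos (t - (s+t)/2))"
            unfolding cos_diff[of s] cos_diff[of t]
            unfolding inner3 n_def vector_3 dec[of x] by (simp add: algebra_simps)
          then show ?thesis unfolding c by (simp add: algebra_simps)
        qed
        ultimately show ?thesis using cp by simp
      qed
      have "measure sph (S \<inter> {x. x \<bullet> q \<le> x$3}) \<le>
        measure sph {x. 0 \<le> x \<bullet> hdir (s + pi/2) \<and> 0 \<le> x \<bullet> hdir (t - pi/2) \<and> 0 \<le> x \<bullet> n}"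
        using n3 by (intro sph.finite_measure_mono) (auto simp: S_eq)
      also have "\<dots> = (p - arctan (tan p / sqrt (1 + R\<^sup>2))) / (2 * pi)"
        unfolding n_def using p R by (intro measure_sph_triangle) (auto simp: p_def)
      finally show thesis using m1 p by (intro result[of p]) auto
    qed
  qed
qed

lemma AE_sph_off_hyperplane:
  assumes "a \<noteq> 0"
  shows "AE x in sph. x \<bullet> a \<noteq> 0"
proof (rule AE_I)
  show "emeasure sph {x. x \<bullet> a = 0} = 0"
    using measure_sph_hyperplane[OF assms] by (simp add: sph.emeasure_eq_measure)
qed auto

text \<open>The sectors cover space and overlap only in planes, so their half-angles sum to
  \<open>pi\<close>; the cell is covered by its pieces in the sectors.\<close>

lemma sector_decomposition:
  fixes B :: "(real^3) set" and R :: real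
  assumes fin: "finite B" and planar: "\<And>q. q \<in> B \<Longrightarrow> q$3 = 0" and R: "0 < R"
    and cov: "\<And>y. y$3 = 0 \<Longrightarrow> \<exists>q\<in>B. norm y \<le> R * (y \<bullet> q)"
  obtains p where "\<forall>q\<in>B. 0 \<le> p q \<and> p q < pi/2" "(\<Sum>q\<in>B. p q) = pi"
    "2 * pi * measure sph {x. \<forall>q\<in>B. x \<bullet> q \<le> x$3} \<le> pi - (\<Sum>q\<in>B. arctan (tan (p q) / sqrt (1 + R\<^sup>2)))"
proof -
  define S where "S q = {x. \<forall>q'\<in>B. x \<bullet> q' \<le> x \<bullet> q}" for q
  define D where "D = {x. \<forall>q\<in>B. x \<bullet> q \<le> x$3}"
  define r where "r = sqrt (1 + R\<^sup>2)"
  have "\<forall>q\<in>B. \<exists>p. 0 \<le> p \<and> p < pi/2 \<and> measure sph (S q) = p / pi \<and>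
    measure sph (S q \<inter> {x. x \<bullet> q \<le> x$3}) \<le> (p - arctan (tan p / r)) / (2*pi)"
  proof
    fix q assume q: "q \<in> B"
    obtain p where "0 \<le> p" "p < pi/2" "measure sph (S q) = p / pi"
      "measure sph (S q \<inter> {x. x \<bullet> q \<le> x$3}) \<le> (p - arctan (tan p / r)) / (2*pi)"
      by (rule sector_measure[OF fin q planar R cov, folded S_def r_def])
    then show "\<exists>p. 0 \<le> p \<and> p < pi/2 \<and> measure sph (S q) = p / pi \<and>
      measure sph (S q \<inter> {x. x \<bullet> q \<le> x$3}) \<le> (p - arctan (tan p / r)) / (2*pi)"
      by (intro exI[of _ p]) simp
  qed
  from bchoice[OF this] obtain p where
    p: "\<And>q. q \<in> B \<Longrightarrow> 0 \<le> p q \<and> p q < pi/2 \<and> measure sph (S q) = p q / pi \<and>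
    measure sph (S q \<inter> {x. x \<bullet> q \<le> x$3}) \<le> (p q - arctan (tan (p q) / r)) / (2*pi)"
    by blast
  have ne: "B \<noteq> {}" using cov[of 0] by auto
  have Sb: "S q \<in> sets sph" for q
  proof -
    have "S q = (\<Inter>q'\<in>B. {x. 0 \<le> x \<bullet> (q - q')})" by (auto simp: S_def inner_diff_right)
    then show ?thesis using fin ne by (auto intro!: sets.finite_INT)
  qed
  have half: "{x. x \<bullet> q \<le> x$3} \<in> sets sph" for q
  proof -
    have "{x. x \<bullet> q \<le> x$3} = {x. 0 \<le> x \<bullet> (axis 3 1 - q)}"
      by (auto simp: inner_diff_right inner_axis)
    then show ?thesis by simp
  qed
  have U: "(\<Union>q\<in>B. S q) = UNIV"
  proof -
    have "\<exists>q\<in>B. \<forall>q'\<in>B. x \<bullet> q' \<le> x \<bullet> q" for x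
    proof -
      have "Max ((\<lambda>q. x \<bullet> q) ` B) \<in> (\<lambda>q. x \<bullet> q) ` B" using fin ne by (intro Max_in) auto
      then obtain q where "q \<in> B" "x \<bullet> q = Max ((\<lambda>q. x \<bullet> q) ` B)" by (metis imageE)
      then show ?thesis using fin by (intro bexI[of _ q]) simp_all
    qed
    then show ?thesis by (auto simp: S_def)
  qed
  have "measure sph (\<Union>q\<in>B. S q) = (\<Sum>q\<in>B. measure sph (S q))"
  proof (rule measure_UNION_AE)
    show "pairwise (\<lambda>m n. AE x in sph. x \<notin> S m \<or> x \<notin> S n) B"
    proof (rule pairwiseI)
      fix q q' assume "q \<in> B" "q' \<in> B" "q \<noteq> q'"
      then have "AE x in sph. x \<bullet> (q - q') \<noteq> 0" by (intro AE_sph_off_hyperplane) simp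
      then show "AE x in sph. x \<notin> S q \<or> x \<notin> S q'"
      proof (rule eventually_mono)
        fix x assume "x \<bullet> (q - q') \<noteq> 0"
        then have "x \<bullet> q \<noteq> x \<bullet> q'" by (simp add: inner_diff_right)
        then show "x \<notin> S q \<or> x \<notin> S q'"
          using \<open>q \<in> B\<close> \<open>q' \<in> B\<close> unfolding S_def mem_Collect_eq by (meson order_antisym)
      qed
    qed
  qed (use fin Sb in \<open>auto simp: sph.fmeasurable_eq_sets\<close>)
  then have "(\<Sum>q\<in>B. p q / pi) = 1" using p by (simp add: U measure_sph_UNIV)
  then have sum: "(\<Sum>q\<in>B. p q) = pi" by (simp flip: sum_divide_distrib)
  have "measure sph D \<le> measure sph (\<Union>q\<in>B. S q \<inter> {x. x \<bullet> q \<le> x$3})"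
  proof (rule sph.finite_measure_mono)
    show "D \<subseteq> (\<Union>q\<in>B. S q \<inter> {x. x \<bullet> q \<le> x$3})"
    proof
      fix x assume x: "x \<in> D"
      obtain q where "q \<in> B" "x \<in> S q" using U by auto
      then show "x \<in> (\<Union>q\<in>B. S q \<inter> {x. x \<bullet> q \<le> x$3})" using x by (auto simp: D_def)
    qed
  qed (use fin Sb half in \<open>auto intro!: sets.finite_UN\<close>)
  also have "\<dots> \<le> (\<Sum>q\<in>B. measure sph (S q \<inter> {x. x \<bullet> q \<le> x$3}))"
    using fin Sb half by (intro sph.finite_measure_subadditive_finite) auto
  also have "\<dots> \<le> (\<Sum>q\<in>B. (p q - arctan (tan (p q) / r)) / (2*pi))"
    using p by (intro sum_mono) blast
  also have "\<dots> = (pi - (\<Sum>q\<in>B. arctan (tan (p q) / r))) / (2 * pi)"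
    by (simp add: sum_subtractf sum flip: sum_divide_distrib)
  finally have "2 * pi * measure sph D \<le> pi - (\<Sum>q\<in>B. arctan (tan (p q) / r))"
    by (simp add: field_simps)
  then show ?thesis using that[of p] p sum by (simp add: D_def r_def)
qed

subsection \<open>Measure of a spherical cell inside a cap\<close>

text \<open>The derivative is \<open>h / (1 - (1 - h^2) * (sin x)^2)\<close>, which increases on
  this range for \<open>h \<le> 1\<close>; so the function is convex.\<close>

lemma arctan_tan_above_tangent:
  fixes h p x :: real
  assumes h: "0 < h" "h \<le> 1" and p: "0 < p" "p < pi/2" and x: "0 \<le> x" "x < pi/2"
  shows "arctan (h * tan p) + h / ((cos p)\<^sup>2 + h\<^sup>2 * (sin p)\<^sup>2) * (x - p) \<le> arctan (h * tan x)"
proof -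
  define f where "f = (\<lambda>x. arctan (h * tan x))"
  define f' where "f' x = h / ((cos x)\<^sup>2 + h\<^sup>2 * (sin x)\<^sup>2)" for x
  have c: "0 < cos y" if "y \<in> {0..<pi/2}" for y using that by (intro cos_gt_zero_pi) auto
  have d: "(f has_real_derivative f' y) (at y)" if y: "y \<in> {0..<pi/2}" for y
  proof -
    have "(f has_real_derivative (h * inverse ((cos y)\<^sup>2)) * inverse (1 + (h * tan y)\<^sup>2)) (at y)"
      unfolding f_def using c[OF y] by (auto intro!: derivative_eq_intros)
    moreover have "(h * inverse ((cos y)\<^sup>2)) * inverse (1 + (h * tan y)\<^sup>2) = f' y"
    proof -
      have "(cos y)\<^sup>2 * (1 + (h * tan y)\<^sup>2) = (cos y)\<^sup>2 + h\<^sup>2 * (sin y)\<^sup>2"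
        using c[OF y] by (simp add: tan_def power_mult_distrib power_divide distrib_left)
      then show ?thesis by (simp add: f'_def divide_inverse mult.assoc flip: inverse_mult_distrib)
    qed
    ultimately show ?thesis by simp
  qed
  have pos: "0 < (cos y)\<^sup>2 + h\<^sup>2 * (sin y)\<^sup>2" if "y \<in> {0..<pi/2}" for y
    using c[OF that] by (intro add_pos_nonneg) auto
  have conv: "convex_on {0..<pi/2} f"
  proof (rule convex_on_realI)
    fix a b assume ab: "a \<in> {0..<pi/2}" "b \<in> {0..<pi/2}" "a \<le> b"
    have "sin a \<le> sin b" using ab by (intro sin_monotone_2pi_le) auto
    then have "(sin a)\<^sup>2 \<le> (sin b)\<^sup>2" using ab by (intro power_mono sin_ge_zero) auto
    moreover have "h\<^sup>2 \<le> 1" using h by (simp add: power_le_one)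
    ultimately have "(1 - h\<^sup>2) * (sin a)\<^sup>2 \<le> (1 - h\<^sup>2) * (sin b)\<^sup>2" by (intro mult_left_mono) auto
    then have "(cos b)\<^sup>2 + h\<^sup>2 * (sin b)\<^sup>2 \<le> (cos a)\<^sup>2 + h\<^sup>2 * (sin a)\<^sup>2"
      unfolding cos_squared_eq by (simp add: algebra_simps)
    then show "f' a \<le> f' b" unfolding f'_def using h pos[OF ab(2)] by (intro divide_left_mono) auto
  qed (use d in auto)
  have "f' p * (x - p) \<le> f x - f p"
    by (rule convex_on_imp_above_tangent[OF conv]) (use p x d[of p] in \<open>auto intro: DERIV_subset\<close>)
  then show ?thesis by (simp add: f_def f'_def)
qed

text \<open>The derivative is at least \<open>h\<close>, its value at zero. This yields the bound
  that does not involve the number of sides.\<close>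

lemma arctan_tan_ge_linear:
  fixes h x :: real
  assumes h: "0 < h" "h \<le> 1" and x: "0 \<le> x" "x < pi/2"
  shows "h * x \<le> arctan (h * tan x)"
proof -
  let ?g = "\<lambda>x. arctan (h * tan x) - h * x"
  have "?g 0 \<le> ?g x"
  proof (rule DERIV_nonneg_imp_nondecreasing[OF x(1)])
    fix y assume y: "0 \<le> y" "y \<le> x"
    then have c: "0 < cos y" using x by (intro cos_gt_zero_pi) auto
    have "(?g has_real_derivative (h * inverse ((cos y)\<^sup>2)) * inverse (1 + (h * tan y)\<^sup>2) - h) (at y)"
      using c by (auto intro!: derivative_eq_intros)
    moreover have "0 \<le> (h * inverse ((cos y)\<^sup>2)) * inverse (1 + (h * tan y)\<^sup>2) - h"
    proof -
      have "(cos y)\<^sup>2 * (1 + (h * tan y)\<^sup>2) = (cos y)\<^sup>2 + h\<^sup>2 * (sin y)\<^sup>2"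
        using c by (simp add: tan_def power_mult_distrib power_divide distrib_left)
      also have "\<dots> \<le> (cos y)\<^sup>2 + 1 * (sin y)\<^sup>2"
        using h by (intro add_mono mult_right_mono) (auto simp: power_le_one)
      finally have "(cos y)\<^sup>2 * (1 + (h * tan y)\<^sup>2) \<le> 1" by simp
      moreover have "0 < (cos y)\<^sup>2 * (1 + (h * tan y)\<^sup>2)"
        using c by (intro mult_pos_pos add_pos_nonneg) auto
      ultimately have "1 \<le> inverse ((cos y)\<^sup>2 * (1 + (h * tan y)\<^sup>2))" using one_le_inverse by blast
      then have "h * 1 \<le> h * inverse ((cos y)\<^sup>2 * (1 + (h * tan y)\<^sup>2))" using h by (intro mult_left_mono) auto
      then show ?thesis by (simp add: mult.assoc)
    qed
    ultimately show "\<exists>z. (?g has_real_derivative z) (at y) \<and> 0 \<le> z" by blast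
  qed
  then show ?thesis by simp
qed

text \<open>Jensen's inequality with the tangent at \<open>pi / N\<close>. There may be fewer than
  \<open>N\<close> terms: the function vanishes at zero, so the tangent is nonpositive there, and
  omitting terms can only raise the bound.\<close>

lemma sum_arctan_tan_ge:
  fixes p :: "'a \<Rightarrow> real"
  assumes B: "finite B" "card B \<le> N" and N: "3 \<le> N" and h: "0 < h" "h \<le> 1"
    and p: "\<And>q. q \<in> B \<Longrightarrow> 0 \<le> p q \<and> p q < pi/2" and sum: "(\<Sum>q\<in>B. p q) = pi"
  shows "real N * arctan (h * tan (pi / N)) \<le> (\<Sum>q\<in>B. arctan (h * tan (p q)))"
proof -
  define a where "a = pi / N"
  have a: "0 < a" "a < pi/2" using N by (auto simp: a_def divide_less_eq)
  define d where "d = h / ((cos a)\<^sup>2 + h\<^sup>2 * (sin a)\<^sup>2)"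
  have tang: "arctan (h * tan a) + d * (x - a) \<le> arctan (h * tan x)" if "0 \<le> x" "x < pi/2" for x
    unfolding d_def by (rule arctan_tan_above_tangent[OF h a that])
  have neg: "arctan (h * tan a) - d * a \<le> 0" using tang[of 0] by simp
  have "real N * arctan (h * tan a) = real N * (arctan (h * tan a) - d * a) + d * pi"
    using N by (simp add: a_def algebra_simps)
  also have "\<dots> \<le> real (card B) * (arctan (h * tan a) - d * a) + d * pi"
    using B neg by (intro add_right_mono mult_right_mono_neg) auto
  also have "\<dots> = (\<Sum>q\<in>B. arctan (h * tan a) + d * (p q - a))"
  proof -
    have "(\<Sum>q\<in>B. arctan (h * tan a) + d * (p q - a)) = (\<Sum>q\<in>B. (arctan (h * tan a) - d * a) + d * p q)"
      by (intro sum.cong) (auto simp: algebra_simps)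
    also have "\<dots> = real (card B) * (arctan (h * tan a) - d * a) + d * (\<Sum>q\<in>B. p q)"
      by (simp add: sum.distrib sum_distrib_left)
    finally show ?thesis using sum by simp
  qed
  also have "\<dots> \<le> (\<Sum>q\<in>B. arctan (h * tan (p q)))" using p tang by (intro sum_mono) auto
  finally show ?thesis by (simp add: a_def)
qed

text \<open>Scaling every normal to third coordinate one gives the cell the form required by
  \<open>sector_decomposition\<close>; different normals may coincide afterwards, hence only an
  inequality between the cardinalities.\<close>

lemma cell_sectors:
  fixes A :: "(real^3) set"
  assumes fin: "finite A" and pos: "\<And>a. a \<in> A \<Longrightarrow> 0 < a$3"
    and cov: "\<And>x. \<forall>a\<in>A. 0 \<le> x \<bullet> a \<Longrightarrow> norm x \<le> r * x$3" and r: "0 < r"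
  obtains B :: "(real^3) set" and p where "finite B" "card B \<le> card A" "1 < r"
    "\<forall>q\<in>B. 0 \<le> p q \<and> p q < pi/2" "(\<Sum>q\<in>B. p q) = pi"
    "2 * pi * measure sph {x. \<forall>a\<in>A. 0 \<le> x \<bullet> a} \<le> pi - (\<Sum>q\<in>B. arctan (tan (p q) / r))"
proof -
  define Q where "Q a = (vector [- a$1 / a$3, - a$2 / a$3, 0] :: real^3)" for a :: "real^3"
  define B where "B = Q ` A"
  have fB: "finite B" "card B \<le> card A" using fin by (auto simp: B_def card_image_le)
  have Q: "0 \<le> x \<bullet> a \<longleftrightarrow> x \<bullet> Q a \<le> x$3" if "a \<in> A" for a x
  proof -
    have "x \<bullet> a = a$3 * (x$3 - x \<bullet> Q a)"
      using pos[OF that] by (simp add: inner3 Q_def field_simps)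
    then show ?thesis using pos[OF that] by (simp add: zero_le_mult_iff)
  qed
  have D: "{x. \<forall>a\<in>A. 0 \<le> x \<bullet> a} = {x. \<forall>q\<in>B. x \<bullet> q \<le> x$3}" using Q by (auto simp: B_def)
  have ne: "A \<noteq> {}"
  proof
    assume "A = {}"
    then have "norm (- axis 3 1 :: real^3) \<le> r * (- axis 3 1 :: real^3)$3" by (intro cov) auto
    then show False using r by simp
  qed
  have cov2: "\<exists>q\<in>B. (norm y)\<^sup>2 \<le> (r\<^sup>2 - 1) * (y \<bullet> q)\<^sup>2 \<and> 0 \<le> y \<bullet> q" if y: "y$3 = 0" for y
  proof -
    define M where "M = Max ((\<lambda>q. y \<bullet> q) ` B)"
    have "M \<in> (\<lambda>q. y \<bullet> q) ` B" unfolding M_def using fB ne by (intro Max_in) (auto simp: B_def)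
    then obtain q where q: "q \<in> B" "M = y \<bullet> q" by auto
    have "y \<bullet> q' \<le> M" if "q' \<in> B" for q' unfolding M_def using fB that by simp
    \<comment> \<open>The lowest point of the cell above \<open>y\<close>, where the cap condition
      says most about the maximum \<open>M\<close>.\<close>
    then have "y + M *\<^sub>R axis 3 1 \<in> {x. \<forall>q\<in>B. x \<bullet> q \<le> x$3}"
    proof -
      have "axis 3 1 \<bullet> q' = 0" if "q' \<in> B" for q'
        using that by (auto simp: inner_axis' B_def Q_def)
      then show ?thesis using y \<open>\<And>q'. q' \<in> B \<Longrightarrow> y \<bullet> q' \<le> M\<close> by (simp add: inner_add_left)
    qed
    then have "norm (y + M *\<^sub>R axis 3 1) \<le> r * (y + M *\<^sub>R axis 3 1)$3"
      using cov[of "y + M *\<^sub>R axis 3 1"] D by blast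
    then have le: "norm (y + M *\<^sub>R axis 3 1) \<le> r * M" using y by simp
    have "0 \<le> r * M" using norm_ge_zero le by (rule order_trans)
    then have M0: "0 \<le> M" using r by (simp add: zero_le_mult_iff)
    have "(norm (y + M *\<^sub>R axis 3 1))\<^sup>2 \<le> (r * M)\<^sup>2" using le by (intro power_mono) auto
    moreover have "(norm (y + M *\<^sub>R axis 3 1))\<^sup>2 = (norm y)\<^sup>2 + M\<^sup>2"
      using y by (simp add: norm3_sq axis_def)
    ultimately have "(norm y)\<^sup>2 \<le> (r\<^sup>2 - 1) * M\<^sup>2" by (simp add: power_mult_distrib algebra_simps)
    then show ?thesis using q M0 by blast
  qed
  have r1: "1 < r"
  proof (rule ccontr)
    assume "\<not> 1 < r"
    then have "r\<^sup>2 \<le> 1" using r by (simp add: power_le_one)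
    moreover obtain q where "(norm (hdir 0))\<^sup>2 \<le> (r\<^sup>2 - 1) * (hdir 0 \<bullet> q)\<^sup>2" using cov2[of "hdir 0"] by auto
    moreover have "(r\<^sup>2 - 1) * (hdir 0 \<bullet> q)\<^sup>2 \<le> 0" using \<open>r\<^sup>2 \<le> 1\<close> by (intro mult_nonpos_nonneg) auto
    ultimately show False by simp
  qed
  \<comment> \<open>The cosine of the angular radius of the cap is \<open>1 / r\<close>, and
    \<open>R\<close> is its tangent.\<close>
  define R where "R = sqrt (r\<^sup>2 - 1)"
  have r2: "0 < r\<^sup>2 - 1" using r1 by (simp add: one_less_power)
  have R: "0 < R" "sqrt (1 + R\<^sup>2) = r" using r2 r1 by (auto simp: R_def)
  have planar: "q$3 = 0" if "q \<in> B" for q using that by (auto simp: B_def Q_def)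
  have cov3: "\<exists>q\<in>B. norm y \<le> R * (y \<bullet> q)" if y: "y$3 = 0" for y
  proof -
    obtain q where q: "q \<in> B" "(norm y)\<^sup>2 \<le> (r\<^sup>2 - 1) * (y \<bullet> q)\<^sup>2" "0 \<le> y \<bullet> q" using cov2[OF y] by blast
    have "(norm y)\<^sup>2 \<le> (R * (y \<bullet> q))\<^sup>2" using q(2) r2 by (simp add: R_def power_mult_distrib)
    then have "norm y \<le> R * (y \<bullet> q)" by (rule power2_le_imp_le) (use q(3) R in simp)
    then show ?thesis using q(1) by blast
  qed
  obtain p where "\<forall>q\<in>B. 0 \<le> p q \<and> p q < pi/2" "(\<Sum>q\<in>B. p q) = pi"
    "2 * pi * measure sph {x. \<forall>q\<in>B. x \<bullet> q \<le> x$3} \<le> pi - (\<Sum>q\<in>B. arctan (tan (p q) / sqrt (1 + R\<^sup>2)))"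
    by (rule sector_decomposition[OF fB(1) planar R(1) cov3])
  then show ?thesis using that[of B p, OF fB r1] unfolding D R(2) by blast
qed

lemma rotate_to_axis:
  fixes u :: "real^3"
  assumes "norm u = 1"
  obtains f where "orthogonal_transformation f" "\<forall>x. (f x)$3 = x \<bullet> u"
    "\<forall>A. finite A \<longrightarrow> measure sph {x. \<forall>a\<in>A. 0 \<le> x \<bullet> a} = measure sph {x. \<forall>a\<in>f ` A. 0 \<le> x \<bullet> a}"
proof -
  obtain f :: "real^3 \<Rightarrow> real^3" where f: "orthogonal_transformation f" "f u = axis 3 1"
    using orthogonal_transformation_exists[of u "axis 3 1 :: real^3"] assms by auto
  have ip: "f x \<bullet> f y = x \<bullet> y" for x y using f(1) by (simp add: orthogonal_transformation_def)
  have 3: "(f x)$3 = x \<bullet> u" for x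
    using ip[of x u] by (simp add: f(2) inner_axis)
  show ?thesis
  proof (rule that[OF f(1)]; intro allI impI)
    show "(f x)$3 = x \<bullet> u" for x by (rule 3)
    fix A :: "(real^3) set"
    assume A: "finite A"
    have "{x. \<forall>a\<in>f ` A. 0 \<le> x \<bullet> a} = (if A = {} then UNIV else (\<Inter>b\<in>f ` A. {x. 0 \<le> x \<bullet> b}))" by auto
    also have "\<dots> \<in> sets borel" using A by (auto intro!: sets.finite_INT)
    finally have "measure sph {x. f x \<in> {x. \<forall>a\<in>f ` A. 0 \<le> x \<bullet> a}} = measure sph {x. \<forall>a\<in>f ` A. 0 \<le> x \<bullet> a}"
      by (rule measure_sph_orthogonal[OF f(1)])
    then show "measure sph {x. \<forall>a\<in>A. 0 \<le> x \<bullet> a} = measure sph {x. \<forall>a\<in>f ` A. 0 \<le> x \<bullet> a}" by (simp add: ip)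
  qed
qed

text \<open>The second bound is half the area of the whole cap and holds for any number of sides;
  the first is sharper when that number is known.\<close>

lemma cell_measure_centered:
  fixes A :: "(real^3) set"
  assumes fin: "finite A" and u: "norm u = 1" and pos: "\<And>a. a \<in> A \<Longrightarrow> 0 < u \<bullet> a"
    and cov: "\<And>x. \<forall>a\<in>A. 0 \<le> x \<bullet> a \<Longrightarrow> norm x \<le> r * (x \<bullet> u)" and r: "0 < r"
  shows "card A \<le> N \<Longrightarrow> 3 \<le> N \<Longrightarrow>
      2 * pi * measure sph {x. \<forall>a\<in>A. 0 \<le> x \<bullet> a} \<le> pi - real N * arctan (tan (pi / N) / r)"
    and "2 * pi * measure sph {x. \<forall>a\<in>A. 0 \<le> x \<bullet> a} \<le> pi - pi / r"
proof -
  obtain f where f': "orthogonal_transformation f" "\<forall>x. (f x)$3 = x \<bullet> u"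
    "\<forall>A. finite A \<longrightarrow> measure sph {x. \<forall>a\<in>A. 0 \<le> x \<bullet> a} = measure sph {x. \<forall>a\<in>f ` A. 0 \<le> x \<bullet> a}"
    by (rule rotate_to_axis[OF u])
  note f = f'(1) f'(2)[rule_format] f'(3)[rule_format]
  have ip: "f x \<bullet> f y = x \<bullet> y" for x y using f(1) by (simp add: orthogonal_transformation_def)
  obtain B :: "(real^3) set" and p where B: "finite B" "card B \<le> card (f ` A)" "1 < r"
    and p': "\<forall>q\<in>B. 0 \<le> p q \<and> p q < pi/2" and psum: "(\<Sum>q\<in>B. p q) = pi"
    and m: "2 * pi * measure sph {x. \<forall>a\<in>f ` A. 0 \<le> x \<bullet> a} \<le> pi - (\<Sum>q\<in>B. arctan (tan (p q) / r))"
  proof (rule cell_sectors[of "f ` A" r])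
    show "norm y \<le> r * y$3" if y: "\<forall>a\<in>f ` A. 0 \<le> y \<bullet> a" for y
    proof -
      obtain x where "y = f x" using orthogonal_transformation_surj[OF f(1)] by (metis surjD)
      then show ?thesis using cov[of x] y f(2)[of x] by (simp add: ip orthogonal_transformation_norm[OF f(1)])
    qed
  qed (use fin r pos in \<open>auto simp: f(2) inner_commute\<close>)
  note p = bspec[OF p'] psum
  have h: "0 < 1 / r" "1 / r \<le> 1" using B by auto
  have mA: "2 * pi * measure sph {x. \<forall>a\<in>A. 0 \<le> x \<bullet> a} \<le> pi - (\<Sum>q\<in>B. arctan (1 / r * tan (p q)))"
    using m f(3)[of A] fin by simp
  show "2 * pi * measure sph {x. \<forall>a\<in>A. 0 \<le> x \<bullet> a} \<le> pi - real N * arctan (tan (pi / N) / r)"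
    if N: "card A \<le> N" "3 \<le> N"
  proof -
    have "card B \<le> N" using B(2) card_image_le[OF fin, of f] N by linarith
    from sum_arctan_tan_ge[OF B(1) this N(2) h p] show ?thesis using mA by simp
  qed
  have "(\<Sum>q\<in>B. 1 / r * p q) \<le> (\<Sum>q\<in>B. arctan (1 / r * tan (p q)))"
    using p(1) h by (intro sum_mono arctan_tan_ge_linear) auto
  then show "2 * pi * measure sph {x. \<forall>a\<in>A. 0 \<le> x \<bullet> a} \<le> pi - pi / r"
    using mA p(2) by (simp flip: sum_divide_distrib)
qed

lemma planar_Cauchy_Schwarz:
  fixes p q t :: real
  shows "(p * cos t + q * sin t)\<^sup>2 \<le> p\<^sup>2 + q\<^sup>2"
proof -
  have "(p * cos t + q * sin t)\<^sup>2 + (p * sin t - q * cos t)\<^sup>2 = (p\<^sup>2 + q\<^sup>2) * ((sin t)\<^sup>2 + (cos t)\<^sup>2)"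
    by algebra
  then have "(p * cos t + q * sin t)\<^sup>2 + (p * sin t - q * cos t)\<^sup>2 = p\<^sup>2 + q\<^sup>2" by simp
  then show ?thesis using zero_le_power2[of "p * sin t - q * cos t"] by linarith
qed

text \<open>If the axis lies outside a cell, the cell lies in half of its cap, which is contained in the
  cone over a right isosceles triangle circumscribed about that half.\<close>

lemma cell_measure_eccentric:
  fixes A :: "(real^3) set"
  assumes fin: "finite A" and u: "norm u = 1" and a: "a \<in> A" "u \<bullet> a \<le> 0" "a \<noteq> 0"
    and cov: "\<And>x. \<forall>a\<in>A. 0 \<le> x \<bullet> a \<Longrightarrow> norm x \<le> r * (x \<bullet> u)" and r: "1 \<le> r"
  shows "2 * pi * measure sph {x. \<forall>a\<in>A. 0 \<le> x \<bullet> a} \<le> pi/2 - sqrt 2 / r"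
proof -
  obtain f where f': "orthogonal_transformation f" "\<forall>x. (f x)$3 = x \<bullet> u"
    "\<forall>A. finite A \<longrightarrow> measure sph {x. \<forall>a\<in>A. 0 \<le> x \<bullet> a} = measure sph {x. \<forall>a\<in>f ` A. 0 \<le> x \<bullet> a}"
    by (rule rotate_to_axis[OF u])
  note f = f'(1) f'(2)[rule_format] f'(3)[rule_format]
  have ip: "f x \<bullet> f y = x \<bullet> y" for x y using f(1) by (simp add: orthogonal_transformation_def)
  define D where "D = {x. \<forall>a\<in>f ` A. 0 \<le> x \<bullet> a}"
  have mD: "measure sph {x. \<forall>a\<in>A. 0 \<le> x \<bullet> a} = measure sph D" using f(3)[of A] fin by (simp add: D_def)
  have Db: "D \<in> sets borel"
  proof -
    have "D = (\<Inter>b\<in>f ` A. {x. 0 \<le> x \<bullet> b})" by (auto simp: D_def)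
    then show ?thesis using fin a(1) by (auto intro!: sets.finite_INT)
  qed
  have covD: "norm y \<le> r * y$3" if y: "y \<in> D" for y
  proof -
    obtain x where "y = f x" using orthogonal_transformation_surj[OF f(1)] by (metis surjD)
    then show ?thesis using cov[of x] y f(2)[of x]
      by (simp add: ip D_def orthogonal_transformation_norm[OF f(1)])
  qed
  define b where "b = f a"
  have b: "b$3 \<le> 0" "b \<noteq> 0"
    using a(2,3) f(2)[of a] orthogonal_transformation_norm[OF f(1), of a] by (auto simp: b_def inner_commute)
  have y3: "0 \<le> y$3" if "y \<in> D" for y
  proof -
    have "0 \<le> r * y$3" using norm_ge_zero covD[OF that] by (rule order_trans)
    then show ?thesis using r by (simp add: zero_le_mult_iff)
  qed
  have yb: "0 \<le> y$1 * b$1 + y$2 * b$2" if "y \<in> D" for y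
  proof -
    have "0 \<le> y \<bullet> b" using that a(1) by (auto simp: D_def b_def)
    moreover have "y$3 * b$3 \<le> 0" using y3[OF that] b(1) by (rule mult_nonneg_nonpos)
    ultimately show ?thesis by (simp add: inner3)
  qed
  define h where "h = 1 / r"
  have h: "0 < h" "h \<le> 1" using r by (auto simp: h_def)
  have s2: "sqrt 2 \<le> pi / 2"
  proof -
    have "sqrt 2 \<le> 3/2" by (rule real_le_lsqrt) (auto simp: power2_eq_square)
    then show ?thesis using pi_gt3 by simp
  qed
  show ?thesis
  proof (cases "b$1 = 0 \<and> b$2 = 0")
    case True
    then have "b$3 < 0" using b by (auto simp: vec_eq_iff forall_3 less_le)
    \<comment> \<open>A constraint pointing straight down and the cap condition together leave only
      the origin.\<close>
    have "D \<subseteq> {x. x \<bullet> hdir 0 = 0}"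
    proof
      fix y assume y: "y \<in> D"
      have "0 \<le> y \<bullet> b" using y a(1) by (auto simp: D_def b_def)
      then have "y$3 \<le> 0" using True \<open>b$3 < 0\<close> by (simp add: inner3 zero_le_mult_iff)
      then have "norm y \<le> 0" using covD[OF y] y3[OF y] by simp
      then show "y \<in> {x. x \<bullet> hdir 0 = 0}" by simp
    qed
    then have "measure sph D = 0" using Db by (intro measure_sph_null_subset[of _ "hdir 0"]) auto
    moreover have "sqrt 2 / r \<le> sqrt 2" using r by (simp add: divide_le_eq)
    ultimately have "0 \<le> pi/2 - sqrt 2 / r" using s2 by linarith
    then show ?thesis using mD \<open>measure sph D = 0\<close> by simp
  next
    case False
    define e where "e = sqrt ((b$1)\<^sup>2 + (b$2)\<^sup>2)"
    have e2: "e\<^sup>2 = (b$1)\<^sup>2 + (b$2)\<^sup>2" by (simp add: e_def)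
    have e: "0 < e" using False by (auto simp: e_def sum_power2_gt_zero_iff)
    have "(b$1 / e)\<^sup>2 + (b$2 / e)\<^sup>2 = 1"
      using e e2 False by (simp add: power_divide flip: add_divide_distrib)
    then obtain c where c: "b$1 / e = cos c" "b$2 / e = sin c" by (metis sincos_total_2pi)
    define R where "R = sqrt (r\<^sup>2 - 1)"
    have "0 \<le> r\<^sup>2 - 1" using r by simp
    then have R: "0 \<le> R" "R\<^sup>2 = r\<^sup>2 - 1" by (simp_all add: R_def)
    \<comment> \<open>Unit normal of the plane that touches the cap in the horizontal direction
      \<open>t\<close>; its half-space contains the cap.\<close>
    define m where "m t = h *\<^sub>R (R *\<^sub>R axis 3 1 - hdir t)" for t
    have mn: "m t $ 1 = - h * cos t" "m t $ 2 = - h * sin t" "m t $ 3 = h * R" for t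
      by (simp_all add: m_def axis_def)
    have hr: "h\<^sup>2 * r\<^sup>2 = 1" using r by (simp add: h_def power_divide)
    have m1: "norm (m t) = 1" for t
    proof -
      have "(norm (m t))\<^sup>2 = h\<^sup>2 * ((cos t)\<^sup>2 + (sin t)\<^sup>2) + h\<^sup>2 * R\<^sup>2"
        by (simp only: norm3_sq mn power_mult_distrib distrib_left power2_minus mult_minus_left)
      also have "\<dots> = 1" by (simp add: R right_diff_distrib hr)
      finally show ?thesis using norm_ge_zero[of "m t"] by (simp add: power2_eq_1_iff)
    qed
    have mpos: "0 \<le> y \<bullet> m t" if y: "y \<in> D" for y t
    proof -
      have "(norm y)\<^sup>2 \<le> (r * y$3)\<^sup>2" using covD[OF y] by (intro power_mono) auto
      then have "(y$1)\<^sup>2 + (y$2)\<^sup>2 \<le> (R * y$3)\<^sup>2"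
        by (simp add: norm3_sq power_mult_distrib R left_diff_distrib)
      moreover have "(y \<bullet> hdir t)\<^sup>2 \<le> (y$1)\<^sup>2 + (y$2)\<^sup>2"
      proof -
        show ?thesis using planar_Cauchy_Schwarz[of "y$1" t "y$2"] by (simp add: inner3)
      qed
      ultimately have "(y \<bullet> hdir t)\<^sup>2 \<le> (R * y$3)\<^sup>2" by linarith
      then have "y \<bullet> hdir t \<le> R * y$3" by (rule power2_le_imp_le) (use R y3[OF y] in simp)
      then show ?thesis using h by (simp add: m_def inner_diff_right inner_axis)
    qed
    have cpos: "0 \<le> y \<bullet> hdir c" if "y \<in> D" for y
    proof -
      have "y \<bullet> hdir c = (y$1 * b$1 + y$2 * b$2) / e" by (simp add: inner3 c[symmetric] add_divide_distrib)
      then show ?thesis using yb[OF that] e by simp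
    qed
    define x where "x = h / sqrt 2"
    have x: "0 \<le> x" "x \<le> 1" "2 * x\<^sup>2 = h\<^sup>2"
    proof -
      have "1 \<le> sqrt 2" by simp
      with h(2) have "h \<le> sqrt 2" by linarith
      then show "0 \<le> x" "x \<le> 1" "2 * x\<^sup>2 = h\<^sup>2"
        using h by (simp_all add: x_def power_divide divide_le_eq)
    qed
    have "h / sqrt 2 = h * (sqrt 2 / 2)" by (simp add: field_simps)
    then have x_alt: "x = h * (sqrt 2 / 2)" unfolding x_def .
    define w where "w = arcsin x"
    have sw: "sin w = x" using x by (simp add: w_def)
    have w: "0 \<le> w" "w \<le> pi/2" using x arcsin_bounded[of x] arcsin_le_mono[of 0 x] by (auto simp: w_def)
    have i1: "hdir c \<bullet> m (c + pi/4) = cos (pi/2 + w)" "hdir c \<bullet> m (c - pi/4) = cos (pi/2 + w)"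
    proof -
      have "hdir c \<bullet> m t = - h * cos (t - c)" for t by (simp add: inner3 mn cos_diff algebra_simps)
      moreover have "cos (pi/2 + w) = - x" by (simp add: cos_add sw)
      ultimately show "hdir c \<bullet> m (c + pi/4) = cos (pi/2 + w)" "hdir c \<bullet> m (c - pi/4) = cos (pi/2 + w)"
        by (simp_all add: cos_45 x_alt)
    qed
    have i2: "m (c + pi/4) \<bullet> m (c - pi/4) = cos (2 * w)"
    proof -
      have "m (c + pi/4) \<bullet> m (c - pi/4) = h\<^sup>2 * cos ((c + pi/4) - (c - pi/4)) + h\<^sup>2 * R\<^sup>2"
        unfolding cos_diff[of "c + pi/4"] inner3 mn by (simp add: power2_eq_square algebra_simps)
      also have "\<dots> = 1 - h\<^sup>2" by (simp add: R right_diff_distrib hr)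
      also have "\<dots> = cos (2 * w)" using x(3) by (simp add: cos_double_sin sw)
      finally show ?thesis .
    qed
    \<comment> \<open>The diametral plane with normal \<open>hdir c\<close> and the tangent planes
      in the directions \<open>c + pi/4\<close> and \<open>c - pi/4\<close> bound the cone over the
      right isosceles triangle.\<close>
    have "measure sph D \<le> measure sph {y. 0 \<le> y \<bullet> hdir c \<and> 0 \<le> y \<bullet> m (c + pi/4) \<and> 0 \<le> y \<bullet> m (c - pi/4)}"
      using cpos mpos by (intro sph.finite_measure_mono) auto
    also have "\<dots> = 1/2 - ((pi/2 + w) + (pi/2 + w) + 2 * w) / (4 * pi)"
      using measure_sph_trihedral[OF norm_hdir m1 m1, of c "c + pi/4" "c - pi/4"] w
      by (simp add: i1 i2 arccos_cos)
    finally have "2 * pi * measure sph D \<le> pi/2 - 2 * w" by (simp add: field_simps)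
    moreover have "x \<le> w" using sin_x_le_x[OF w(1)] sw by simp
    moreover have "2 * x = sqrt 2 / r"
      by (simp add: x_alt h_def)
    ultimately show ?thesis using mD by simp
  qed
qed

subsection \<open>Edges of a polytope with few vertices\<close>

text \<open>When \<open>V\<close> is the vertex set of its hull, these are the edges of the
  polytope, described as exposed faces.\<close>

definition hull_edge :: "(real^3) set \<Rightarrow> real^3 \<Rightarrow> real^3 \<Rightarrow> bool" where
  "hull_edge V v w \<longleftrightarrow> v \<in> V \<and> w \<in> V \<and> v \<noteq> w \<and>
     (\<exists>z. z \<bullet> v = z \<bullet> w \<and> (\<forall>l\<in>V - {v, w}. z \<bullet> l < z \<bullet> v))"

text \<open>For finite \<open>V\<close> this means that \<open>V\<close> is the vertex set of its
  hull.\<close>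

definition convex_independent :: "'a::real_vector set \<Rightarrow> bool" where
  "convex_independent V \<longleftrightarrow> (\<forall>v\<in>V. v \<notin> convex hull (V - {v}))"

lemma hull_edge_sym: "hull_edge V v w \<Longrightarrow> hull_edge V w v"
  unfolding hull_edge_def by (metis doubleton_eq_iff insert_commute)

text \<open>Of two points on one ray from \<open>v\<close>, the nearer is a convex combination of
  \<open>v\<close> and the farther.\<close>

lemma convex_independent_no_three_collinear:
  assumes V: "convex_independent V" and mem: "v \<in> V" "l \<in> V" "m \<in> V" "v \<noteq> l" "v \<noteq> m" "l \<noteq> m"
    and c: "0 < c" "v - l = c *\<^sub>R (v - m)"
  shows False
proof -
  have *: False if mem: "l \<in> V" "v \<in> V - {l}" "m \<in> V - {l}" and c: "0 < c" "c \<le> 1" "v - l = c *\<^sub>R (v - m)" for c l m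
  proof -
    have "l = (1 - c) *\<^sub>R v + c *\<^sub>R m" using c(3) by (simp add: algebra_simps)
    moreover have "(1 - c) *\<^sub>R v + c *\<^sub>R m \<in> convex hull (V - {l})"
      using mem c by (intro convexD[OF convex_convex_hull] hull_inc) auto
    ultimately show False using V mem(1) by (auto simp: convex_independent_def)
  qed
  show False
  proof (cases "c \<le> 1")
    case True
    then show False using *[of l m c] mem c by auto
  next
    case False
    have "v - m = (1 / c) *\<^sub>R (v - l)" using c by simp
    then show False using *[of m l "1 / c"] mem c False by auto
  qed
qed

lemma convex_independent_separate:
  fixes V :: "'a::euclidean_space set"
  assumes "finite V" "convex_independent V" "v \<in> V"
  obtains y where "\<forall>l\<in>V - {v}. y \<bullet> l < y \<bullet> v"
proof -
  have "v \<notin> convex hull (V - {v})" using assms by (simp add: convex_independent_def)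
  moreover have "closed (convex hull (V - {v}))"
    using assms(1) by (simp add: compact_imp_closed finite_imp_compact_convex_hull)
  ultimately obtain a b where ab: "a \<bullet> v < b" "\<forall>x\<in>convex hull (V - {v}). b < a \<bullet> x"
    using separating_hyperplane_closed_point[OF convex_convex_hull] by blast
  have "- a \<bullet> l < - a \<bullet> v" if "l \<in> V - {v}" for l
    using ab(1) bspec[OF ab(2) hull_inc[OF that]] by simp
  then show ?thesis by (intro that[of "- a"]) blast
qed

text \<open>Walking from a point outside the normal cone of a vertex to a generic interior point, one
  enters the cone through the relative interior of a facet, and that facet comes from an edge.\<close>

lemma normal_cone_edges:
  assumes fin: "finite V" and ind: "convex_independent V" and v: "v \<in> V"
  shows "{x. \<forall>l\<in>V. x \<bullet> l \<le> x \<bullet> v} = {x. \<forall>w. hull_edge V v w \<longrightarrow> x \<bullet> w \<le> x \<bullet> v}"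
proof (intro equalityI subsetI)
  fix x assume "x \<in> {x. \<forall>l\<in>V. x \<bullet> l \<le> x \<bullet> v}"
  then show "x \<in> {x. \<forall>w. hull_edge V v w \<longrightarrow> x \<bullet> w \<le> x \<bullet> v}" by (auto simp: hull_edge_def)
next
  fix x assume "x \<in> {x. \<forall>w. hull_edge V v w \<longrightarrow> x \<bullet> w \<le> x \<bullet> v}"
  then have x: "\<And>w. hull_edge V v w \<Longrightarrow> x \<bullet> w \<le> x \<bullet> v" by blast
  define L where "L = V - {v}"
  define q where "q l = v - l" for l
  have fL: "finite L" using fin by (simp add: L_def)
  show "x \<in> {x. \<forall>l\<in>V. x \<bullet> l \<le> x \<bullet> v}"
  proof (rule ccontr)
    assume "x \<notin> {x. \<forall>l\<in>V. x \<bullet> l \<le> x \<bullet> v}"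
    then obtain l0 where l0: "l0 \<in> L" "x \<bullet> q l0 < 0" by (auto simp: L_def q_def inner_diff_right not_le)
    obtain y0 where y0: "\<forall>l\<in>V - {v}. y0 \<bullet> l < y0 \<bullet> v"
      by (rule convex_independent_separate[OF fin ind v])
    \<comment> \<open>The interior of the normal cone, nonempty because \<open>v\<close> is
      exposed.\<close>
    define U where "U = (\<Inter>l\<in>L. {y. 0 < y \<bullet> q l})"
    have oU: "open U" unfolding U_def using fL
      by (intro open_INT ballI) (auto intro!: open_Collect_less continuous_intros)
    have "y0 \<in> U" using y0 by (auto simp: U_def L_def q_def inner_diff_right)
    \<comment> \<open>If \<open>y\<close> is orthogonal to such a vector, the segment from
      \<open>x\<close> to \<open>y\<close> may cross the walls of \<open>l\<close> and
      \<open>m\<close> at the same parameter. Zero vectors are left out here and ruled out later,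
      since they would make \<open>v\<close>, \<open>l\<close>, \<open>m\<close> collinear.\<close>
    define W where "W = (\<lambda>(l, m). (x \<bullet> q l) *\<^sub>R q m - (x \<bullet> q m) *\<^sub>R q l) ` (L \<times> L) - {0}"
    have fW: "finite W" using fL by (simp add: W_def)
    have "negligible (\<Union>w\<in>W. {y. w \<bullet> y = 0})"
      using fW by (intro negligible_Union) (auto simp: W_def intro!: negligible_hyperplane)
    moreover have "\<not> negligible U" using oU \<open>y0 \<in> U\<close> open_not_negligible by blast
    ultimately have "\<not> U \<subseteq> (\<Union>w\<in>W. {y. w \<bullet> y = 0})" using negligible_subset by blast
    then obtain y where y: "y \<in> U" "\<And>w. w \<in> W \<Longrightarrow> w \<bullet> y \<noteq> 0" by blast
    have yq: "0 < y \<bullet> q l" if "l \<in> L" for l using y(1) that by (simp add: U_def)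
    define N where "N = {l \<in> L. x \<bullet> q l < 0}"
    \<comment> \<open>The parameter at which the segment from \<open>x\<close> to \<open>y\<close>
      crosses the wall of \<open>l\<close>. The largest one, at \<open>m\<close>, is where the cone
      is entered.\<close>
    define t where "t l = - (x \<bullet> q l) / (y \<bullet> q l - x \<bullet> q l)" for l
    have fN: "finite N" "N \<noteq> {}" using fL l0 by (auto simp: N_def)
    have "Max (t ` N) \<in> t ` N" using fN by (intro Max_in) auto
    then obtain m where m: "m \<in> N" "t m = Max (t ` N)" by (metis imageE)
    have mL: "m \<in> L" and mneg: "x \<bullet> q m < 0" using m(1) by (auto simp: N_def)
    have tm: "t l \<le> t m" if "l \<in> N" for l unfolding m(2) using fN that by (intro Max_ge) auto
    have pos: "0 < y \<bullet> q l - x \<bullet> q l" if "l \<in> N" for l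
      using that yq[of l] by (auto simp: N_def)
    define z where "z = (1 - t m) *\<^sub>R x + t m *\<^sub>R y"
    have zq: "z \<bullet> q l = (1 - t m) * (x \<bullet> q l) + t m * (y \<bullet> q l)" for l
      by (simp add: z_def inner_add_left)
    have cross: "(y \<bullet> q l - x \<bullet> q l) * (s - t l) = (1 - s) * (x \<bullet> q l) + s * (y \<bullet> q l)" if "l \<in> N" for l s
    proof -
      have "(y \<bullet> q l - x \<bullet> q l) * t l = - (x \<bullet> q l)" using pos[OF that] by (simp add: t_def)
      then show ?thesis by (simp add: algebra_simps)
    qed
    have t01: "0 < t m" "t m < 1"
    proof -
      have "0 < (y \<bullet> q m - x \<bullet> q m) * (1 - t m)" using cross[OF m(1), of 1] yq[OF mL] by simp
      then show "t m < 1" using pos[OF m(1)] by (simp add: zero_less_mult_iff)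
      have "0 < (y \<bullet> q m - x \<bullet> q m) * t m" using cross[OF m(1), of 0] mneg by simp
      then show "0 < t m" using pos[OF m(1)] by (simp add: zero_less_mult_iff)
    qed
    have zm: "z \<bullet> q m = 0" using cross[OF m(1), of "t m"] by (simp add: zq)
    have zl: "0 < z \<bullet> q l" if l: "l \<in> L" "l \<noteq> m" for l
    proof (cases "l \<in> N")
      case False
      then have "0 \<le> x \<bullet> q l" using l by (simp add: N_def)
      then have "0 \<le> (1 - t m) * (x \<bullet> q l)" using t01 by simp
      moreover have "0 < t m * (y \<bullet> q l)" using t01 yq[OF l(1)] by simp
      ultimately show ?thesis by (simp add: zq)
    next
      case True
      have lneg: "x \<bullet> q l < 0" using True by (simp add: N_def)
      have "t l \<noteq> t m"
      proof
        assume e: "t l = t m"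
        then have zl0: "z \<bullet> q l = 0" using cross[OF True, of "t m"] by (simp add: zq)
        define w where "w = (x \<bullet> q l) *\<^sub>R q m - (x \<bullet> q m) *\<^sub>R q l"
        have "t m * (w \<bullet> y) = 0"
        proof -
          have "t m * (y \<bullet> q m) = - ((1 - t m) * (x \<bullet> q m))" "t m * (y \<bullet> q l) = - ((1 - t m) * (x \<bullet> q l))"
            using zm zl0 by (simp_all add: zq)
          moreover have "t m * (w \<bullet> y) = (x \<bullet> q l) * (t m * (y \<bullet> q m)) - (x \<bullet> q m) * (t m * (y \<bullet> q l))"
            by (simp add: w_def inner_diff_left inner_commute algebra_simps)
          ultimately show ?thesis by simp
        qed
        then have "w \<bullet> y = 0" using t01 by simp
        then have "w \<notin> W" using y(2) by blast
        then have "w = 0" using l mL by (force simp: W_def w_def)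
        then have "(x \<bullet> q m) *\<^sub>R q l = (x \<bullet> q l) *\<^sub>R q m" by (simp add: w_def)
        then have "(1 / (x \<bullet> q m)) *\<^sub>R ((x \<bullet> q m) *\<^sub>R q l) = (1 / (x \<bullet> q m)) *\<^sub>R ((x \<bullet> q l) *\<^sub>R q m)" by (rule arg_cong)
        then have "v - l = ((x \<bullet> q l) / (x \<bullet> q m)) *\<^sub>R (v - m)"
          using mneg by (simp add: q_def)
        moreover have "0 < (x \<bullet> q l) / (x \<bullet> q m)" using lneg mneg by (simp add: divide_neg_neg)
        ultimately show False
          using convex_independent_no_three_collinear[OF ind v, of l m] l mL by (auto simp: L_def)
      qed
      then have "0 < t m - t l" using tm[OF True] by simp
      then have "0 < (y \<bullet> q l - x \<bullet> q l) * (t m - t l)" using pos[OF True] by simp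
      then show ?thesis using cross[OF True, of "t m"] by (simp add: zq)
    qed
    have "hull_edge V v m"
      unfolding hull_edge_def
    proof (intro conjI exI[of _ z] ballI)
      show "z \<bullet> v = z \<bullet> m" using zm by (simp add: q_def inner_diff_right)
      show "z \<bullet> l < z \<bullet> v" if "l \<in> V - {v, m}" for l
        using zl[of l] that by (simp add: q_def L_def inner_diff_right)
    qed (use v mL in \<open>auto simp: L_def\<close>)
    then show False using x[of m] mneg by (simp add: q_def inner_diff_right)
  qed
qed

section \<open>Vertex pairs that do not span an edge\<close>

lemma crossing_not_hull_edge:
  assumes "P \<subseteq> V - {v, w}" "convex hull {v, w} \<inter> convex hull P \<noteq> {}"
  shows "\<not> hull_edge V v w"
proof
  assume "hull_edge V v w"
  then obtain z where z: "z \<bullet> v = z \<bullet> w" "\<forall>l\<in>V - {v, w}. z \<bullet> l < z \<bullet> v" by (auto simp: hull_edge_def)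
  obtain p where p: "p \<in> convex hull {v, w}" "p \<in> convex hull P" using assms(2) by blast
  have "convex hull {v, w} \<subseteq> {x. z \<bullet> x = z \<bullet> v}"
    using z(1) by (intro hull_minimal convex_hyperplane) auto
  moreover have "convex hull P \<subseteq> {x. z \<bullet> x < z \<bullet> v}"
    using z(2) assms(1) by (intro hull_minimal convex_halfspace_lt) auto
  ultimately have "z \<bullet> p = z \<bullet> v" "z \<bullet> p < z \<bullet> v" using p by blast+
  then show False by simp
qed

text \<open>Radon splits five points into two parts with intersecting hulls. Convex independence
  forbids a part with a single point, so the smaller part is a pair.\<close>

lemma convex_independent_Radon5:
  fixes V :: "(real^3) set"
  assumes ind: "convex_independent V" and F: "F \<subseteq> V" "card F = 5"
  obtains (result) v w where "v \<in> F" "w \<in> F" "v \<noteq> w" "convex hull {v, w} \<inter> convex hull (F - {v, w}) \<noteq> {}"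
proof -
  have fF: "finite F" using F(2) by (metis card.infinite zero_neq_numeral)
  have "affine_dependent F" using fF F(2) by (intro affine_dependent_biggerset) auto
  from Radon_partition[OF fF this] obtain M P where
    MP: "M \<inter> P = {}" "M \<union> P = F" "convex hull M \<inter> convex hull P \<noteq> {}" by blast
  have *: ?thesis if MP: "M \<inter> P = {}" "M \<union> P = F" "convex hull M \<inter> convex hull P \<noteq> {}" and c: "card M \<le> 2" for M P
  proof -
    have fM: "finite M" using MP fF by auto
    have P: "P = F - M" using MP by auto
    consider "card M = 0" | "card M = 1" | "card M = 2" using c by linarith
    then show ?thesis
    proof cases
      case 1
      then show ?thesis using MP fM by simp
    next
      case 2
      then obtain v where v: "M = {v}" by (rule card_1_singletonE)
      have "convex hull P \<subseteq> convex hull (V - {v})" using P v F by (intro hull_mono) auto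
      then have "v \<in> convex hull (V - {v})" using MP(3) v by auto
      then show ?thesis using ind MP(2) v F(1) by (auto simp: convex_independent_def)
    next
      case 3
      then obtain v w where vw: "M = {v, w}" "v \<noteq> w" by (meson card_2_iff)
      then show ?thesis using result[of v w] MP P by auto
    qed
  qed
  have "card M + card P = 5" using MP fF F(2) by (metis card_Un_disjoint finite_Un)
  then consider "card M \<le> 2" | "card P \<le> 2" by linarith
  then show ?thesis
  proof cases
    case 1
    then show ?thesis by (rule *[OF MP])
  next
    case 2
    then show ?thesis using *[of P M] MP by (simp add: Int_commute Un_commute)
  qed
qed

text \<open>The crossing point has positive weight on \<open>g\<close> or \<open>h\<close>, so
  \<open>z\<close> is larger there than at \<open>c\<close>; one end of the segment must then be
  larger too.\<close>

lemma crossing_segment_level: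
  fixes z :: "'a::real_inner"
  assumes X: "X \<in> convex hull {a, b}" "X \<in> convex hull {c, g, h}" "X \<noteq> c"
    and z: "z \<bullet> g = k" "z \<bullet> h = k" "z \<bullet> c < k"
  shows "z \<bullet> c < max (z \<bullet> a) (z \<bullet> b)"
proof -
  have "convex hull {a, b} \<subseteq> {x. z \<bullet> x \<le> max (z \<bullet> a) (z \<bullet> b)}"
    by (intro hull_minimal convex_halfspace_le) auto
  then have 1: "z \<bullet> X \<le> max (z \<bullet> a) (z \<bullet> b)" using X(1) by blast
  obtain s t u where X': "0 \<le> s" "0 \<le> t" "0 \<le> u" "s + t + u = 1" "X = s *\<^sub>R c + t *\<^sub>R g + u *\<^sub>R h"
    using X(2) unfolding convex_hull_3 by blast
  have "s \<noteq> 1"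
  proof
    assume "s = 1"
    then have "t = 0" "u = 0" using X'(2,3,4) by linarith+
    then have "X = c" using X'(5) \<open>s = 1\<close> by simp
    then show False using X(3) by simp
  qed
  moreover have "s \<le> 1" using X'(2,3,4) by linarith
  ultimately have "0 < 1 - s" by simp
  have "z \<bullet> X = s * (z \<bullet> c) + (t + u) * k" using X' z by (simp add: inner_add_right algebra_simps)
  also have "t + u = 1 - s" using X'(4) by simp
  finally have "z \<bullet> X - z \<bullet> c = (1 - s) * (k - z \<bullet> c)" by (simp add: algebra_simps)
  moreover have "0 < (1 - s) * (k - z \<bullet> c)" using \<open>0 < 1 - s\<close> z(3) by simp
  ultimately show ?thesis using 1 by linarith
qed

text \<open>Ordered pairs, so that the fibre over \<open>v\<close> counts what its degree lacks;
  each missing edge appears twice.\<close>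

definition nonedges :: "(real^3) set \<Rightarrow> ((real^3) \<times> (real^3)) set" where
  "nonedges V = {(v, w). v \<in> V \<and> w \<in> V \<and> v \<noteq> w \<and> \<not> hull_edge V v w}"

lemma finite_nonedges: "finite V \<Longrightarrow> finite (nonedges V)"
  by (rule finite_subset[of _ "V \<times> V"]) (auto simp: nonedges_def)

lemma nonedges_sym: "(v, w) \<in> nonedges V \<Longrightarrow> (w, v) \<in> nonedges V"
  unfolding nonedges_def mem_Collect_eq prod.case by (blast dest: hull_edge_sym)

lemma nonedge_among_five:
  assumes fin: "finite V" and ind: "convex_independent V" and F: "F \<subseteq> V" "5 \<le> card F"
  obtains v w where "v \<in> F" "w \<in> F" "v \<noteq> w" "(v, w) \<in> nonedges V"
proof -
  obtain F' where F': "F' \<subseteq> F" "card F' = 5" by (rule obtain_subset_with_card_n[OF F(2)])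
  obtain v w where vw: "v \<in> F'" "w \<in> F'" "v \<noteq> w" "convex hull {v, w} \<inter> convex hull (F' - {v, w}) \<noteq> {}"
    by (rule convex_independent_Radon5[OF ind order_trans[OF F'(1) F(1)] F'(2)])
  have "\<not> hull_edge V v w" using vw F' F by (intro crossing_not_hull_edge[of "F' - {v, w}"]) auto
  then show ?thesis using that[of v w] vw F' F by (auto simp: nonedges_def)
qed

lemma card_nonedges_5:
  assumes "finite V" "convex_independent V" "card V = 5"
  shows "2 \<le> card (nonedges V)"
proof -
  obtain v w where vw: "v \<noteq> w" "(v, w) \<in> nonedges V"
    by (rule nonedge_among_five[OF assms(1,2), of V]) (use assms in auto)
  then have "{(v, w), (w, v)} \<subseteq> nonedges V" using nonedges_sym[OF vw(2)] by simp
  then have "card {(v, w), (w, v)} \<le> card (nonedges V)" using finite_nonedges[OF assms(1)] by (intro card_mono)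
  then show ?thesis using vw by simp
qed

lemma card_nonedges_ge_6I:
  assumes "finite V" "(a, b) \<in> nonedges V" "(c, d) \<in> nonedges V" "(e, f) \<in> nonedges V"
    "{c, d} \<noteq> {a, b}" "{e, f} \<noteq> {a, b}" "{e, f} \<noteq> {c, d}"
  shows "6 \<le> card (nonedges V)"
proof -
  define E where "E p q = {(p, q), (q, p)}" for p q :: "real^3"
  have E2: "card (E p q) = 2" if "p \<noteq> q" for p q using that by (simp add: E_def)
  have fE: "finite (E p q)" for p q by (simp add: E_def)
  have Em: "{p', q'} = {p, q}" if "(p', q') \<in> E p q" for p q p' q' using that by (auto simp: E_def)
  have Ed: "E p q \<inter> E r s = {}" if "{p, q} \<noteq> {r, s}" for p q r s
  proof (rule ccontr)
    assume "E p q \<inter> E r s \<noteq> {}"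
    then obtain p' q' where "(p', q') \<in> E p q" "(p', q') \<in> E r s" by fast
    from Em[OF this(1)] Em[OF this(2)] show False using that by simp
  qed
  have ne: "a \<noteq> b" "c \<noteq> d" "e \<noteq> f" using assms(2-4) by (simp_all add: nonedges_def)
  have "card (E a b \<union> E c d) = 4"
    using E2[OF ne(1)] E2[OF ne(2)] Ed[OF assms(5)] fE by (subst card_Un_disjoint) (simp_all add: Int_commute)
  moreover have "(E a b \<union> E c d) \<inter> E e f = {}"
    using Ed[OF assms(6)] Ed[OF assms(7)] by blast
  ultimately have "card (E a b \<union> E c d \<union> E e f) = 6"
    using E2[OF ne(3)] fE by (subst card_Un_disjoint) simp_all
  moreover have "E a b \<union> E c d \<union> E e f \<subseteq> nonedges V"
    using assms(2-4) assms(2-4)[THEN nonedges_sym] by (simp add: E_def)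
  ultimately show ?thesis using card_mono[OF finite_nonedges[OF assms(1)]] by metis
qed

text \<open>Deleting one member of each pair found so far forces the next pair to be new, and seven
  vertices leave five after two deletions.\<close>

lemma card_nonedges_ge_7:
  assumes fin: "finite V" and ind: "convex_independent V" and V: "7 \<le> card V"
  shows "6 \<le> card (nonedges V)"
proof -
  obtain a b where ab: "a \<in> V" "b \<in> V" "a \<noteq> b" "(a, b) \<in> nonedges V"
    by (rule nonedge_among_five[OF fin ind, of V]) (use V in auto)
  obtain c d where cd: "c \<in> V - {a}" "d \<in> V - {a}" "c \<noteq> d" "(c, d) \<in> nonedges V"
    by (rule nonedge_among_five[OF fin ind, of "V - {a}"]) (use V fin ab in auto)
  have "card (V - {a, c}) = card V - 2" using ab cd fin by (subst card_Diff_subset) auto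
  then have "5 \<le> card (V - {a, c})" using V by simp
  then obtain e f where ef: "e \<in> V - {a, c}" "f \<in> V - {a, c}" "e \<noteq> f" "(e, f) \<in> nonedges V"
    by (rule nonedge_among_five[OF fin ind Diff_subset])
  show ?thesis by (rule card_nonedges_ge_6I[OF fin ab(4) cd(4) ef(4)]) (use cd ef in auto)
qed

text \<open>Two deletions would leave only four vertices. Instead, suppose that at most
  \<open>{a, b}\<close> and \<open>{c, d}\<close> are missing: the two remaining vertices span an
  edge, and the values of its functional at \<open>a\<close>, \<open>b\<close>, \<open>c\<close>,
  \<open>d\<close> contradict each other.\<close>

lemma card_nonedges_6:
  assumes fin: "finite V" and ind: "convex_independent V" and V: "card V = 6"
  shows "6 \<le> card (nonedges V)"
proof (rule ccontr)
  assume small: "\<not> 6 \<le> card (nonedges V)"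
  obtain a b where ab: "a \<in> V" "b \<in> V" "a \<noteq> b" "(a, b) \<in> nonedges V"
    by (rule nonedge_among_five[OF fin ind, of V]) (use V in auto)
  obtain c d where cd: "c \<in> V - {a}" "d \<in> V - {a}" "c \<noteq> d" "(c, d) \<in> nonedges V"
    by (rule nonedge_among_five[OF fin ind, of "V - {a}"]) (use V fin ab in auto)
  have only: "{e, f} = {a, b} \<or> {e, f} = {c, d}" if "(e, f) \<in> nonedges V" for e f
    using card_nonedges_ge_6I[OF fin ab(4) cd(4) that] small cd by auto
  define cross where "cross x p q \<longleftrightarrow> x \<notin> {p, q} \<and> convex hull {p, q} \<inter> convex hull (V - {x} - {p, q}) \<noteq> {}" for x p q
  \<comment> \<open>Radon applied after deleting \<open>x\<close> gives a crossing pair that avoids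
    \<open>x\<close>. So deleting a member of one pair forces the other pair to cross the triangle
    of the three vertices left.\<close>
  have drop: "cross x a b \<or> cross x c d" if "x \<in> V" for x
  proof -
    have "card (V - {x}) = 5" using that V fin by simp
    then obtain e f where ef: "e \<in> V - {x}" "f \<in> V - {x}" "e \<noteq> f"
      "convex hull {e, f} \<inter> convex hull (V - {x} - {e, f}) \<noteq> {}"
      by (rule convex_independent_Radon5[OF ind Diff_subset])
    have "\<not> hull_edge V e f" using ef by (intro crossing_not_hull_edge[of "V - {x} - {e, f}"]) auto
    then have "(e, f) \<in> nonedges V" using ef by (auto simp: nonedges_def)
    moreover have "x \<notin> {e, f}" using ef by auto
    ultimately show ?thesis using only[of e f] ef(4) unfolding cross_def by metis
  qed
  \<comment> \<open>After deleting \<open>b\<close> only \<open>{c, d}\<close> can be the crossing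
    pair, so the two pairs are disjoint.\<close>
  have b: "b \<notin> {c, d}" using drop[OF ab(2)] by (simp add: cross_def)
  have dist: "a \<noteq> c" "a \<noteq> d" "b \<noteq> c" "b \<noteq> d" using cd b by auto
  have four: "card {a, b, c, d} = 4" using dist ab cd by auto
  have "card (V - {a, b, c, d}) = 2" using four ab cd fin V by (subst card_Diff_subset) auto
  then obtain g h where gh: "V - {a, b, c, d} = {g, h}" "g \<noteq> h" by (meson card_2_iff)
  have Veq: "V = {a, b, c, d, g, h}" and gh2: "g \<notin> {a, b, c, d}" "h \<notin> {a, b, c, d}"
    using gh ab cd by auto
  have "(g, h) \<notin> nonedges V" using only[of g h] gh2 by (auto simp: doubleton_eq_iff)
  then have "hull_edge V g h" using gh(2) Veq by (auto simp: nonedges_def)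
  then obtain z where z: "z \<bullet> g = z \<bullet> h" "\<forall>l\<in>V - {g, h}. z \<bullet> l < z \<bullet> g"
    by (auto simp: hull_edge_def)
  have lev: "z \<bullet> p < max (z \<bullet> p1) (z \<bullet> p2)"
    if p: "p \<in> V" "p1 \<in> V" "p2 \<in> V" "p \<notin> {p1, p2, g, h}" "convex hull {p1, p2} \<inter> convex hull {p, g, h} \<noteq> {}" for p p1 p2
  proof -
    obtain X where X: "X \<in> convex hull {p1, p2}" "X \<in> convex hull {p, g, h}" using p(5) by blast
    have "convex hull {p1, p2} \<subseteq> convex hull (V - {p})" using p by (intro hull_mono) auto
    then have "X \<noteq> p" using X(1) ind p(1) by (auto simp: convex_independent_def)
    moreover have "z \<bullet> p < z \<bullet> g" using z(2) p(1,4) by simp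
    ultimately show ?thesis by (rule crossing_segment_level[OF X _ refl z(1)[symmetric]])
  qed
  have "z \<bullet> c < max (z \<bullet> a) (z \<bullet> b)"
  proof (rule lev)
    have "cross d a b" using drop[of d] ab cd by (auto simp: cross_def)
    moreover have "V - {d} - {a, b} = {c, g, h}" using Veq gh2 dist cd(3) ab(3) by blast
    ultimately show "convex hull {a, b} \<inter> convex hull {c, g, h} \<noteq> {}" by (simp add: cross_def)
  qed (use ab cd dist gh2 in auto)
  moreover have "z \<bullet> d < max (z \<bullet> a) (z \<bullet> b)"
  proof (rule lev)
    have "cross c a b" using drop[of c] ab cd by (auto simp: cross_def)
    moreover have "V - {c} - {a, b} = {d, g, h}" using Veq gh2 dist cd(3) ab(3) by blast
    ultimately show "convex hull {a, b} \<inter> convex hull {d, g, h} \<noteq> {}" by (simp add: cross_def)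
  qed (use ab cd dist gh2 in auto)
  moreover have "z \<bullet> b < max (z \<bullet> c) (z \<bullet> d)"
  proof (rule lev)
    have "cross a c d" using drop[of a] ab cd by (auto simp: cross_def)
    moreover have "V - {a} - {c, d} = {b, g, h}" using Veq gh2 dist cd(3) ab(3) by blast
    ultimately show "convex hull {c, d} \<inter> convex hull {b, g, h} \<noteq> {}" by (simp add: cross_def)
  qed (use ab cd dist gh2 in auto)
  moreover have "z \<bullet> a < max (z \<bullet> c) (z \<bullet> d)"
  proof (rule lev)
    have "cross b c d" using drop[of b] ab cd by (auto simp: cross_def)
    moreover have "V - {b} - {c, d} = {a, g, h}" using Veq gh2 dist cd(3) ab(3) by blast
    ultimately show "convex hull {c, d} \<inter> convex hull {a, g, h} \<noteq> {}" by (simp add: cross_def)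
  qed (use ab cd dist gh2 in auto)
  \<comment> \<open>The larger value on \<open>{c, d}\<close> is below the larger value on
    \<open>{a, b}\<close>, and vice versa.\<close>
  ultimately show False by linarith
qed

subsection \<open>Numerical estimates\<close>

text \<open>The derivative \<open>- t / (t^2 + r^2)\<close> increases with \<open>r\<close>, so the
  function is convex.\<close>

lemma arctan_divide_above_tangent:
  fixes t r s :: real
  assumes "0 < t" "0 < r" "0 < s"
  shows "arctan (t / s) - t / (t\<^sup>2 + s\<^sup>2) * (r - s) \<le> arctan (t / r)"
proof -
  have d: "((\<lambda>r. arctan (t / r)) has_real_derivative - t / (t\<^sup>2 + x\<^sup>2)) (at x)" if "0 < x" for x
  proof -
    have "((\<lambda>r. arctan (t / r)) has_real_derivative (- t / x\<^sup>2) * inverse (1 + (t / x)\<^sup>2)) (at x)"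
      using that by (auto intro!: derivative_eq_intros simp: power2_eq_square)
    moreover have "x\<^sup>2 * (1 + (t / x)\<^sup>2) = t\<^sup>2 + x\<^sup>2"
      using that by (simp add: power_divide distrib_left)
    then have "(- t / x\<^sup>2) * inverse (1 + (t / x)\<^sup>2) = - t / (t\<^sup>2 + x\<^sup>2)"
      by (metis divide_inverse inverse_mult_distrib mult.assoc)
    ultimately show ?thesis by simp
  qed
  have conv: "convex_on {0<..} (\<lambda>r. arctan (t / r))"
  proof (rule convex_on_realI)
    fix x y :: real assume xy: "x \<in> {0<..}" "y \<in> {0<..}" "x \<le> y"
    then have "t / (t\<^sup>2 + y\<^sup>2) \<le> t / (t\<^sup>2 + x\<^sup>2)"
      using assms by (intro divide_left_mono add_left_mono power_mono mult_pos_pos add_pos_pos) auto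
    then show "- t / (t\<^sup>2 + x\<^sup>2) \<le> - t / (t\<^sup>2 + y\<^sup>2)" by simp
  qed (use d in auto)
  have "- t / (t\<^sup>2 + s\<^sup>2) * (r - s) \<le> arctan (t / r) - arctan (t / s)"
    by (rule convex_on_imp_above_tangent[OF conv])
       (use assms d[of s] in \<open>auto simp: interior_open intro: DERIV_subset\<close>)
  then show ?thesis by simp
qed

text \<open>The tangent at \<open>r = T / y\<close>, made independent of its contact point.\<close>

lemma mult_arctan_divide_ge:
  fixes N T a y r :: real
  assumes pos: "0 < N" "0 < T" "0 < y" "0 < r" and y: "N * y\<^sup>2 \<le> a * T * (1 + y\<^sup>2)"
  shows "N * (arctan y + y / (1 + y\<^sup>2)) - a * r \<le> N * arctan (T / r)"
proof -
  define s where "s = T / y"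
  have s: "0 < s" "T / s = y" using pos by (simp_all add: s_def)
  \<comment> \<open>Minus the slope of the tangent at \<open>s\<close>. The hypothesis on
    \<open>y\<close> says that \<open>N * e \<le> a\<close>, so passing to the slope
    \<open>a\<close> only lowers the line for positive \<open>r\<close>.\<close>
  define e where "e = T / (T\<^sup>2 + s\<^sup>2)"
  have p: "0 < 1 + y\<^sup>2" by (simp add: add_pos_nonneg)
  have "T\<^sup>2 + s\<^sup>2 = T\<^sup>2 * (1 + y\<^sup>2) / y\<^sup>2"
    using pos by (simp add: s_def power_divide field_simps)
  then have e_eq: "e = y\<^sup>2 / (T * (1 + y\<^sup>2))"
    using pos by (simp add: e_def power2_eq_square)
  have "N * e \<le> a"
    using y pos p unfolding e_eq by (simp add: divide_le_eq mult.assoc)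
  have "e * s = y / (1 + y\<^sup>2)"
    using pos unfolding e_eq s_def by (simp add: power2_eq_square)
  then have "arctan y + y / (1 + y\<^sup>2) - e * r \<le> arctan (T / r)"
    using arctan_divide_above_tangent[OF pos(2,4) s(1)] unfolding s(2) e_def[symmetric]
    by (simp add: right_diff_distrib)
  then have "N * (arctan y + y / (1 + y\<^sup>2) - e * r) \<le> N * arctan (T / r)"
    using pos by (intro mult_left_mono) auto
  moreover have "N * e * r \<le> a * r" using \<open>N * e \<le> a\<close> pos by (intro mult_right_mono) auto
  ultimately show ?thesis by (simp add: right_diff_distrib mult.assoc)
qed

text \<open>The derivative of the difference is \<open>x^8 / (1 + x^2)\<close>, the tail of the
  geometric series.\<close>

lemma arctan_lower_7:
  fixes y :: real
  assumes "0 \<le> y"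
  shows "y - y^3 / 3 + y^5 / 5 - y^7 / 7 \<le> arctan y"
proof -
  let ?g = "\<lambda>y. arctan y - (y - y^3 / 3 + y^5 / 5 - y^7 / 7)"
  have "?g 0 \<le> ?g y"
  proof (rule DERIV_nonneg_imp_nondecreasing[OF assms])
    fix x :: real
    have p: "0 < 1 + x\<^sup>2" by (simp add: add_pos_nonneg)
    have "(?g has_real_derivative inverse (1 + x\<^sup>2) - (1 - x\<^sup>2 + x^4 - x^6)) (at x)"
      by (auto intro!: derivative_eq_intros)
    moreover have "inverse (1 + x\<^sup>2) - (1 - x\<^sup>2 + x^4 - x^6) = x^8 / (1 + x\<^sup>2)"
    proof -
      have "(1 - x\<^sup>2 + x^4 - x^6) * (1 + x\<^sup>2) = 1 - x^8" by algebra
      then have "1 - x\<^sup>2 + x^4 - x^6 = (1 - x^8) / (1 + x\<^sup>2)" using p by (simp add: eq_divide_eq)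
      then show ?thesis by (simp add: divide_inverse left_diff_distrib)
    qed
    moreover have "0 \<le> x^8 / (1 + x\<^sup>2)" using p by (intro divide_nonneg_pos) auto
    ultimately show "\<exists>z. (?g has_real_derivative z) (at x) \<and> 0 \<le> z"
      by (intro exI[of _ "x^8 / (1 + x\<^sup>2)"]) (simp only: simp_thms)
  qed
  then show ?thesis by simp
qed

lemma tan_pi_fifth_ge: "0.7256 \<le> tan (pi / 5)"
proof -
  define t where "t = pi / 5"
  have s: "0 < sin t" "0 < cos t" using pi_gt_zero by (auto simp: t_def intro!: sin_gt_zero cos_gt_zero)
  \<comment> \<open>This uses \<open>5 * t = pi\<close>. Divided by \<open>sin t\<close> it is a
    quadratic equation for \<open>cos t\<close>, whose root \<open>(1 + sqrt 5) / 4\<close> lies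
    just below 0.8091.\<close>
  have "sin (2 * t) = sin (3 * t)"
  proof -
    have e: "3 * t = pi - 2 * t" by (simp add: t_def)
    show ?thesis unfolding e by simp
  qed
  moreover have "sin (3 * t) = sin t * (4 * (cos t)\<^sup>2 - 1)"
  proof -
    have "sin (3 * t) = sin (2 * t + t)" by simp
    also have "\<dots> = sin t * (2 * (cos t)\<^sup>2 + cos (2 * t))"
      unfolding sin_add sin_double by (simp add: algebra_simps power2_eq_square)
    also have "cos (2 * t) = 2 * (cos t)\<^sup>2 - 1" by (rule cos_double_cos)
    finally show ?thesis by simp
  qed
  ultimately have "sin t * (2 * cos t) = sin t * (4 * (cos t)\<^sup>2 - 1)"
    by (simp add: sin_double)
  then have c: "2 * cos t = 4 * (cos t)\<^sup>2 - 1" using s by simp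
  have "cos t \<le> 0.8091"
  proof (rule ccontr)
    assume "\<not> cos t \<le> 0.8091"
    then have "0 < (cos t - 0.8091) * (4 * cos t + 1.2364)" using s by (intro mult_pos_pos) auto
    also have "(cos t - 0.8091) * (4 * cos t + 1.2364) = 4 * (cos t)\<^sup>2 - 2 * cos t - 0.8091 * 1.2364"
      by (simp add: power2_eq_square algebra_simps)
    finally show False using c by simp
  qed
  then have "(cos t)\<^sup>2 \<le> 0.8091\<^sup>2" using s by (intro power_mono) auto
  then have "(cos t)\<^sup>2 \<le> 0.65465" by (simp add: power_divide)
  then have "0.52649536 * (cos t)\<^sup>2 \<le> (sin t)\<^sup>2" unfolding sin_squared_eq by simp
  then have "(0.7256 * cos t)\<^sup>2 \<le> (sin t)\<^sup>2" by (simp add: power_mult_distrib power_divide)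
  then have "0.7256 * cos t \<le> sin t" by (rule power2_le_imp_le) (use s in auto)
  then show ?thesis using s by (simp add: tan_def t_def le_divide_eq)
qed

text \<open>Moves arguments near one to small ones, where crude bounds are accurate enough.\<close>

lemma arctan_eq_pi4_minus: "0 < y \<Longrightarrow> y < 1 \<Longrightarrow> arctan y = pi/4 - arctan ((1 - y) / (1 + y))" for y :: real
proof -
  assume y: "0 < y" "y < 1"
  have "arctan y + arctan ((1 - y) / (1 + y)) = arctan ((y + (1 - y) / (1 + y)) / (1 - y * ((1 - y) / (1 + y))))"
    using y by (intro arctan_add) (simp_all add: abs_less_iff)
  also have "(y + (1 - y) / (1 + y)) / (1 - y * ((1 - y) / (1 + y))) = 1"
  proof -
    have "1 - y * ((1 - y) / (1 + y)) = (1 + y\<^sup>2) / (1 + y)" "y + (1 - y) / (1 + y) = (1 + y\<^sup>2) / (1 + y)"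
      using y by (simp_all add: field_simps power2_eq_square)
    moreover have "0 < 1 + y\<^sup>2" by (simp add: add_pos_nonneg)
    ultimately show ?thesis using y by simp
  qed
  finally show ?thesis by (simp add: arctan_one)
qed

lemma arctan_eq_pi4_plus: "0 < x \<Longrightarrow> x < 1 \<Longrightarrow> arctan ((1 + x) / (1 - x)) = pi/4 + arctan x" for x :: real
  using arctan_add[of 1 x] by (simp add: arctan_one)

lemma sqrt3_ge: "1.732 \<le> sqrt 3"
  by (rule real_le_rsqrt) (simp add: power2_eq_square)

text \<open>The slopes 0.7, 1 and 1.25 below serve polytopes with at most five, six and seven
  vertices, respectively. The constants are rounded minima, except that for six vertices the line
  for the degree 4 must touch at \<open>r = sqrt 3\<close>, the radius of the regular octahedron.\<close>

lemma centered_bound_3_07: "0 < r \<Longrightarrow> 3.52 - 0.7 * r \<le> 3 * arctan (tan (pi / 3) / r)" for r :: real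
proof -
  assume r: "0 < r"
  have t: "1.73 \<le> tan (pi / 3)" using sqrt3_ge by (simp add: tan_60)
  \<comment> \<open>The constant of \<open>mult_arctan_divide_ge\<close> grows with
    \<open>y\<close>. Here and in the similar bounds below, \<open>y\<close> is a round value under
    the largest one that its hypothesis admits.\<close>
  have "arctan (0.82::real) = pi/4 - arctan (9/91)" using arctan_eq_pi4_minus[of "0.82"] by simp
  moreover have "arctan (9/91::real) \<le> 9/91" by (rule arctan_le_self) simp
  ultimately have "0.6864 \<le> arctan (0.82::real)" using pi_approx(1) by simp
  then have "3.52 - 0.7 * r \<le> 3 * (arctan 0.82 + 0.82 / (1 + 0.82\<^sup>2)) - 0.7 * r" by (simp add: power2_eq_square)
  also have "\<dots> \<le> 3 * arctan (tan (pi / 3) / r)"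
    by (rule mult_arctan_divide_ge) (use t r in \<open>simp_all add: power2_eq_square\<close>)
  finally show ?thesis .
qed

lemma centered_bound_4_07: "0 < r \<Longrightarrow> 3.235 - 0.7 * r \<le> 4 * arctan (tan (pi / 4) / r)" for r :: real
proof -
  assume r: "0 < r"
  have "0.431 \<le> arctan (0.46::real)" using arctan_lower_7[of "0.46"] by (simp add: power_numeral_reduce)
  then have "3.235 - 0.7 * r \<le> 4 * (arctan 0.46 + 0.46 / (1 + 0.46\<^sup>2)) - 0.7 * r" by (simp add: power2_eq_square)
  also have "\<dots> \<le> 4 * arctan (tan (pi / 4) / r)"
    by (rule mult_arctan_divide_ge) (use r in \<open>simp_all add: power2_eq_square tan_45\<close>)
  finally show ?thesis .
qed

text \<open>The amount 0.117 gained here for degree 3 is given away for degree 5, which makes the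
  three bounds of slope 1 linear in the degree.\<close>

lemma centered_bound_3_1: "0 < r \<Longrightarrow> 2*pi/3 + sqrt 3 + 0.117 - r \<le> 3 * arctan (tan (pi / 3) / r)" for r :: real
proof -
  assume r: "0 < r"
  have t: "1.73 \<le> tan (pi / 3)" using sqrt3_ge by (simp add: tan_60)
  have t2: "sqrt 3 \<le> 1.7321" by (rule real_le_lsqrt) (simp_all add: power2_eq_square)
  have "arctan (1.1::real) = pi/4 + arctan (1/21)" using arctan_eq_pi4_plus[of "1/21"] by simp
  moreover have "0.0475 \<le> arctan (1/21::real)" using arctan_lower_7[of "1/21"] by (simp add: power_numeral_reduce)
  ultimately have "pi/4 + 0.0475 \<le> arctan (1.1::real)" by simp
  then have "2*pi/3 + sqrt 3 + 0.117 - 1 * r \<le> 3 * (arctan 1.1 + 1.1 / (1 + 1.1\<^sup>2)) - 1 * r"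
    using t2 pi_approx by (simp add: power2_eq_square)
  also have "\<dots> \<le> 3 * arctan (tan (pi / 3) / r)"
    by (rule mult_arctan_divide_ge) (use t r in \<open>simp_all add: power2_eq_square\<close>)
  finally show ?thesis by simp
qed

lemma centered_bound_4_1: "0 < r \<Longrightarrow> 2*pi/3 + sqrt 3 - r \<le> 4 * arctan (tan (pi / 4) / r)" for r :: real
proof -
  assume r: "0 < r"
  \<comment> \<open>The contact value is \<open>y = 1 / sqrt 3\<close>, that is
    \<open>r = sqrt 3\<close>, and the slope condition holds with equality.\<close>
  have a: "arctan (1 / sqrt 3) = pi / 6" using arctan_tan[of "pi/6"] by (simp add: tan_30)
  have "sqrt 3 / 4 * 4 = 4 * ((1 / sqrt 3) / (1 + (1 / sqrt 3)\<^sup>2))"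
    by (simp add: power_divide real_div_sqrt field_simps)
  then have "2*pi/3 + sqrt 3 - 1 * r = 4 * (arctan (1 / sqrt 3) + (1 / sqrt 3) / (1 + (1 / sqrt 3)\<^sup>2)) - 1 * r"
    by (simp only: a distrib_left)
  also have "\<dots> \<le> 4 * arctan (tan (pi / 4) / r)"
    by (rule mult_arctan_divide_ge) (use r in \<open>simp_all add: power_divide tan_45\<close>)
  finally show ?thesis by simp
qed

lemma centered_bound_5_1: "0 < r \<Longrightarrow> 2*pi/3 + sqrt 3 - 0.117 - r \<le> 5 * arctan (tan (pi / 5) / r)" for r :: real
proof -
  assume r: "0 < r"
  have t2: "sqrt 3 \<le> 1.73206" by (rule real_le_lsqrt) (simp_all add: power2_eq_square)
  have "0.39077 \<le> arctan (0.412::real)" using arctan_lower_7[of "0.412"] by (simp add: power_numeral_reduce)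
  then have "2*pi/3 + sqrt 3 - 0.117 - 1 * r \<le> 5 * (arctan 0.412 + 0.412 / (1 + 0.412\<^sup>2)) - 1 * r"
    using t2 pi_approx by (simp add: power2_eq_square)
  also have "\<dots> \<le> 5 * arctan (tan (pi / 5) / r)"
    by (rule mult_arctan_divide_ge) (use tan_pi_fifth_ge r in \<open>simp_all add: power2_eq_square\<close>)
  finally show ?thesis by simp
qed

text \<open>The constants of slope 1.25 fall by 0.045 from each degree to the next, so that they are
  linear in the degree.\<close>

lemma centered_bound_3_125: "0 < r \<Longrightarrow> 4.197 - 1.25 * r \<le> 3 * arctan (tan (pi / 3) / r)" for r :: real
proof -
  assume r: "0 < r"
  have t: "1.73 \<le> tan (pi / 3)" using sqrt3_ge by (simp add: tan_60)
  have "arctan (1.5::real) = pi/4 + arctan (1/5)" using arctan_eq_pi4_plus[of "1/5"] by simp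
  moreover have "0.197 \<le> arctan (1/5::real)" using arctan_lower_7[of "1/5"] by (simp add: power_numeral_reduce)
  ultimately have "0.98 \<le> arctan (1.5::real)" using pi_approx by simp
  then have "4.197 - 1.25 * r \<le> 3 * (arctan 1.5 + 1.5 / (1 + 1.5\<^sup>2)) - 1.25 * r"
    by (simp add: power2_eq_square)
  also have "\<dots> \<le> 3 * arctan (tan (pi / 3) / r)"
    by (rule mult_arctan_divide_ge) (use t r in \<open>simp_all add: power2_eq_square\<close>)
  finally show ?thesis by simp
qed

lemma centered_bound_4_125: "0 < r \<Longrightarrow> 4.152 - 1.25 * r \<le> 4 * arctan (tan (pi / 4) / r)" for r :: real
proof -
  assume r: "0 < r"
  have "arctan (0.67::real) = pi/4 - arctan (33/167)" using arctan_eq_pi4_minus[of "0.67"] by simp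
  moreover have "arctan (33/167::real) \<le> 33/167" by (rule arctan_le_self) simp
  ultimately have "0.5877 \<le> arctan (0.67::real)" using pi_approx by simp
  then have "4.152 - 1.25 * r \<le> 4 * (arctan 0.67 + 0.67 / (1 + 0.67\<^sup>2)) - 1.25 * r"
    by (simp add: power2_eq_square)
  also have "\<dots> \<le> 4 * arctan (tan (pi / 4) / r)"
    by (rule mult_arctan_divide_ge) (use r in \<open>simp_all add: power2_eq_square tan_45\<close>)
  finally show ?thesis by simp
qed

lemma centered_bound_5_125: "0 < r \<Longrightarrow> 4.107 - 1.25 * r \<le> 5 * arctan (tan (pi / 5) / r)" for r :: real
proof -
  assume r: "0 < r"
  have "0.439 \<le> arctan (0.47::real)" using arctan_lower_7[of "0.47"] by (simp add: power_numeral_reduce)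
  then have "4.107 - 1.25 * r \<le> 5 * (arctan 0.47 + 0.47 / (1 + 0.47\<^sup>2)) - 1.25 * r"
    by (simp add: power2_eq_square)
  also have "\<dots> \<le> 5 * arctan (tan (pi / 5) / r)"
    by (rule mult_arctan_divide_ge) (use tan_pi_fifth_ge r in \<open>simp_all add: power2_eq_square\<close>)
  finally show ?thesis by simp
qed

lemma centered_bound_6_125: "0 < r \<Longrightarrow> 4.062 - 1.25 * r \<le> 6 * arctan (tan (pi / 6) / r)" for r :: real
proof -
  assume r: "0 < r"
  have "1 / sqrt 3 = sqrt 3 / 3" by (simp add: field_simps)
  then have t: "0.5773 \<le> tan (pi / 6)" using sqrt3_ge by (simp add: tan_30)
  have "0.3534 \<le> arctan (0.369::real)" using arctan_lower_7[of "0.369"] by (simp add: power_numeral_reduce)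
  then have "4.062 - 1.25 * r \<le> 6 * (arctan 0.369 + 0.369 / (1 + 0.369\<^sup>2)) - 1.25 * r"
    by (simp add: power2_eq_square)
  also have "\<dots> \<le> 6 * arctan (tan (pi / 6) / r)"
    by (rule mult_arctan_divide_ge) (use t r in \<open>simp_all add: power2_eq_square\<close>)
  finally show ?thesis by simp
qed

text \<open>The arithmetic-geometric mean inequality for \<open>sqrt 2 / r\<close> and
  \<open>a * r\<close>, whose product does not depend on \<open>r\<close>.\<close>

lemma eccentric_bound:
  fixes a m r :: real
  assumes "0 < r" "0 < a" "m\<^sup>2 \<le> 4 * sqrt 2 * a"
  shows "m - a * r \<le> sqrt 2 / r"
proof -
  have "(sqrt 2 / r + a * r)\<^sup>2 = (sqrt 2 / r - a * r)\<^sup>2 + 4 * ((sqrt 2 / r) * (a * r))" by algebra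
  moreover have "(sqrt 2 / r) * (a * r) = sqrt 2 * a" using assms by simp
  ultimately have "m\<^sup>2 \<le> (sqrt 2 / r + a * r)\<^sup>2"
    using assms(3) zero_le_power2[of "sqrt 2 / r - a * r"] by linarith
  then have "m \<le> sqrt 2 / r + a * r" by (rule power2_le_imp_le) (use assms in simp)
  then show ?thesis by simp
qed

lemma sqrt2_ge: "1.41421 \<le> sqrt 2"
  by (rule real_le_rsqrt) (simp add: power2_eq_square)

text \<open>The bound for eccentric cells is free of the degree, so it suffices to compare it with
  the largest constant of each slope, that for degree 3.\<close>

lemma eccentric_bound_07: "0 < r \<Longrightarrow> 3.52 - 0.7 * r \<le> pi/2 + sqrt 2 / r" for r :: real
  using eccentric_bound[of r "0.7" "1.98"] sqrt2_ge pi_approx by (simp add: power2_eq_square)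

lemma eccentric_bound_1: "0 < r \<Longrightarrow> 2*pi/3 + sqrt 3 + 0.117 - r \<le> pi/2 + sqrt 2 / r" for r :: real
proof -
  assume "0 < r"
  have "sqrt 3 \<le> 1.73206" by (rule real_le_lsqrt) (simp_all add: power2_eq_square)
  then show ?thesis
    using eccentric_bound[of r 1 "2.3784"] sqrt2_ge pi_approx \<open>0 < r\<close> by (simp add: power2_eq_square)
qed

lemma eccentric_bound_125: "0 < r \<Longrightarrow> 4.197 - 1.25 * r \<le> pi/2 + sqrt 2 / r" for r :: real
  using eccentric_bound[of r "1.25" "2.65"] sqrt2_ge pi_approx by (simp add: power2_eq_square)

text \<open>The tangent to \<open>1 / r\<close> at \<open>r = 4/3\<close>, the norm at which eight
  caps have exactly the area of the sphere.\<close>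

lemma centered_cap_bound: "0 < r \<Longrightarrow> pi * (3/2 - 9/16 * r) \<le> pi / r" for r :: real
proof -
  assume r: "0 < r"
  have "0 \<le> (3 * r - 4)\<^sup>2 / (16 * r)" using r by (intro divide_nonneg_pos) auto
  also have "(3 * r - 4)\<^sup>2 / (16 * r) = 1 / r - (3/2 - 9/16 * r)"
    using r by (simp add: field_simps power2_eq_square)
  finally show ?thesis using mult_left_mono[of "3/2 - 9/16 * r" "1 / r" pi] by simp
qed

lemma eccentric_cap_bound: "0 < r \<Longrightarrow> pi * (3/2 - 9/16 * r) \<le> pi/2 + sqrt 2 / r" for r :: real
proof -
  assume r: "0 < r"
  have "pi - pi * 9/16 * r \<le> sqrt 2 / r"
    by (rule eccentric_bound)
       (use r sqrt2_ge pi_approx in \<open>auto simp: power2_eq_square intro!: mult_right_mono\<close>)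
  then show ?thesis by (simp add: algebra_simps)
qed

subsection \<open>The spatial case\<close>

text \<open>Otherwise an open half-space with normal \<open>x\<close> would contain the hull but
  miss the point \<open>sgn x\<close> of the ball.\<close>

lemma cball_subset_hull_support:
  fixes V :: "'a::euclidean_space set"
  assumes "cball 0 1 \<subseteq> convex hull V"
  shows "\<exists>v\<in>V. norm x \<le> x \<bullet> v"
proof (rule ccontr)
  assume "\<not> (\<exists>v\<in>V. norm x \<le> x \<bullet> v)"
  then have lt: "x \<bullet> v < norm x" if "v \<in> V" for v using that by (simp add: not_le)
  have "convex hull V \<subseteq> {y. x \<bullet> y < norm x}"
    using lt by (intro hull_minimal convex_halfspace_lt) auto
  moreover have "sgn x \<in> cball 0 1" by (simp add: norm_sgn)
  ultimately have "sgn x \<in> {y. x \<bullet> y < norm x}" using assms by blast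
  moreover have "x \<bullet> sgn x = norm x"
    by (cases "x = 0") (simp_all add: sgn_div_norm power2_norm_eq_inner[symmetric] power2_eq_square)
  ultimately show False by simp
qed

lemma convex_independent_subset:
  fixes V :: "'a::real_vector set"
  assumes "finite V"
  obtains W where "W \<subseteq> V" "convex_independent W" "convex hull W = convex hull V"
proof -
  have "\<exists>W\<subseteq>V. convex_independent W \<and> convex hull W = convex hull V"
    using assms
  proof (induction V rule: finite_psubset_induct)
    case (psubset V)
    show ?case
    proof (cases "convex_independent V")
      case True
      then show ?thesis by blast
    next
      case False
      then obtain v where v: "v \<in> V" "v \<in> convex hull (V - {v})" by (auto simp: convex_independent_def)
      have "V - {v} \<subset> V" using v(1) by blast
      from psubset.IH[OF this] obtain W where
        "W \<subseteq> V - {v}" "convex_independent W" "convex hull W = convex hull (V - {v})" by blast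
      moreover have "convex hull (V - {v}) = convex hull V"
        using hull_redundant[OF v(2)] v(1) by (simp add: insert_absorb)
      ultimately show ?thesis by blast
    qed
  qed
  then show ?thesis using that by blast
qed

definition normal_cone :: "(real^3) set \<Rightarrow> real^3 \<Rightarrow> (real^3) set" where
  "normal_cone V v = {x. \<forall>l\<in>V. x \<bullet> l \<le> x \<bullet> v}"

definition hull_degree :: "(real^3) set \<Rightarrow> real^3 \<Rightarrow> nat" where
  "hull_degree V v = card {w. hull_edge V v w}"

context
  fixes V :: "(real^3) set"
  assumes fin: "finite V" and ind: "convex_independent V" and ball: "cball 0 1 \<subseteq> convex hull V"
begin

lemma finite_hull_edges: "finite {w. hull_edge V v w}"
  by (rule finite_subset[OF _ fin]) (auto simp: hull_edge_def)

lemma card_vertices_ge_4: "4 \<le> card V"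
proof (rule ccontr)
  assume "\<not> 4 \<le> card V"
  then have "interior (convex hull V) = {}" using fin by (intro empty_interior_convex_hull) auto
  moreover have "ball 0 1 \<subseteq> interior (convex hull V)"
    using ball by (intro interior_maximal) auto
  ultimately show False by auto
qed

lemma normal_cone_in_cap: "x \<in> normal_cone V v \<Longrightarrow> norm x \<le> x \<bullet> v"
  using cball_subset_hull_support[OF ball, of x] by (force simp: normal_cone_def)

lemma normal_cone_eq:
  assumes "v \<in> V"
  shows "normal_cone V v = {x. \<forall>a\<in>(\<lambda>w. v - w) ` {w. hull_edge V v w}. 0 \<le> x \<bullet> a}"
  unfolding normal_cone_def normal_cone_edges[OF fin ind assms] by (auto simp: inner_diff_right)

text \<open>A functional exposing \<open>v\<close> is a nonzero element of its normal cone, and by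
  Cauchy-Schwarz the cap of \<open>v\<close> has nonzero elements only if \<open>v\<close> is
  outside the open ball.\<close>

lemma norm_vertex_ge_1:
  assumes "v \<in> V"
  shows "1 \<le> norm v"
proof -
  obtain y where y: "\<forall>l\<in>V - {v}. y \<bullet> l < y \<bullet> v"
    by (rule convex_independent_separate[OF fin ind assms])
  have "card (V - {v}) \<noteq> 0" using card_vertices_ge_4 fin assms by simp
  then have "V - {v} \<noteq> {}" by force
  then have "y \<noteq> 0" using y by auto
  have "y \<bullet> l \<le> y \<bullet> v" if "l \<in> V" for l using y that by (cases "l = v") (auto simp: less_imp_le)
  then have "y \<in> normal_cone V v" by (simp add: normal_cone_def)
  then have "norm y \<le> y \<bullet> v" by (rule normal_cone_in_cap)
  also have "\<dots> \<le> norm y * norm v" by (rule norm_cauchy_schwarz)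
  finally show ?thesis using \<open>y \<noteq> 0\<close> by simp
qed

text \<open>With at most two edge directions some nonzero \<open>a\<close> is orthogonal to all of
  them, and \<open>a\<close> and \<open>- a\<close> both lie in the normal cone. But nonzero
  elements of the cap have positive inner product with \<open>v\<close>.\<close>

lemma hull_degree_ge_3:
  assumes "v \<in> V"
  shows "3 \<le> hull_degree V v"
proof (rule ccontr)
  define A where "A = (\<lambda>w. v - w) ` {w. hull_edge V v w}"
  assume "\<not> 3 \<le> hull_degree V v"
  then have "card A \<le> 2"
    unfolding A_def hull_degree_def using card_image_le[OF finite_hull_edges, of "\<lambda>w. v - w" v] by linarith
  moreover have "dim A \<le> card A" unfolding A_def using finite_hull_edges by (intro dim_le_card') simp
  ultimately have "dim A < DIM(real^3)" by simp
  then obtain a where a: "a \<noteq> 0" "span A \<subseteq> {x. a \<bullet> x = 0}"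
    using lowdim_subset_hyperplane by blast
  have "a \<bullet> x = 0" if "x \<in> A" for x using a(2) span_base[OF that] by blast
  then have "a \<in> normal_cone V v" "- a \<in> normal_cone V v"
    unfolding normal_cone_eq[OF assms] A_def[symmetric] by simp_all
  then have "norm a \<le> a \<bullet> v" "norm (- a) \<le> - a \<bullet> v" using normal_cone_in_cap by blast+
  moreover have "0 < norm a" using a(1) by simp
  ultimately show False by simp
qed

lemma sum_normal_cones: "1 \<le> (\<Sum>v\<in>V. measure sph (normal_cone V v))"
proof -
  have ne: "V \<noteq> {}" using card_vertices_ge_4 by auto
  have b: "normal_cone V v \<in> sets sph" for v
  proof -
    have "normal_cone V v = (\<Inter>l\<in>V. {x. 0 \<le> x \<bullet> (v - l)})" by (auto simp: normal_cone_def inner_diff_right)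
    then show ?thesis using fin ne by (auto intro!: sets.finite_INT)
  qed
  have "(\<Union>v\<in>V. normal_cone V v) = UNIV"
  proof -
    have "\<exists>v\<in>V. \<forall>l\<in>V. x \<bullet> l \<le> x \<bullet> v" for x
    proof -
      have "Max ((\<lambda>v. x \<bullet> v) ` V) \<in> (\<lambda>v. x \<bullet> v) ` V" using fin ne by (intro Max_in) auto
      then obtain v where "v \<in> V" "x \<bullet> v = Max ((\<lambda>v. x \<bullet> v) ` V)" by (metis imageE)
      then show ?thesis using fin by (intro bexI[of _ v]) simp_all
    qed
    then show ?thesis by (auto simp: normal_cone_def)
  qed
  then have "1 = measure sph (\<Union>v\<in>V. normal_cone V v)" by (simp add: measure_sph_UNIV)
  also have "\<dots> \<le> (\<Sum>v\<in>V. measure sph (normal_cone V v))"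
    using fin b by (intro sph.finite_measure_subadditive_finite) auto
  finally show ?thesis .
qed

text \<open>The axis through \<open>v\<close> either satisfies all constraints of the cone strictly,
  which gives both centered bounds, or fails one, which gives the eccentric bound.\<close>

lemma measure_normal_cone:
  assumes v: "v \<in> V"
  defines "m \<equiv> 2 * pi * measure sph (normal_cone V v)" and "k \<equiv> hull_degree V v"
  shows "m \<le> pi - real k * arctan (tan (pi / k) / norm v) \<and> m \<le> pi - pi / norm v
    \<or> m \<le> pi/2 - sqrt 2 / norm v"
proof -
  define A where "A = (\<lambda>w. v - w) ` {w. hull_edge V v w}"
  define u where "u = sgn v"
  have r: "1 \<le> norm v" by (rule norm_vertex_ge_1[OF v])
  then have "norm v \<noteq> 0" by linarith
  then have u: "norm u = 1" and uv: "norm v *\<^sub>R u = v" by (simp_all add: u_def norm_sgn sgn_div_norm)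
  have fA: "finite A" using finite_hull_edges by (simp add: A_def)
  have cA: "card A \<le> k" unfolding A_def k_def hull_degree_def by (rule card_image_le[OF finite_hull_edges])
  have eq: "normal_cone V v = {x. \<forall>a\<in>A. 0 \<le> x \<bullet> a}" unfolding A_def by (rule normal_cone_eq[OF v])
  have cov: "norm x \<le> norm v * (x \<bullet> u)" if "\<forall>a\<in>A. 0 \<le> x \<bullet> a" for x
  proof -
    have "norm x \<le> x \<bullet> v" using that by (intro normal_cone_in_cap) (simp add: eq)
    also have "x \<bullet> v = norm v * (x \<bullet> u)" using inner_scaleR_right[of x "norm v" u] uv by simp
    finally show ?thesis .
  qed
  show ?thesis
  proof (cases "\<forall>a\<in>A. 0 < u \<bullet> a")
    case True
    then have pos: "\<And>a. a \<in> A \<Longrightarrow> 0 < u \<bullet> a" by blast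
    have "0 < norm v" using r by linarith
    note centered = cell_measure_centered[OF fA u pos cov this]
    show ?thesis
      using centered(1)[OF _ _ cA] centered(2) hull_degree_ge_3[OF v] unfolding m_def eq k_def by blast
  next
    case False
    then obtain a where a: "a \<in> A" "u \<bullet> a \<le> 0" by (auto simp: not_less)
    have "a \<noteq> 0" using a(1) by (auto simp: A_def hull_edge_def)
    have "m \<le> pi/2 - sqrt 2 / norm v"
      unfolding m_def eq by (rule cell_measure_eccentric[OF fA u a \<open>a \<noteq> 0\<close> cov r])
    then show ?thesis ..
  qed
qed

lemma sum_codegree: "(\<Sum>v\<in>V. real (card V) - 1 - real (hull_degree V v)) = real (card (nonedges V))"
proof -
  have "nonedges V = Sigma V (\<lambda>v. V - {v} - {w. hull_edge V v w})"
    by (auto simp: nonedges_def)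
  then have "card (nonedges V) = (\<Sum>v\<in>V. card (V - {v} - {w. hull_edge V v w}))"
    using fin by (simp add: card_SigmaI)
  moreover have "real (card (V - {v} - {w. hull_edge V v w})) = real (card V) - 1 - real (hull_degree V v)"
    if v: "v \<in> V" for v
  proof -
    have sub: "{w. hull_edge V v w} \<subseteq> V - {v}" by (auto simp: hull_edge_def)
    have "card (V - {v} - {w. hull_edge V v w}) = card (V - {v}) - hull_degree V v"
      unfolding hull_degree_def by (rule card_Diff_subset[OF finite_hull_edges sub])
    moreover have "hull_degree V v \<le> card (V - {v})"
      unfolding hull_degree_def using fin by (intro card_mono sub) simp
    moreover have "card V = Suc (card (V - {v}))" using fin v by (metis card.remove)
    ultimately show ?thesis by simp
  qed
  ultimately show ?thesis by simp
qed

lemma hull_degree_less: "v \<in> V \<Longrightarrow> hull_degree V v \<le> card V - 1"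
proof -
  assume v: "v \<in> V"
  have "hull_degree V v \<le> card (V - {v})"
    unfolding hull_degree_def using fin by (intro card_mono) (auto simp: hull_edge_def)
  then show ?thesis using v fin by simp
qed

text \<open>Summed over the vertices, the degrees enter only through \<open>sum_codegree\<close>:
  every missing ordered pair is worth \<open>d\<close>. The covering by normal cones bounds the sum
  of their measures from below. The eccentric hypothesis uses the constant of degree 3, the largest
  since \<open>d\<close> is nonnegative.\<close>

lemma sum_norm_vertices_ge:
  assumes centered: "\<And>k r. 3 \<le> k \<Longrightarrow> k < card V \<Longrightarrow> 0 < r \<Longrightarrow>
      c + d * (real (card V) - 1 - real k) - a * r \<le> real k * arctan (tan (pi / k) / r)"
    and eccentric: "\<And>r. 0 < r \<Longrightarrow> c + d * (real (card V) - 4) - a * r \<le> pi/2 + sqrt 2 / r"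
    and d: "0 \<le> d" and N: "N \<le> card (nonedges V)"
  shows "real (card V) * c + d * real N - pi * (real (card V) - 2) \<le> a * (\<Sum>v\<in>V. norm v)"
proof -
  have step: "2 * pi * measure sph (normal_cone V v) \<le> pi - (c + d * (real (card V) - 1 - real (hull_degree V v)) - a * norm v)"
    if v: "v \<in> V" for v
  proof -
    have k: "3 \<le> hull_degree V v" "hull_degree V v < card V"
      using hull_degree_ge_3[OF v] hull_degree_less[OF v] card_vertices_ge_4 by auto
    have r: "0 < norm v" using norm_vertex_ge_1[OF v] by linarith
    have "d * (real (card V) - 1 - real (hull_degree V v)) \<le> d * (real (card V) - 4)"
      using d k by (intro mult_left_mono) auto
    then show ?thesis using measure_normal_cone[OF v] centered[OF k r] eccentric[OF r] by linarith
  qed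
  have "2 * pi * 1 \<le> 2 * pi * (\<Sum>v\<in>V. measure sph (normal_cone V v))"
    using sum_normal_cones by (intro mult_left_mono) auto
  also have "\<dots> = (\<Sum>v\<in>V. 2 * pi * measure sph (normal_cone V v))" by (rule sum_distrib_left)
  also have "\<dots> \<le> (\<Sum>v\<in>V. (pi - c) - d * (real (card V) - 1 - real (hull_degree V v)) + a * norm v)"
    using step by (intro sum_mono) (simp add: algebra_simps)
  also have "\<dots> = real (card V) * (pi - c) - d * real (card (nonedges V)) + a * (\<Sum>v\<in>V. norm v)"
  proof -
    define f where "f v = real (card V) - 1 - real (hull_degree V v)" for v
    have "sum f V = real (card (nonedges V))" using sum_codegree by (simp add: f_def)
    then show ?thesis
      unfolding f_def[symmetric] by (simp add: sum.distrib sum_subtractf flip: sum_distrib_left)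
  qed
  finally have "2 * pi \<le> real (card V) * (pi - c) - d * real (card (nonedges V)) + a * (\<Sum>v\<in>V. norm v)" by simp
  moreover have "d * real N \<le> d * real (card (nonedges V))" using d N by (intro mult_left_mono) auto
  ultimately show ?thesis by (simp add: algebra_simps)
qed

lemma sum_norm_vertices_ge_8:
  assumes "8 \<le> card V"
  shows "32/3 \<le> (\<Sum>v\<in>V. norm v)"
proof -
  have step: "2 * pi * measure sph (normal_cone V v) \<le> pi - pi * (3/2 - 9/16 * norm v)" if v: "v \<in> V" for v
  proof -
    have r: "0 < norm v" using norm_vertex_ge_1[OF v] by linarith
    show ?thesis using measure_normal_cone[OF v] centered_cap_bound[OF r] eccentric_cap_bound[OF r] by linarith
  qed
  have "2 * pi * 1 \<le> 2 * pi * (\<Sum>v\<in>V. measure sph (normal_cone V v))"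
    using sum_normal_cones by (intro mult_left_mono) auto
  also have "\<dots> = (\<Sum>v\<in>V. 2 * pi * measure sph (normal_cone V v))" by (rule sum_distrib_left)
  also have "\<dots> \<le> (\<Sum>v\<in>V. pi * (9/16 * norm v - 1/2))"
    using step by (intro sum_mono) (simp add: algebra_simps)
  also have "\<dots> = pi * (9/16 * (\<Sum>v\<in>V. norm v) - real (card V) / 2)"
    by (simp only: sum_distrib_left[symmetric] sum_subtractf sum_constant) simp
  finally have "2 \<le> 9/16 * (\<Sum>v\<in>V. norm v) - real (card V) / 2" by simp
  moreover have "8 \<le> real (card V)" using assms by simp
  ultimately show ?thesis by linarith
qed

lemma sum_norm_vertices_3d: "6 * sqrt 3 \<le> (\<Sum>v\<in>V. norm v)"
proof -
  have s3: "sqrt 3 \<le> 1.73206" by (rule real_le_lsqrt) (simp_all add: power2_eq_square)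
  consider "card V = 4" | "card V = 5" | "card V = 6" | "card V = 7" | "8 \<le> card V"
    using card_vertices_ge_4 by linarith
  then show ?thesis
  proof cases
    case 1
    \<comment> \<open>All degrees are 3 here, so missing edges need no correction term.\<close>
    have "real (card V) * 3.52 + 0 * real 0 - pi * (real (card V) - 2) \<le> 0.7 * (\<Sum>v\<in>V. norm v)"
    proof (rule sum_norm_vertices_ge)
      fix k :: nat and r :: real assume "3 \<le> k" "k < card V" "0 < r"
      then have "k = 3" using 1 by simp
      then show "3.52 + 0 * (real (card V) - 1 - real k) - 0.7 * r \<le> real k * arctan (tan (pi / k) / r)"
        using centered_bound_3_07[OF \<open>0 < r\<close>] by simp
    qed (use eccentric_bound_07 in auto)
    then show ?thesis using 1 s3 pi_approx by simp
  next
    case 2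
    have "real (card V) * 3.235 + 0.285 * real 2 - pi * (real (card V) - 2) \<le> 0.7 * (\<Sum>v\<in>V. norm v)"
    proof (rule sum_norm_vertices_ge)
      fix k :: nat and r :: real assume "3 \<le> k" "k < card V" "0 < r"
      then have "k = 3 \<or> k = 4" using 2 by auto
      then show "3.235 + 0.285 * (real (card V) - 1 - real k) - 0.7 * r \<le> real k * arctan (tan (pi / k) / r)"
        using centered_bound_3_07[OF \<open>0 < r\<close>] centered_bound_4_07[OF \<open>0 < r\<close>] 2 by auto
    qed (use 2 eccentric_bound_07 card_nonedges_5[OF fin ind] in auto)
    then show ?thesis using 2 s3 pi_approx by simp
  next
    case 3
    \<comment> \<open>Six missing ordered pairs exactly offset the six deductions of 0.117, and the
      left side is \<open>6 * sqrt 3\<close> without loss.\<close>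
    have "real (card V) * (2*pi/3 + sqrt 3 - 0.117) + 0.117 * real 6 - pi * (real (card V) - 2) \<le> 1 * (\<Sum>v\<in>V. norm v)"
    proof (rule sum_norm_vertices_ge)
      fix k :: nat and r :: real assume "3 \<le> k" "k < card V" "0 < r"
      then have "k = 3 \<or> k = 4 \<or> k = 5" using 3 by auto
      then show "2*pi/3 + sqrt 3 - 0.117 + 0.117 * (real (card V) - 1 - real k) - 1 * r \<le> real k * arctan (tan (pi / k) / r)"
        using centered_bound_3_1[OF \<open>0 < r\<close>] centered_bound_4_1[OF \<open>0 < r\<close>] centered_bound_5_1[OF \<open>0 < r\<close>] 3 by auto
    next
      fix r :: real assume "0 < r"
      then show "2*pi/3 + sqrt 3 - 0.117 + 0.117 * (real (card V) - 4) - 1 * r \<le> pi/2 + sqrt 2 / r"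
        using eccentric_bound_1[of r] 3 by simp
    qed (use 3 card_nonedges_6[OF fin ind] in auto)
    then show ?thesis using 3 by simp
  next
    case 4
    \<comment> \<open>The margin is narrow: the resulting bound is about 10.397, while
      \<open>6 * sqrt 3\<close> is about 10.392.\<close>
    have "real (card V) * 4.062 + 0.045 * real 6 - pi * (real (card V) - 2) \<le> 1.25 * (\<Sum>v\<in>V. norm v)"
    proof (rule sum_norm_vertices_ge)
      fix k :: nat and r :: real assume "3 \<le> k" "k < card V" "0 < r"
      then have "k = 3 \<or> k = 4 \<or> k = 5 \<or> k = 6" using 4 by auto
      then show "4.062 + 0.045 * (real (card V) - 1 - real k) - 1.25 * r \<le> real k * arctan (tan (pi / k) / r)"
        using centered_bound_3_125[OF \<open>0 < r\<close>] centered_bound_4_125[OF \<open>0 < r\<close>] centered_bound_5_125[OF \<open>0 < r\<close>] centered_bound_6_125[OF \<open>0 < r\<close>] 4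
        by auto
    next
      fix r :: real assume "0 < r"
      then show "4.062 + 0.045 * (real (card V) - 4) - 1.25 * r \<le> pi/2 + sqrt 2 / r"
        using eccentric_bound_125[of r] 4 by simp
    qed (use 4 card_nonedges_ge_7[OF fin ind] in auto)
    then show ?thesis using 4 s3 pi_approx by simp
  next
    case 5
    then show ?thesis using sum_norm_vertices_ge_8 s3 by simp
  qed
qed

end

lemma sum_norm_3d:
  fixes V :: "(real^3) set"
  assumes "finite V" "cball 0 1 \<subseteq> convex hull V"
  shows "6 * sqrt 3 \<le> (\<Sum>v\<in>V. norm v)"
proof -
  obtain W where W: "W \<subseteq> V" "convex_independent W" "convex hull W = convex hull V"
    by (rule convex_independent_subset[OF assms(1)])
  have "6 * sqrt 3 \<le> (\<Sum>v\<in>W. norm v)"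
    using W assms finite_subset by (intro sum_norm_vertices_3d) auto
  also have "\<dots> \<le> (\<Sum>v\<in>V. norm v)" using W(1) assms(1) by (intro sum_mono2) auto
  finally show ?thesis .
qed

subsection \<open>The planar case\<close>

lemma inverse_cos_above_tangent:
  assumes "0 \<le> x" "x < pi/2" "0 < p" "p < pi/2"
  shows "1 / cos p + sin p / (cos p)\<^sup>2 * (x - p) \<le> 1 / cos x"
proof -
  have c: "0 < cos y" if "y \<in> {0..<pi/2}" for y using that by (intro cos_gt_zero_pi) auto
  have d: "((\<lambda>x. 1 / cos x) has_real_derivative sin y / (cos y)\<^sup>2) (at y)" if y: "y \<in> {0..<pi/2}" for y
    using c[OF y] by (auto intro!: derivative_eq_intros simp: power2_eq_square)
  have conv: "convex_on {0..<pi/2} (\<lambda>x. 1 / cos x)"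
  proof (rule convex_on_realI)
    fix y z assume yz: "y \<in> {0..<pi/2}" "z \<in> {0..<pi/2}" "y \<le> z"
    have "sin y \<le> sin z" using yz by (intro sin_monotone_2pi_le) auto
    moreover have "cos z \<le> cos y" using yz by (intro cos_monotone_0_pi_le) auto
    then have "(cos z)\<^sup>2 \<le> (cos y)\<^sup>2" using c[OF yz(2)] by (intro power_mono) auto
    moreover have "0 \<le> sin z" using yz by (intro sin_ge_zero) auto
    ultimately show "sin y / (cos y)\<^sup>2 \<le> sin z / (cos z)\<^sup>2"
      using c[OF yz(2)] by (intro frac_le) auto
  qed (use d in auto)
  have "sin p / (cos p)\<^sup>2 * (x - p) \<le> 1 / cos x - 1 / cos p"
    by (rule convex_on_imp_above_tangent[OF conv])
       (use assms d[of p] in \<open>auto intro: DERIV_subset\<close>)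
  then show ?thesis by simp
qed

text \<open>The planar cone over an arc, extended vertically, is a wedge in space of angle twice
  \<open>arccos (1 / norm v)\<close>; this lets the spatial measure serve the circle.\<close>

lemma arc_measure:
  fixes v :: "real^3"
  assumes v: "v$3 = 0" "1 \<le> norm v"
  shows "measure sph {x. sqrt ((x$1)\<^sup>2 + (x$2)\<^sup>2) \<le> x \<bullet> v} \<le> arccos (1 / norm v) / pi"
proof -
  define r where "r = norm v"
  define a where "a = arccos (1 / r)"
  have r: "1 \<le> r" using v by (simp add: r_def)
  have "0 \<le> 1 / r" "1 / r \<le> 1" using r by auto
  then have ir: "-1 \<le> 1 / r" "0 \<le> 1 / r" "1 / r \<le> 1" by linarith+
  have ca: "cos a = 1 / r" unfolding a_def by (rule cos_arccos[OF ir(1,3)])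
  have a: "0 \<le> a" "a \<le> pi/2"
    unfolding a_def by (rule arccos_lbound[OF ir(1,3)], rule arccos_le_pi2[OF ir(2,3)])
  have sa: "0 \<le> sin a" using a by (intro sin_ge_zero) auto
  have "(v$1 / r)\<^sup>2 + (v$2 / r)\<^sup>2 = 1"
  proof -
    have "(v$1)\<^sup>2 + (v$2)\<^sup>2 = r\<^sup>2" using norm3_sq[of v] v(1) by (simp add: r_def)
    then show ?thesis using r by (simp add: power_divide flip: add_divide_distrib)
  qed
  then obtain c where c: "v$1 / r = cos c" "v$2 / r = sin c" by (metis sincos_total_2pi)
  have vc: "x \<bullet> v = r * (x \<bullet> hdir c)" for x
    using r v(1) by (simp add: inner3 c[symmetric] field_simps)
  have sub: "{x. sqrt ((x$1)\<^sup>2 + (x$2)\<^sup>2) \<le> x \<bullet> v} \<subseteq>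
    {x. 0 \<le> x \<bullet> hdir (c - a + pi/2) \<and> 0 \<le> x \<bullet> hdir (c + a - pi/2)}"
  proof
    fix x :: "real^3" assume "x \<in> {x. sqrt ((x$1)\<^sup>2 + (x$2)\<^sup>2) \<le> x \<bullet> v}"
    \<comment> \<open>Coordinates along and across \<open>v\<close>, in which membership in the
      wedge reads \<open>\<bar>Y\<bar> * cos a \<le> X * sin a\<close>.\<close>
    define X where "X = x \<bullet> hdir c"
    define Y where "Y = x \<bullet> hdir (c + pi/2)"
    define n where "n = sqrt ((x$1)\<^sup>2 + (x$2)\<^sup>2)"
    have "n \<le> r * X" using \<open>x \<in> _\<close> vc[of x] by (simp add: n_def X_def)
    then have nX: "n * cos a \<le> X" using r by (simp add: ca field_simps)
    have n0: "0 \<le> n" by (simp add: n_def)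
    have "0 \<le> n * cos a" using n0 ca r by (intro mult_nonneg_nonneg) auto
    then have X0: "0 \<le> X" using nX by linarith
    have XY: "X\<^sup>2 + Y\<^sup>2 = n\<^sup>2"
    proof -
      have e: "X = x$1 * cos c + x$2 * sin c" "Y = x$2 * cos c - x$1 * sin c"
        by (simp_all add: X_def Y_def inner3 cos_add sin_add)
      have "X\<^sup>2 + Y\<^sup>2 = ((x$1)\<^sup>2 + (x$2)\<^sup>2) * ((sin c)\<^sup>2 + (cos c)\<^sup>2)"
        unfolding e by algebra
      then show ?thesis by (simp add: n_def)
    qed
    have "(n * cos a)\<^sup>2 \<le> X\<^sup>2" using nX n0 ca r by (intro power_mono) auto
    then have "(X\<^sup>2 + Y\<^sup>2) * (cos a)\<^sup>2 \<le> X\<^sup>2 * ((sin a)\<^sup>2 + (cos a)\<^sup>2)"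
      by (simp add: XY power_mult_distrib)
    then have "Y\<^sup>2 * (cos a)\<^sup>2 \<le> X\<^sup>2 * (sin a)\<^sup>2" unfolding distrib_left distrib_right by linarith
    then have "(\<bar>Y\<bar> * cos a)\<^sup>2 \<le> (X * sin a)\<^sup>2" by (simp add: power_mult_distrib)
    then have "\<bar>Y\<bar> * cos a \<le> X * sin a" by (rule power2_le_imp_le) (use X0 sa in simp)
    moreover have "Y * cos a \<le> \<bar>Y\<bar> * cos a" "- Y * cos a \<le> \<bar>Y\<bar> * cos a"
      using ca r by (intro mult_right_mono; simp)+
    moreover have "x \<bullet> hdir (c - a + pi/2) = X * sin a + Y * cos a"
      "x \<bullet> hdir (c + a - pi/2) = X * sin a - Y * cos a"
      by (simp_all add: X_def Y_def inner3 cos_add sin_add cos_diff sin_diff algebra_simps)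
    ultimately show "x \<in> {x. 0 \<le> x \<bullet> hdir (c - a + pi/2) \<and> 0 \<le> x \<bullet> hdir (c + a - pi/2)}"
      by simp
  qed
  have "hdir (c - a + pi/2) \<bullet> hdir (c + a - pi/2) = cos ((c - a + pi/2) - (c + a - pi/2))"
    unfolding cos_diff[of "c - a + pi/2"] by (simp add: inner3)
  also have "(c - a + pi/2) - (c + a - pi/2) = pi - 2 * a" by simp
  finally have "arccos (hdir (c - a + pi/2) \<bullet> hdir (c + a - pi/2)) = pi - 2 * a"
    using a by (simp only:) (intro arccos_cos, auto)
  then have "measure sph {x. 0 \<le> x \<bullet> hdir (c - a + pi/2) \<and> 0 \<le> x \<bullet> hdir (c + a - pi/2)} = a / pi"
    using measure_sph_wedge[OF norm_hdir norm_hdir, of "c - a + pi/2" "c + a - pi/2"] by (simp add: field_simps)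
  then have "measure sph {x. sqrt ((x$1)\<^sup>2 + (x$2)\<^sup>2) \<le> x \<bullet> v} \<le> a / pi"
    using sub sph.finite_measure_mono[OF sub] by simp
  then show ?thesis by (simp add: a_def r_def)
qed

lemma sum_norm_2d:
  fixes V :: "(real^2) set"
  assumes fin: "finite V" and ball: "cball 0 1 \<subseteq> convex hull V"
  shows "4 * sqrt 2 \<le> sum norm V"
proof -
  define E where "E y = (vector [y$1, y$2, 0] :: real^3)" for y :: "real^2"
  define K where "K v = {x::real^3. sqrt ((x$1)\<^sup>2 + (x$2)\<^sup>2) \<le> x \<bullet> E v}" for v
  have norm2: "norm y = sqrt ((y$1)\<^sup>2 + (y$2)\<^sup>2)" for y :: "real^2"
    by (simp add: norm_vec_def L2_set_def sum_2)
  have nE: "norm (E v) = norm v" for v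
  proof -
    have "(norm (E v))\<^sup>2 = (norm v)\<^sup>2" unfolding norm3_sq by (simp add: E_def norm2)
    then show ?thesis by simp
  qed
  \<comment> \<open>Points of the open unit disc support no direction, and only outside it is
    \<open>arccos (1 / norm v)\<close> meaningful.\<close>
  define W where "W = {v \<in> V. 1 \<le> norm v}"
  have fW: "finite W" using fin by (simp add: W_def)
  have Kb: "K v \<in> sets sph" for v
    unfolding K_def by simp
  have "measure sph UNIV \<le> measure sph ((\<Union>v\<in>W. K v) \<union> {x. x \<bullet> hdir 0 = 0})"
  proof (rule sph.finite_measure_mono)
    have "x \<in> (\<Union>v\<in>W. K v) \<union> {x. x \<bullet> hdir 0 = 0}" for x
    proof (cases "x$1 = 0")
      case True
      then show ?thesis by (simp add: inner3)
    next
      case False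
      define y where "y = (vector [x$1, x$2] :: real^2)"
      have "y \<noteq> 0" using False by (auto simp: y_def vec_eq_iff forall_2)
      obtain v where v: "v \<in> V" "norm y \<le> y \<bullet> v" using cball_subset_hull_support[OF ball, of y] by blast
      have "y \<bullet> v \<le> norm y * norm v" by (rule norm_cauchy_schwarz)
      then have "norm y * 1 \<le> norm y * norm v" using v(2) by simp
      then have "1 \<le> norm v" using \<open>y \<noteq> 0\<close> by simp
      moreover have "x \<in> K v"
        using v(2) unfolding norm2 by (simp add: K_def y_def E_def inner3 inner_vec_def sum_2)
      ultimately show ?thesis using v(1) by (auto simp: W_def)
    qed
    then show "UNIV \<subseteq> (\<Union>v\<in>W. K v) \<union> {x. x \<bullet> hdir 0 = 0}" by blast
  qed (use Kb fW in \<open>auto intro!: sets.finite_UN\<close>)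
  also have "\<dots> \<le> measure sph (\<Union>v\<in>W. K v) + measure sph {x. x \<bullet> hdir 0 = 0}"
    using Kb fW by (intro measure_Un_le) (auto intro!: sets.finite_UN)
  also have "measure sph {x. x \<bullet> hdir 0 = 0} = 0" by (rule measure_sph_hyperplane) simp
  also have "measure sph (\<Union>v\<in>W. K v) + 0 \<le> (\<Sum>v\<in>W. measure sph (K v))"
    using Kb fW by (simp, intro sph.finite_measure_subadditive_finite) auto
  also have "\<dots> \<le> (\<Sum>v\<in>W. arccos (1 / norm v) / pi)"
  proof (rule sum_mono)
    fix v assume "v \<in> W"
    then have "E v $ 3 = 0" "1 \<le> norm (E v)" by (simp_all add: nE W_def) (simp add: E_def)
    from arc_measure[OF this] show "measure sph (K v) \<le> arccos (1 / norm v) / pi"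
      by (simp add: K_def nE)
  qed
  finally have "1 \<le> (\<Sum>v\<in>W. arccos (1 / norm v)) / pi"
    by (simp add: measure_sph_UNIV sum_divide_distrib)
  then have cover: "pi \<le> (\<Sum>v\<in>W. arccos (1 / norm v))" by (simp add: le_divide_eq)
  have tang: "real (card W) * (1 / cos p - sin p / (cos p)\<^sup>2 * p) + sin p / (cos p)\<^sup>2 * pi \<le> sum norm W"
    if p: "0 < p" "p < pi/2" for p
  proof -
    have s: "0 \<le> sin p / (cos p)\<^sup>2" using p by (intro divide_nonneg_nonneg sin_ge_zero) auto
    have "real (card W) * (1 / cos p - sin p / (cos p)\<^sup>2 * p) + sin p / (cos p)\<^sup>2 * pi
      \<le> real (card W) * (1 / cos p - sin p / (cos p)\<^sup>2 * p) + sin p / (cos p)\<^sup>2 * (\<Sum>v\<in>W. arccos (1 / norm v))"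
      using cover s by (intro add_left_mono mult_left_mono)
    also have "\<dots> = (\<Sum>v\<in>W. (1 / cos p - sin p / (cos p)\<^sup>2 * p) + sin p / (cos p)\<^sup>2 * arccos (1 / norm v))"
      by (simp add: sum.distrib sum_distrib_left)
    also have "\<dots> \<le> sum norm W"
    proof (rule sum_mono)
      fix v assume "v \<in> W"
      then have v: "1 \<le> norm v" by (simp add: W_def)
      define x where "x = arccos (1 / norm v)"
      have "0 \<le> 1 / norm v" "1 / norm v \<le> 1" using v by (auto simp: divide_le_eq)
      then have ir: "-1 \<le> 1 / norm v" "0 \<le> 1 / norm v" "1 / norm v \<le> 1" by linarith+
      have cx: "cos x = 1 / norm v" unfolding x_def by (rule cos_arccos[OF ir(1,3)])
      have "0 \<le> x" "x \<le> pi/2"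
        unfolding x_def by (rule arccos_lbound[OF ir(1,3)], rule arccos_le_pi2[OF ir(2,3)])
      moreover have "x \<noteq> pi/2"
      proof
        assume "x = pi/2"
        then have "1 / norm v = 0" using cx cos_pi_half by metis
        then show False using v by auto
      qed
      ultimately have "1 / cos p + sin p / (cos p)\<^sup>2 * (x - p) \<le> 1 / cos x"
        using p by (intro inverse_cos_above_tangent) auto
      then show "(1 / cos p - sin p / (cos p)\<^sup>2 * p) + sin p / (cos p)\<^sup>2 * arccos (1 / norm v) \<le> norm v"
        unfolding cx by (simp add: x_def right_diff_distrib)
    qed
    finally show ?thesis .
  qed
  have s2: "1.41 \<le> sqrt 2" "sqrt 2 \<le> 1.4143"
    by (rule real_le_rsqrt, simp add: power2_eq_square) (rule real_le_lsqrt, simp_all add: power2_eq_square)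
  have "4 * sqrt 2 \<le> sum norm W"
  \<comment> \<open>With four or more points the tangent at \<open>pi/4\<close> is used: its
    constant term per point is positive, so further points only raise the bound. With at most three,
    the term of the tangent at \<open>pi/3\<close> is negative, and the bound is at least 6.\<close>
  proof (cases "4 \<le> card W")
    case True
    have c: "1 / cos (pi/4) = sqrt 2" "sin (pi/4) / (cos (pi/4))\<^sup>2 = sqrt 2"
      by (simp_all add: cos_45 sin_45 power_divide field_simps)
    have "real (card W) * (sqrt 2 - sqrt 2 * (pi/4)) + sqrt 2 * pi \<le> sum norm W"
      using tang[of "pi/4"] unfolding c by simp
    moreover have "4 * (sqrt 2 * (1 - pi/4)) \<le> real (card W) * (sqrt 2 * (1 - pi/4))"
      using True pi_less_4 by (intro mult_right_mono mult_nonneg_nonneg) auto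
    ultimately show ?thesis by (simp add: algebra_simps)
  next
    case False
    have c: "1 / cos (pi/3) = 2" "sin (pi/3) / (cos (pi/3))\<^sup>2 = 2 * sqrt 3"
      by (simp_all add: cos_60 sin_60 power_divide)
    have t: "real (card W) * (2 - 2 * sqrt 3 * (pi/3)) + 2 * sqrt 3 * pi \<le> sum norm W"
      using tang[of "pi/3"] unfolding c by simp
    have "3 * 1 \<le> pi * sqrt 3" using sqrt3_ge pi_gt3 by (intro mult_mono) auto
    then have "3 * (2 - 2 * sqrt 3 * (pi/3)) \<le> real (card W) * (2 - 2 * sqrt 3 * (pi/3))"
      using False by (intro mult_right_mono_neg) auto
    then have "6 \<le> sum norm W" using t by (simp add: algebra_simps)
    then show ?thesis using s2 by simp
  qed
  also have "sum norm W \<le> sum norm V" using fin by (intro sum_mono2) (auto simp: W_def)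
  finally show ?thesis .
qed

subsection \<open>The vertex index of the ball\<close>

lemma body_norm_cball: "body_norm (cball 0 1) x = norm x"
proof -
  have "(x \<in> (\<lambda>y. l *\<^sub>R y) ` cball 0 1) \<longleftrightarrow> norm x \<le> l" if "0 < l" for l
  proof
    assume "x \<in> (\<lambda>y. l *\<^sub>R y) ` cball 0 1"
    then obtain y where "x = l *\<^sub>R y" "y \<in> cball 0 1" by (rule imageE)
    then show "norm x \<le> l" using that by (simp add: mult_left_le)
  next
    assume "norm x \<le> l"
    then have "x = l *\<^sub>R ((1 / l) *\<^sub>R x)" "(1 / l) *\<^sub>R x \<in> cball 0 1" using that by (auto simp: divide_le_eq)
    then show "x \<in> (\<lambda>y. l *\<^sub>R y) ` cball 0 1" by blast
  qed
  then have e: "{l. 0 < l \<and> x \<in> (\<lambda>y. l *\<^sub>R y) ` cball 0 1} = {l. 0 < l \<and> norm x \<le> l}" by blast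
  show ?thesis
  \<comment> \<open>At the origin the infimum over positive scalars is not attained.\<close>
  proof (cases "x = 0")
    case True
    then have "{l. 0 < l \<and> norm x \<le> l} = {0<..}" by auto
    then show ?thesis unfolding body_norm_def e using True by simp
  next
    case False
    then have "{l. 0 < l \<and> norm x \<le> l} = {norm x..}" by (auto intro: less_le_trans[of 0 "norm x"])
    then show ?thesis unfolding body_norm_def e by simp
  qed
qed

lemma vein_cball_le:
  fixes V :: "'a::euclidean_space set"
  assumes "finite V" "cball 0 1 \<subseteq> convex hull V"
  shows "vein (cball (0::'a) 1) \<le> sum norm V"
proof -
  obtain h where h: "bij_betw h {0..<card V} V" using ex_bij_betw_nat_finite[OF assms(1)] by blast
  have "h ` {..<card V} = V" using h by (simp add: bij_betw_def lessThan_atLeast0)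
  moreover have "sum norm V = (\<Sum>i<card V. body_norm (cball 0 1) (h i))"
    using sum.reindex_bij_betw[OF h, of norm] by (simp add: body_norm_cball lessThan_atLeast0)
  ultimately have "sum norm V \<in> {(\<Sum>i<n. body_norm (cball (0::'a) 1) (p i)) | (n::nat) (p::nat \<Rightarrow> 'a).
      cball 0 1 \<subseteq> convex hull (p ` {..<n})}"
    using assms(2) by (intro CollectI exI[of _ "card V"] exI[of _ h]) auto
  then show ?thesis unfolding vein_def
    by (rule cInf_lower) (auto simp: body_norm_cball intro!: bdd_belowI[of _ 0] sum_nonneg)
qed

text \<open>The set \<open>V\<close> shows that the infimum is over a nonempty set. Repetitions in a
  family only increase its sum, so a bound for finite sets suffices.\<close>

lemma vein_cball_ge:
  fixes C :: real
  assumes V: "finite (V :: 'a::euclidean_space set)" "cball 0 1 \<subseteq> convex hull V"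
    and C: "\<And>W :: 'a set. finite W \<Longrightarrow> cball 0 1 \<subseteq> convex hull W \<Longrightarrow> C \<le> sum norm W"
  shows "C \<le> vein (cball (0::'a) 1)"
  unfolding vein_def
proof (rule cInf_greatest)
  obtain h where "bij_betw h {0..<card V} V" using ex_bij_betw_nat_finite[OF V(1)] by blast
  then have "h ` {..<card V} = V" by (simp add: bij_betw_def lessThan_atLeast0)
  then have "cball 0 1 \<subseteq> convex hull (h ` {..<card V})" using V(2) by simp
  then show "{(\<Sum>i<n. body_norm (cball (0::'a) 1) (p i)) | (n::nat) (p::nat \<Rightarrow> 'a).
      cball 0 1 \<subseteq> convex hull (p ` {..<n})} \<noteq> {}" by blast
next
  fix s assume "s \<in> {(\<Sum>i<n. body_norm (cball (0::'a) 1) (p i)) | (n::nat) (p::nat \<Rightarrow> 'a).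
      cball 0 1 \<subseteq> convex hull (p ` {..<n})}"
  then obtain n and p :: "nat \<Rightarrow> 'a" where
    p: "s = (\<Sum>i<n. norm (p i))" "cball 0 1 \<subseteq> convex hull (p ` {..<n})"
    by (auto simp: body_norm_cball)
  have "C \<le> sum norm (p ` {..<n})" by (rule C) (use p in auto)
  also have "\<dots> \<le> (\<Sum>i<n. norm (p i))"
    using sum_image_le[of "{..<n}" norm p] by (simp add: o_def)
  finally show "C \<le> s" using p(1) by simp
qed

text \<open>The vertices lie on the axes at distance \<open>sqrt d\<close>. A functional separating
  a point of the ball would have all coordinates below \<open>- b / sqrt d\<close> in absolute
  value, hence norm at most \<open>- b\<close>, which contradicts Cauchy-Schwarz.\<close>

lemma cross_polytope:
  obtains V :: "(real^'n) set" where "finite V" "cball 0 1 \<subseteq> convex hull V"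
    "sum norm V \<le> 2 * real CARD('n) powr (3/2)"
proof -
  define s where "s = sqrt (real CARD('n))"
  have s: "0 < s" "s * s = real CARD('n)" by (simp_all add: s_def)
  define V where "V = (\<lambda>i. axis i s) ` UNIV \<union> (\<lambda>i. axis i (- s) :: real^'n) ` UNIV"
  have fin: "finite V" by (simp add: V_def)
  have "card V \<le> CARD('n) + CARD('n)"
    unfolding V_def by (rule order_trans[OF card_Un_le]) (intro add_mono card_image_le; simp)
  moreover have nV: "norm v = s" if "v \<in> V" for v using that by (auto simp: V_def norm_eq_sqrt_inner inner_axis_axis s_def)
  ultimately have "sum norm V \<le> real (2 * CARD('n)) * s"
    using s by (simp add: nV mult_right_mono)
  also have "\<dots> = 2 * real CARD('n) powr (3/2)"
  proof -
    have "real CARD('n) * s = real CARD('n) powr 1 * real CARD('n) powr (1/2)"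
      by (simp add: s_def powr_half_sqrt)
    also have "\<dots> = real CARD('n) powr (1 + 1/2)" by (rule powr_add[symmetric])
    finally show ?thesis by simp
  qed
  finally have sum: "sum norm V \<le> 2 * real CARD('n) powr (3/2)" .
  have "x \<in> convex hull V" if x: "x \<in> cball 0 1" for x
  proof (rule ccontr)
    assume "x \<notin> convex hull V"
    moreover have "closed (convex hull V)"
      using fin by (simp add: compact_imp_closed finite_imp_compact_convex_hull)
    ultimately obtain a b where ab: "a \<bullet> x < b" "\<forall>y\<in>convex hull V. b < a \<bullet> y"
      using separating_hyperplane_closed_point[OF convex_convex_hull] by blast
    have i: "\<bar>a$i\<bar> * s < - b" for i
    proof -
      have "b < a \<bullet> axis i s" "b < a \<bullet> axis i (- s)"
        using ab(2) hull_inc[of _ V] by (auto simp: V_def)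
      then show ?thesis by (cases "0 \<le> a$i") (auto simp: inner_axis)
    qed
    have "0 \<le> \<bar>a$undefined\<bar> * s" using s(1) by simp
    then have b: "0 < - b" using i[of undefined] by linarith
    have "(a$i)\<^sup>2 * real CARD('n) \<le> b\<^sup>2" for i
    proof -
      have "(\<bar>a$i\<bar> * s)\<^sup>2 \<le> (- b)\<^sup>2" using i[of i] s(1) by (intro power_mono) auto
      moreover have "s\<^sup>2 = real CARD('n)" by (simp add: s_def)
      ultimately show ?thesis by (simp add: power_mult_distrib)
    qed
    then have "(\<Sum>i\<in>UNIV. (a$i)\<^sup>2 * real CARD('n)) \<le> (\<Sum>i\<in>(UNIV::'n set). b\<^sup>2)" by (intro sum_mono)
    then have "(\<Sum>i\<in>UNIV. (a$i)\<^sup>2) * real CARD('n) \<le> b\<^sup>2 * real CARD('n)"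
      unfolding sum_distrib_right by (simp add: mult.commute)
    then have "(\<Sum>i\<in>UNIV. (a$i)\<^sup>2) \<le> b\<^sup>2" by (rule mult_right_le_imp_le) simp
    then have "(\<Sum>i\<in>UNIV. (a$i)\<^sup>2) \<le> (- b)\<^sup>2" by simp
    then have "(norm a)\<^sup>2 \<le> (- b)\<^sup>2" by (simp add: norm_vec_def L2_set_def sum_nonneg)
    then have "norm a \<le> - b" by (rule power2_le_imp_le) (use b in simp)
    moreover have "- (a \<bullet> x) \<le> norm a * norm x" using norm_cauchy_schwarz[of "- a" x] by simp
    moreover have "norm a * norm x \<le> norm a" using x by (simp add: mult_left_le)
    ultimately show False using ab(1) by linarith
  qed
  then show ?thesis using that[OF fin _ sum] by blast
qed

theorem theoremA:
  assumes "CARD('n::finite) \<ge> 2"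
  shows "real CARD('n) powr (3/2) / sqrt (2 * pi * exp 1) \<le> vein (cball (0 :: real ^ 'n) 1)
       \<and> vein (cball (0 :: real ^ 'n) 1) \<le> 2 * real CARD('n) powr (3/2)
       \<and> (CARD('n) = 2 \<or> CARD('n) = 3 \<longrightarrow>
            vein (cball (0 :: real ^ 'n) 1) = 2 * real CARD('n) powr (3/2))"
proof -
  obtain V :: "(real^'n) set" where V: "finite V" "cball 0 1 \<subseteq> convex hull V"
    "sum norm V \<le> 2 * real CARD('n) powr (3/2)"
    by (rule cross_polytope)
  have upper: "vein (cball (0 :: real ^ 'n) 1) \<le> 2 * real CARD('n) powr (3/2)"
    using vein_cball_le[OF V(1,2)] V(3) by linarith
  have lower: "real CARD('n) powr (3/2) / sqrt (2 * pi * exp 1) \<le> vein (cball (0 :: real ^ 'n) 1)"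
  proof (rule vein_cball_ge[OF V(1,2)])
    fix W :: "(real^'n) set" assume W: "finite W" "cball 0 1 \<subseteq> convex hull W"
    have "DIM(real^'n) = DIM(real^'n ordered_copy)" by (simp only: DIM_cart card_ordered_copy)
    then obtain U :: "(real^'n ordered_copy) set" where "finite U" "cball 0 1 \<subseteq> convex hull U" "sum norm U = sum norm W"
      by (rule hull_isometric_copy[OF W])
    then show "real CARD('n) powr (3/2) / sqrt (2 * pi * exp 1) \<le> sum norm W"
      using sum_norm_ge_general[of U] by (simp add: card_ordered_copy)
  qed
  have tight: "2 * real CARD('n) powr (3/2) \<le> vein (cball (0 :: real ^ 'n) 1)" if d: "CARD('n) = 2 \<or> CARD('n) = 3"
  proof (rule vein_cball_ge[OF V(1,2)])
    fix W :: "(real^'n) set" assume W: "finite W" "cball 0 1 \<subseteq> convex hull W"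
    have powr: "x powr (3/2) = x * sqrt x" if "0 < x" for x :: real
    proof -
      have "x powr (1 + 1/2) = x powr 1 * x powr (1/2)" by (rule powr_add)
      then show ?thesis using that by (simp add: powr_half_sqrt)
    qed
    from d show "2 * real CARD('n) powr (3/2) \<le> sum norm W"
    proof
      assume d2: "CARD('n) = 2"
      have "DIM(real^'n) = DIM(real^2)" unfolding DIM_cart using d2 by simp
      then obtain U :: "(real^2) set" where "finite U" "cball 0 1 \<subseteq> convex hull U" "sum norm U = sum norm W"
        by (rule hull_isometric_copy[OF W])
      then show ?thesis using sum_norm_2d[of U] by (simp add: d2 powr)
    next
      assume d3: "CARD('n) = 3"
      have "DIM(real^'n) = DIM(real^3)" unfolding DIM_cart using d3 by simp
      then obtain U :: "(real^3) set" where "finite U" "cball 0 1 \<subseteq> convex hull U" "sum norm U = sum norm W"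
        by (rule hull_isometric_copy[OF W])
      then show ?thesis using sum_norm_3d[of U] by (simp add: d3 powr)
    qed
  qed
  show ?thesis using upper lower tight by (auto intro: antisym)
qed

end
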